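(* Let $\Gamma$ be a connected leaf-free signed graph with $c(\Gamma)\geq 3$. Then $\eta(\Gamma)=2c(\Gamma)-1$ if and only if $\Gamma$ is a signed graph obtained from a signed tree $T$ with $p(T)=c(\Gamma)$ and $\eta(T)=p(T)-1$ by attaching a signed cycle with nullity $2$ at each leaf of $T$ (i.e., identifying each leaf of $T$ with a vertex of its own, pairwise disjoint, signed cycle of nullity $2$).
   Context: A signed graph $\Gamma=(G,\sigma)$ is a simple finite graph $G$ with a map $\sigma:E(G)\to\{+,-\}$; its adjacency matrix has entry $\sigma(v_iv_j)$ if $v_i\sim v_j$ and $0$ otherwise; $\eta(\Gamma)$ is the multiplicity of the eigenvalue $0$ of this matrix. $c(\Gamma)=|E(G)|-|V(G)|+\omega(G)$ with $\omega(G)$ the number of components. $p(\Gamma)$ is the number of vertices of degree one (leaves); leaf-free means $p(\Gamma)=0$. *)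

theory Defs
  imports "Jordan_Normal_Form.Char_Poly"
begin

section \<open>Signed graphs\<close>

datatype edge_sign = Plus | Minus

primrec sign_val :: "edge_sign \<Rightarrow> real" where
  "sign_val Plus = 1"
| "sign_val Minus = -1"

text \<open>
  Edges are two-element sets of vertices, so loops and parallel edges are impossible.
  The sign map is a total function; its values outside the edge set are irrelevant and
  are never used below.
\<close>

record 'a signed_graph =
  verts :: "'a set"
  edges :: "'a set set"
  esign :: "'a set \<Rightarrow> edge_sign"

definition signed_graph :: "'a signed_graph \<Rightarrow> bool" where
  "signed_graph G \<longleftrightarrow> finite (verts G) \<and> (\<forall>e\<in>edges G. e \<subseteq> verts G \<and> card e = 2)"

definition vdegree :: "'a signed_graph \<Rightarrow> 'a \<Rightarrow> nat" where
  "vdegree G v = card {e \<in> edges G. v \<in> e}"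

definition leaves :: "'a signed_graph \<Rightarrow> 'a set" where
  "leaves G = {v \<in> verts G. vdegree G v = 1}"

definition num_leaves :: "'a signed_graph \<Rightarrow> nat" where
  "num_leaves G = card (leaves G)"

definition leaf_free :: "'a signed_graph \<Rightarrow> bool" where
  "leaf_free G \<longleftrightarrow> num_leaves G = 0"

definition reach_rel :: "'a signed_graph \<Rightarrow> ('a \<times> 'a) set" where
  "reach_rel G =
    {(u, v). u \<in> verts G \<and> v \<in> verts G \<and> (u, v) \<in> {(x, y). {x, y} \<in> edges G}\<^sup>*}"

definition components :: "'a signed_graph \<Rightarrow> 'a set set" where
  "components G = verts G // reach_rel G"

definition connected_graph :: "'a signed_graph \<Rightarrow> bool" where
  "connected_graph G \<longleftrightarrow>
    verts G \<noteq> {} \<and> (\<forall>u\<in>verts G. \<forall>v\<in>verts G. (u, v) \<in> reach_rel G)"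

definition cyclomatic :: "'a signed_graph \<Rightarrow> int" where
  "cyclomatic G = int (card (edges G)) - int (card (verts G)) + int (card (components G))"

section \<open>Cycles and trees\<close>

definition cycle_edges :: "'a list \<Rightarrow> 'a set set" where
  "cycle_edges vs = {{vs ! i, vs ! (Suc i mod length vs)} | i. i < length vs}"

definition signed_cycle :: "'a signed_graph \<Rightarrow> bool" where
  "signed_cycle G \<longleftrightarrow>
    (\<exists>vs. distinct vs \<and> 3 \<le> length vs \<and> verts G = set vs \<and> edges G = cycle_edges vs)"

definition acyclic_graph :: "'a signed_graph \<Rightarrow> bool" where
  "acyclic_graph G \<longleftrightarrow>
    \<not> (\<exists>vs. distinct vs \<and> 3 \<le> length vs \<and> set vs \<subseteq> verts G \<and> cycle_edges vs \<subseteq> edges G)"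

definition signed_tree :: "'a signed_graph \<Rightarrow> bool" where
  "signed_tree G \<longleftrightarrow> signed_graph G \<and> connected_graph G \<and> acyclic_graph G"

section \<open>Adjacency matrix and nullity\<close>

definition adj_entry :: "'a signed_graph \<Rightarrow> 'a \<Rightarrow> 'a \<Rightarrow> real" where
  "adj_entry G u v = (if {u, v} \<in> edges G then sign_val (esign G {u, v}) else 0)"

definition adj_mat :: "'a signed_graph \<Rightarrow> 'a list \<Rightarrow> real mat" where
  "adj_mat G vs = mat (length vs) (length vs) (\<lambda>(i, j). adj_entry G (vs ! i) (vs ! j))"

text \<open>
  The nullity is the multiplicity of 0 as a root of the characteristic polynomial. The
  enumeration of the vertices is arbitrary; \<open>nullity_eq\<close> below shows that the choice
  does not matter.
\<close>

definition nullity :: "'a signed_graph \<Rightarrow> nat" where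
  "nullity G =
    Polynomial.order 0 (char_poly (adj_mat G (SOME vs. distinct vs \<and> set vs = verts G)))"

lemma adj_mat_reorder_similar:
  assumes vs: "distinct vs" and ws: "distinct ws" and eq: "set vs = set ws"
  shows "similar_mat (adj_mat G vs) (adj_mat G ws)"
proof -
  define n where "n = length vs"
  have lv: "length vs = n" and lw: "length ws = n"
    using distinct_card[OF vs] distinct_card[OF ws] eq by (auto simp: n_def)
  define R where "R xs ys = mat n n (\<lambda>(i, j). if xs ! i = ys ! j then 1 else (0::real))"
    for xs ys :: "'a list"
  have entry: "(\<Sum>k = 0..<n. (if x = ys ! k then 1 else (0::real)) * f (ys ! k)) = f x"
    if ys: "distinct ys" "length ys = n" and x: "x \<in> set ys" for x f ys
  proof -
    have "(\<Sum>k = 0..<n. (if x = ys ! k then 1 else 0) * f (ys ! k))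
        = (\<Sum>y\<in>set ys. (if x = y then 1 else 0) * f y)"
      using bij_betw_nth[OF ys(1) refl refl] ys(2)
      by (intro sum.reindex_bij_betw) (simp add: lessThan_atLeast0)
    also have "\<dots> = (\<Sum>y\<in>set ys. if x = y then f y else 0)"
      by (rule sum.cong) auto
    also have "\<dots> = f x"
      using x by (simp add: sum.delta')
    finally show ?thesis .
  qed
  have inv: "R xs ys * R ys xs = 1\<^sub>m n"
    if xs: "distinct xs" "length xs = n" and ys: "distinct ys" "length ys = n"
      and s: "set xs = set ys" for xs ys
  proof (rule eq_matI)
    fix i j assume ij: "i < dim_row (1\<^sub>m n :: real mat)" "j < dim_col (1\<^sub>m n :: real mat)"
    have "(R xs ys * R ys xs) $$ (i, j)
        = (\<Sum>k = 0..<n. (if xs ! i = ys ! k then 1 else 0) * (if ys ! k = xs ! j then 1 else 0))"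
      using ij by (simp add: R_def scalar_prod_def)
    also have "\<dots> = (if xs ! i = xs ! j then 1 else 0)"
      using entry[OF ys, of "xs ! i" "\<lambda>y. if y = xs ! j then 1 else 0"] xs s ij nth_mem[of i xs]
      by simp
    also have "\<dots> = (1\<^sub>m n :: real mat) $$ (i, j)"
      using ij xs by (simp add: nth_eq_iff_index_eq)
    finally show "(R xs ys * R ys xs) $$ (i, j) = 1\<^sub>m n $$ (i, j)" .
  qed (simp_all add: R_def)
  have cR: "R xs ys \<in> carrier_mat n n" for xs ys
    by (simp add: R_def)
  have cA: "adj_mat G vs \<in> carrier_mat n n" "adj_mat G ws \<in> carrier_mat n n"
    by (simp_all add: adj_mat_def lv lw)
  have RA: "R vs ws * adj_mat G ws
      = mat n n (\<lambda>(i, j). adj_entry G (vs ! i) (ws ! j))" (is "_ = ?M")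
  proof (rule eq_matI)
    fix i j assume ij: "i < dim_row ?M" "j < dim_col ?M"
    have "(R vs ws * adj_mat G ws) $$ (i, j)
        = (\<Sum>k = 0..<n. (if vs ! i = ws ! k then 1 else 0) * adj_entry G (ws ! k) (ws ! j))"
      using ij by (simp add: R_def adj_mat_def lw scalar_prod_def)
    also have "\<dots> = adj_entry G (vs ! i) (ws ! j)"
      using entry[OF ws lw, of "vs ! i" "\<lambda>y. adj_entry G y (ws ! j)"] ij eq lv nth_mem[of i vs]
      by simp
    finally show "(R vs ws * adj_mat G ws) $$ (i, j) = ?M $$ (i, j)"
      using ij by simp
  qed (simp_all add: R_def adj_mat_def lw)
  have RAR: "?M * R ws vs = adj_mat G vs"
  proof (rule eq_matI)
    fix i j assume ij: "i < dim_row (adj_mat G vs)" "j < dim_col (adj_mat G vs)"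
    have ij': "i < n" "j < n" using ij by (simp_all add: adj_mat_def lv)
    have "(?M * R ws vs) $$ (i, j)
        = (\<Sum>k = 0..<n. (if vs ! j = ws ! k then 1 else 0) * adj_entry G (vs ! i) (ws ! k))"
      using ij' by (auto simp: R_def scalar_prod_def intro!: sum.cong)
    also have "\<dots> = adj_entry G (vs ! i) (vs ! j)"
      using entry[OF ws lw, of "vs ! j" "adj_entry G (vs ! i)"] ij' eq lv nth_mem[of j vs]
      by simp
    finally show "(?M * R ws vs) $$ (i, j) = adj_mat G vs $$ (i, j)"
      using ij' by (simp add: adj_mat_def lv)
  qed (simp_all add: R_def adj_mat_def lv)
  have "similar_mat_wit (adj_mat G vs) (adj_mat G ws) (R vs ws) (R ws vs)"
    unfolding similar_mat_wit_def
    using cR cA inv[OF vs lv ws lw eq] inv[OF ws lw vs lv eq[symmetric]] RA RAR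
    by (simp add: Let_def)
  then show ?thesis
    unfolding similar_mat_def by blast
qed

lemma nullity_eq:
  assumes "distinct vs" "set vs = verts G"
  shows "nullity G = Polynomial.order 0 (char_poly (adj_mat G vs))"
proof -
  let ?ws = "SOME ws. distinct ws \<and> set ws = verts G"
  have "distinct ?ws \<and> set ?ws = verts G"
    by (rule someI[of _ vs]) (use assms in simp)
  then have "similar_mat (adj_mat G ?ws) (adj_mat G vs)"
    using assms by (intro adj_mat_reorder_similar) auto
  then show ?thesis
    unfolding nullity_def by (simp add: char_poly_similar)
qed

section \<open>Attaching cycles at the leaves of a tree\<close>

text \<open>
  The graph \<open>G\<close> is obtained from \<open>T\<close> by identifying each leaf \<open>l\<close> of \<open>T\<close> with a vertex of
  \<open>C l\<close>. The identification is expressed inside \<open>G\<close>: the pieces are taken after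
  identification, so that \<open>C l\<close> meets \<open>T\<close> in exactly \<open>l\<close> and \<open>G\<close> is the union of the
  pieces. Up to renaming vertices this is the quotient of the disjoint union. The values
  of \<open>C\<close> outside the leaves of \<open>T\<close> are irrelevant.
\<close>

definition attached_at_leaves ::
  "'a signed_graph \<Rightarrow> ('a \<Rightarrow> 'a signed_graph) \<Rightarrow> 'a signed_graph \<Rightarrow> bool" where
  "attached_at_leaves T C G \<longleftrightarrow>
    (\<forall>l\<in>leaves T. verts (C l) \<inter> verts T = {l}) \<and>
    (\<forall>l\<in>leaves T. \<forall>m\<in>leaves T. l \<noteq> m \<longrightarrow> verts (C l) \<inter> verts (C m) = {}) \<and>
    verts G = verts T \<union> (\<Union>l\<in>leaves T. verts (C l)) \<and>
    edges G = edges T \<union> (\<Union>l\<in>leaves T. edges (C l)) \<and>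
    (\<forall>e\<in>edges T. esign G e = esign T e) \<and>
    (\<forall>l\<in>leaves T. \<forall>e\<in>edges (C l). esign G e = esign (C l) e)"

end

theory Submission
  imports Defs "HOL-Library.Function_Algebras"
begin

text \<open>
  For a connected graph put \<open>\<Phi> = \<Sum>v. max (deg v - 2) 0\<close>. Since the degrees sum to twice the
  number of edges, \<open>\<Phi> = 2 c + p - 2\<close> as soon as there is an edge, so the nullity in question is
  \<open>\<Phi> + 1\<close>. Deleting a vertex \<open>b\<close> lowers the nullity by at most one, and raises it by at least
  one if \<open>b\<close> is adjacent to a leaf; comparing this with the change of \<open>\<Phi>\<close> over the components
  that remain gives \<open>\<eta> \<le> \<Phi> + 1\<close> for every connected graph other than a cycle of nullity two.
  If equality holds and there is a leaf, the same comparison at the neighbour of the leaf is tight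
  in every component, and by induction every cycle has nullity two and is joined to the rest by
  a single edge. In the leaf-free case, deleting a suitable non-cut vertex of degree two exhibits one
  such pendant cycle; pruning it lowers \<open>\<eta>\<close> and \<open>\<Phi>\<close> by one and creates a leaf, so all cycles
  are pendant. Pruning all of them leaves the tree, and each pruning costs exactly one in the nullity.
\<close>

section \<open>Dimension of spaces of finitely supported functions\<close>

text \<open>Every graph in the argument is an induced subgraph of one weighted graph, given by its
  vertex set alone, and kernel vectors are extended by zero. Passing to a subgraph therefore changes
  neither the matrix nor the ambient space. The quantity \<Phi> is used instead of c and p because
  it is a sum over vertices, hence additive over the components left by a deletion, and it stays
  meaningful when some of them are isolated vertices. The obstacle is the exceptional case: a cycle
  of nullity two has \<Phi> + 1 = 1, and such cycles do turn up as components inside the induction.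
  They do no harm there because all their vertices have degree two: an edge joining one of them to
  an outside vertex raises \<Phi> by an additional unit, which pays for the surplus nullity. The
  hypothesis c \<ge> 3 gives \<Phi> = 2 c - 2 \<ge> 4. Small c really behaves differently: the
  complete bipartite graph on 2 + 3 vertices, all signs positive, is leaf-free with c = 2 and
  nullity 3 = 2 c - 1, yet contains no two disjoint cycles.\<close>

global_interpretation fv: vector_space "\<lambda>(c::real) (f::'a \<Rightarrow> real) x. c * f x"
  by unfold_locales (simp_all add: fun_eq_iff algebra_simps)

lemma fv_subspaceI:
  fixes U :: "('a \<Rightarrow> real) set"
  assumes "0 \<in> U" "\<And>f g. f \<in> U \<Longrightarrow> g \<in> U \<Longrightarrow> f + g \<in> U"
    "\<And>c f. f \<in> U \<Longrightarrow> (\<lambda>x. c * f x) \<in> U"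
  shows "fv.subspace U"
  using assms by (rule fv.subspaceI)

lemma fv_span_delta:
  fixes f :: "'a \<Rightarrow> real"
  assumes "finite S" "\<forall>v. v \<notin> S \<longrightarrow> f v = 0"
  shows "f \<in> fv.span ((\<lambda>s v. if v = s then 1 else 0) ` S)"
proof -
  let ?d = "\<lambda>s v. if v = s then 1 else (0::real)"
  have "f = (\<Sum>s\<in>S. (\<lambda>x. f s * ?d s x))"
  proof
    fix v
    have app: "(\<Sum>s\<in>S. (\<lambda>x. f s * ?d s x)) v = (\<Sum>s\<in>S. f s * ?d s v)"
      using assms(1) by (induction S rule: finite_induct) auto
    show "f v = (\<Sum>s\<in>S. (\<lambda>x. f s * ?d s x)) v"
      unfolding app using assms by (cases "v \<in> S") (simp_all add: if_distrib cong: if_cong)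
  qed
  also have "\<dots> \<in> fv.span (?d ` S)"
    by (intro fv.span_sum fv.span_scale fv.span_base) auto
  finally show ?thesis .
qed

text \<open>The finite-dimensional space attached to a vertex set. Since functions are total, spaces
  for different vertex sets are subspaces of one another and can be compared by inclusion, without
  embedding maps.\<close>

definition supp_in :: "'a set \<Rightarrow> ('a \<Rightarrow> real) set" where
  "supp_in S = {f. \<forall>v. v \<notin> S \<longrightarrow> f v = 0}"

text \<open>An infinite basis would have cardinality 0, so each dimension argument first secures
  finiteness here.\<close>

lemma finite_independent_supp:
  assumes "finite S" "fv.independent B" "B \<subseteq> supp_in S"
  shows "finite B \<and> card B \<le> card S"
proof -
  let ?D = "(\<lambda>s v. if v = s then 1 else (0::real)) ` S"
  have "B \<subseteq> fv.span ?D"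
    using assms fv_span_delta[OF assms(1)] by (auto simp: supp_in_def)
  then have "finite B \<and> card B \<le> card ?D"
    using assms by (intro fv.independent_span_bound) auto
  then show ?thesis using card_image_le[OF assms(1)] le_trans by blast
qed

lemma dim_mono_supp:
  assumes "finite S" "U \<subseteq> W" "W \<subseteq> supp_in S"
  shows "fv.dim U \<le> fv.dim W"
proof -
  obtain B where B: "B \<subseteq> W" "fv.independent B" "W \<subseteq> fv.span B" "card B = fv.dim W"
    by (rule fv.basis_exists)
  have "finite B" using finite_independent_supp[of S B] B assms by auto
  then show ?thesis using fv.dim_le_card[of U B] B assms by auto
qed

text \<open>Subtracting \<open>\<phi> f / \<phi> u\<close> times \<open>u\<close> moves any
  \<open>f\<close> into the kernel of the functional, so \<open>u\<close> completes a basis of that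
  kernel to one of \<open>U\<close>.\<close>

lemma dim_hyperplane:
  fixes \<phi> :: "('a \<Rightarrow> real) \<Rightarrow> real"
  assumes "finite S" "fv.subspace U" "U \<subseteq> supp_in S"
    and add: "\<And>f g. \<phi> (f + g) = \<phi> f + \<phi> g" and scale: "\<And>c f. \<phi> (\<lambda>x. c * f x) = c * \<phi> f"
    and u: "u \<in> U" "\<phi> u \<noteq> 0"
  shows "fv.dim U = fv.dim {f \<in> U. \<phi> f = 0} + 1"
proof -
  let ?W = "{f \<in> U. \<phi> f = 0}"
  have z: "\<phi> 0 = 0" using scale[of 0 0] by (simp add: zero_fun_def)
  have W: "fv.subspace ?W"
    using assms(2) fv.subspace_0 fv.subspace_add fv.subspace_scale
    by (intro fv_subspaceI) (auto simp: add scale z)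
  obtain B where B: "B \<subseteq> ?W" "fv.independent B" "?W \<subseteq> fv.span B" "card B = fv.dim ?W"
    by (rule fv.basis_exists)
  have fin: "finite B" using finite_independent_supp[of S B] B assms by auto
  have "fv.span B \<subseteq> ?W" using B W by (intro fv.span_minimal) auto
  then have un: "u \<notin> fv.span B" using u by auto
  then have ind: "fv.independent (insert u B)" using B(2) by (rule fv.independent_insertI)
  have "U \<subseteq> fv.span (insert u B)"
  proof
    fix f assume f: "f \<in> U"
    let ?c = "\<phi> f / \<phi> u"
    let ?g = "f + (\<lambda>x. (- ?c) * u x)"
    have "?g \<in> U" using f u assms(2) by (intro fv.subspace_add fv.subspace_scale) auto
    moreover have "\<phi> ?g = 0" unfolding add scale using u by simp
    ultimately have "?g \<in> fv.span B" using B by auto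
    then have "?g \<in> fv.span (insert u B)" using fv.span_mono[of B "insert u B"] by auto
    then have "?g + (\<lambda>x. ?c * u x) \<in> fv.span (insert u B)"
      by (rule fv.span_add[OF _ fv.span_scale[OF fv.span_base[OF insertI1]]])
    moreover have "?g + (\<lambda>x. ?c * u x) = f" by (simp add: fun_eq_iff)
    ultimately show "f \<in> fv.span (insert u B)" by (simp only:)
  qed
  then have "fv.dim U = card (insert u B)"
    using ind B u by (intro fv.dim_unique) auto
  also have "\<dots> = card B + 1" using fin un fv.span_base[of u B] by (subst card_insert_disjoint) auto
  finally show ?thesis using B by simp
qed

lemma dim_direct_sum:
  assumes fin: "finite S" and U: "fv.subspace U" "U \<subseteq> supp_in S" and W: "fv.subspace W" "W \<subseteq> supp_in S"
    and int: "U \<inter> W \<subseteq> {0}"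
  shows "fv.dim {f + g | f g. f \<in> U \<and> g \<in> W} = fv.dim U + fv.dim W"
proof -
  obtain A where A: "A \<subseteq> U" "fv.independent A" "U \<subseteq> fv.span A" "card A = fv.dim U"
    by (rule fv.basis_exists)
  obtain B where B: "B \<subseteq> W" "fv.independent B" "W \<subseteq> fv.span B" "card B = fv.dim W"
    by (rule fv.basis_exists)
  have fA: "finite A" and fB: "finite B"
    using finite_independent_supp[OF fin] A B U W by (meson order_trans)+
  have sA: "fv.span A = U" using A U fv.span_minimal by blast
  have sB: "fv.span B = W" using B W fv.span_minimal by blast
  \<comment> \<open>Elements of \<open>B\<close> are added one at a time. If \<open>b\<close>
    depended on the earlier ones, its part in \<open>U\<close> would be a difference of elements of
    \<open>W\<close>, hence 0, contradicting the independence of \<open>B\<close>.\<close>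
  have ind: "fv.independent (A \<union> B')" if "B' \<subseteq> B" for B'
  proof -
    have "finite B'" using that fB finite_subset by auto
    then show ?thesis using that
    proof (induction B' rule: finite_induct)
      case empty then show ?case using A by simp
    next
      case (insert b B')
      have "b \<notin> fv.span (A \<union> B')"
      proof
        assume "b \<in> fv.span (A \<union> B')"
        then obtain f g where fg: "b = f + g" "f \<in> U" "g \<in> fv.span B'"
          unfolding fv.span_Un sA by auto
        have "b \<in> W" "g \<in> W" using insert.prems B fg(3) sB fv.span_mono[of B' B] by auto
        then have "f \<in> W" using fg(1) fv.subspace_diff[OF W(1), of b g] by simp
        then have "f = 0" using int fg by auto
        then have "b \<in> fv.span B'" using fg by simp
        moreover have "fv.independent (insert b B')"
          using insert.prems B(2) fv.independent_mono by blast
        ultimately show False using insert.hyps by (simp add: fv.independent_insert)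
      qed
      then show ?case using insert fv.independent_insertI[of b "A \<union> B'"] by simp
    qed
  qed
  have disj: "A \<inter> B = {}"
  proof (rule ccontr)
    assume "A \<inter> B \<noteq> {}"
    then have "0 \<in> A" using A B int by auto
    then show False using A fv.dependent_zero by blast
  qed
  have "fv.dim {f + g | f g. f \<in> U \<and> g \<in> W} = card (A \<union> B)"
  proof (rule fv.dim_unique[OF _ _ ind refl])
    show "A \<union> B \<subseteq> {f + g |f g. f \<in> U \<and> g \<in> W}"
    proof
      fix x assume "x \<in> A \<union> B"
      then have "x = x + 0 \<and> x \<in> U \<or> x = 0 + x \<and> x \<in> W" using A(1) B(1) by auto
      then show "x \<in> {f + g |f g. f \<in> U \<and> g \<in> W}"
        using fv.subspace_0[OF U(1)] fv.subspace_0[OF W(1)] by blast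
    qed
    show "{f + g |f g. f \<in> U \<and> g \<in> W} \<subseteq> fv.span (A \<union> B)"
      unfolding fv.span_Un sA sB by auto
  qed simp
  then show ?thesis using card_Un_disjoint[OF fA fB disj] A B by simp
qed

section \<open>The nullity as a kernel dimension\<close>

definition kern :: "('a \<Rightarrow> 'a \<Rightarrow> real) \<Rightarrow> 'a set \<Rightarrow> ('a \<Rightarrow> real) set" where
  "kern a S = {f \<in> supp_in S. \<forall>v\<in>S. (\<Sum>u\<in>S. a v u * f u) = 0}"

definition eta :: "('a \<Rightarrow> 'a \<Rightarrow> real) \<Rightarrow> 'a set \<Rightarrow> nat" where
  "eta a S = fv.dim (kern a S)"

lemma kern_supp: "kern a S \<subseteq> supp_in S"
  by (auto simp: kern_def)

lemma kern_subspace: "fv.subspace (kern a S)"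
proof (rule fv_subspaceI)
  fix c f assume f: "f \<in> kern a S"
  have "(\<Sum>u\<in>S. a v u * (c * f u)) = c * (\<Sum>u\<in>S. a v u * f u)" for v
    by (simp add: sum_distrib_left algebra_simps)
  then show "(\<lambda>x. c * f x) \<in> kern a S" using f by (simp add: kern_def supp_in_def)
qed (simp_all add: kern_def supp_in_def algebra_simps sum.distrib)

lemma kern_cong:
  assumes "\<And>u v. u \<in> S \<Longrightarrow> v \<in> S \<Longrightarrow> a u v = b u v"
  shows "kern a S = kern b S"
  using assms by (simp add: kern_def)

lemma eta_cong:
  assumes "\<And>u v. u \<in> S \<Longrightarrow> v \<in> S \<Longrightarrow> a u v = b u v"
  shows "eta a S = eta b S"
  unfolding eta_def using kern_cong[of S a b] assms by simp

text \<open>The zero columns make the characteristic matrix block upper triangular, with X times the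
  identity in the upper left corner.\<close>

lemma char_poly_zero_cols:
  fixes M :: "real mat"
  assumes M: "M \<in> carrier_mat n n" and k: "k \<le> n"
    and z: "\<And>i j. i < n \<Longrightarrow> j < k \<Longrightarrow> M $$ (i, j) = 0"
  defines "D \<equiv> mat (n - k) (n - k) (\<lambda>(i, j). M $$ (i + k, j + k))"
  shows "char_poly M = [:0, 1:] ^ k * char_poly D"
proof -
  let ?X = "[:0, 1:] \<cdot>\<^sub>m 1\<^sub>m k :: real poly mat"
  let ?B = "mat k (n - k) (\<lambda>(i, j). [:- M $$ (i, j + k):])"
  have "char_poly_matrix M = four_block_mat ?X ?B (0\<^sub>m (n - k) k) (char_poly_matrix D)"
  proof (rule eq_matI)
    fix i j
    assume "i < dim_row (four_block_mat ?X ?B (0\<^sub>m (n - k) k) (char_poly_matrix D))"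
      "j < dim_col (four_block_mat ?X ?B (0\<^sub>m (n - k) k) (char_poly_matrix D))"
    then have ij: "i < n" "j < n" using k by (auto simp: char_poly_matrix_def D_def)
    then show "char_poly_matrix M $$ (i, j)
        = four_block_mat ?X ?B (0\<^sub>m (n - k) k) (char_poly_matrix D) $$ (i, j)"
      using M z k by (auto simp: char_poly_matrix_def D_def)
  qed (use M k in \<open>auto simp: char_poly_matrix_def D_def\<close>)
  then have "char_poly M = det ?X * det (char_poly_matrix D)"
    unfolding char_poly_def
    by (simp add: det_four_block_mat_lower_left_zero[of _ k _ "n - k"] D_def)
  then show ?thesis by (simp add: char_poly_def det_smult)
qed

text \<open>With g = A f, symmetry gives <g, g> = <f, A g> = 0, and over the reals this forces g =
  0. So 0 has no generalised eigenvectors beyond the kernel.\<close>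

lemma symmetric_kern_square:
  fixes a :: "'a \<Rightarrow> 'a \<Rightarrow> real"
  assumes fin: "finite S" and sym: "\<And>u v. u \<in> S \<Longrightarrow> v \<in> S \<Longrightarrow> a u v = a v u"
    and f: "f \<in> supp_in S"
    and g: "\<And>v. v \<in> S \<Longrightarrow> (\<Sum>u\<in>S. a v u * (\<Sum>w\<in>S. a u w * f w)) = 0"
  shows "f \<in> kern a S"
proof -
  let ?g = "\<lambda>u. \<Sum>w\<in>S. a u w * f w"
  have "(\<Sum>u\<in>S. ?g u * ?g u) = (\<Sum>u\<in>S. \<Sum>w\<in>S. f w * (a u w * ?g u))"
    by (simp add: sum_distrib_right algebra_simps)
  also have "\<dots> = (\<Sum>w\<in>S. \<Sum>u\<in>S. f w * (a u w * ?g u))" by (rule sum.swap)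
  also have "\<dots> = (\<Sum>w\<in>S. f w * (\<Sum>u\<in>S. a w u * ?g u))"
    unfolding sum_distrib_left by (intro sum.cong refl) (simp add: sym)
  also have "\<dots> = 0" using g by simp
  finally have "(\<Sum>u\<in>S. ?g u * ?g u) = 0" .
  then have "\<forall>u\<in>S. ?g u = 0" using fin by (simp add: sum_nonneg_eq_0_iff)
  then show ?thesis using f by (simp add: kern_def)
qed

text \<open>In a basis that begins with a basis of the kernel, the matrix has exactly
  \<open>k\<close> leading zero columns. It remains to see that the complementary block
  \<open>D\<close> is invertible, which is where symmetry enters: otherwise algebraic and geometric
  multiplicity could differ.\<close>

lemma order_char_poly_eq_eta:
  fixes a :: "'a \<Rightarrow> 'a \<Rightarrow> real"
  assumes vs: "distinct vs" and sym: "\<And>u v. u \<in> set vs \<Longrightarrow> v \<in> set vs \<Longrightarrow> a u v = a v u"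
  defines "A \<equiv> mat (length vs) (length vs) (\<lambda>(i, j). a (vs ! i) (vs ! j))"
  shows "Polynomial.order 0 (char_poly A) = eta a (set vs)"
proof -
  define n where "n = length vs"
  let ?S = "set vs"
  have A: "A \<in> carrier_mat n n" by (simp add: A_def n_def)
  have sumS: "(\<Sum>u\<in>?S. h u) = (\<Sum>i<n. h (vs ! i))" for h :: "'a \<Rightarrow> real"
    using sum.reindex_bij_betw[OF bij_betw_nth[OF vs refl refl], of h] by (simp add: n_def)
  obtain B0 where B0: "B0 \<subseteq> kern a ?S" "fv.independent B0" "kern a ?S \<subseteq> fv.span B0"
      "card B0 = fv.dim (kern a ?S)"
    by (rule fv.basis_exists)
  obtain B where B: "B0 \<subseteq> B" "B \<subseteq> supp_in ?S" "fv.independent B" "supp_in ?S \<subseteq> fv.span B"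
    by (rule fv.maximal_independent_subset_extend[OF subset_trans[OF B0(1) kern_supp] B0(2)])
  have finB: "finite B" and cBn: "card B \<le> n"
    using finite_independent_supp[OF _ B(3,2)] distinct_card[OF vs] by (auto simp: n_def)
  have "n \<le> card B"
  proof -
    let ?d = "\<lambda>s v. if v = s then 1 else (0::real)"
    have inj: "inj_on ?d ?S" by (rule inj_onI) (metis zero_neq_one)
    have "fv.independent (?d ` ?S)"
    proof (rule fv.independent_if_scalars_zero)
      fix c x assume c: "(\<Sum>x\<in>?d ` ?S. (\<lambda>y. c x * x y)) = 0" and x: "x \<in> ?d ` ?S"
      obtain s where s: "s \<in> ?S" "x = ?d s" using x by auto
      have app: "(\<Sum>x\<in>X. (\<lambda>y. c x * x y)) z = (\<Sum>x\<in>X. c x * x z)" for X :: "('a \<Rightarrow> real) set" and z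
        by (induction X rule: infinite_finite_induct) auto
      have "0 = (\<Sum>x\<in>?d ` ?S. c x * x s)" using c app[of "?d ` ?S" s] by simp
      also have "\<dots> = (\<Sum>t\<in>?S. c (?d t) * ?d t s)" by (subst sum.reindex[OF inj]) simp
      also have "\<dots> = c (?d s)" using s by (simp add: if_distrib cong: if_cong)
      finally show "c x = 0" using s by simp
    qed simp
    moreover have "?d ` ?S \<subseteq> fv.span B" using B(4) by (force simp: supp_in_def)
    ultimately have "card (?d ` ?S) \<le> card B"
      using fv.independent_span_bound[OF finB] by blast
    then show ?thesis using card_image[OF inj] distinct_card[OF vs] by (simp add: n_def)
  qed
  then have cB: "card B = n" using cBn by simp
  define k where "k = card B0"
  have k: "k \<le> n" using card_mono[OF finB B(1)] cB by (simp add: k_def)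
  obtain b0 where b0: "set b0 = B0" "distinct b0"
    using finite_distinct_list[OF finite_subset[OF B(1) finB]] by auto
  obtain b1 where b1: "set b1 = B - B0" "distinct b1" using finite_distinct_list finB by blast
  define bs where "bs = b0 @ b1"
  have bs: "set bs = B" "distinct bs" using b0 b1 B(1) by (auto simp: bs_def)
  have lbs: "length bs = n" using distinct_card[OF bs(2)] bs(1) cB by simp
  have lb0: "length b0 = k" using distinct_card[OF b0(2)] b0(1) by (simp add: k_def)
  have bs_k: "bs ! j \<in> kern a ?S" if "j < k" for j
    using that lb0 b0 B0(1) nth_mem[of j b0] by (auto simp: bs_def nth_append)
  have bs_supp: "bs ! j \<in> supp_in ?S" if "j < n" for j
    using that lbs bs B(2) nth_mem[of j bs] by auto
  define P where "P = mat n n (\<lambda>(i, j). (bs ! j) (vs ! i))"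
  have P: "P \<in> carrier_mat n n" by (simp add: P_def)
  define comb where "comb y = (\<lambda>v. \<Sum>j<n. y $ j * (bs ! j) v)" for y :: "real vec"
  have comb_supp: "comb y \<in> supp_in ?S" for y
    using bs_supp by (auto simp: comb_def supp_in_def)
  have Py: "(P *\<^sub>v y) $ i = comb y (vs ! i)" if "y \<in> carrier_vec n" "i < n" for y i
    using that by (auto simp: P_def comb_def scalar_prod_def lessThan_atLeast0 algebra_simps intro!: sum.cong)
  have Ay: "(A *\<^sub>v y) $ i = (\<Sum>u\<in>?S. a (vs ! i) u * f u)"
    if "y \<in> carrier_vec n" "i < n" "\<And>j. j < n \<Longrightarrow> y $ j = f (vs ! j)" for y f i
    using that unfolding sumS
    by (auto simp: A_def n_def[symmetric] scalar_prod_def lessThan_atLeast0 intro!: sum.cong)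
  have app: "(\<Sum>x\<in>X. (\<lambda>y. c x * x y)) z = (\<Sum>x\<in>X. c x * x z)"
    for X :: "('a \<Rightarrow> real) set" and z c
    by (induction X rule: infinite_finite_induct) auto
  have comb_sum: "comb y = (\<Sum>x\<in>B. (\<lambda>v. y $ (inv_into {..<n} ((!) bs) x) * x v))" for y
  proof
    fix v
    have bij: "bij_betw ((!) bs) {..<n} B" using bij_betw_nth[OF bs(2)] lbs bs(1) by simp
    then have inj: "inj_on ((!) bs) {..<n}" by (rule bij_betw_imp_inj_on)
    have "(\<Sum>x\<in>B. y $ (inv_into {..<n} ((!) bs) x) * x v)
       = (\<Sum>j<n. y $ (inv_into {..<n} ((!) bs) (bs ! j)) * (bs ! j) v)"
      by (rule sum.reindex_bij_betw[OF bij, symmetric])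
    also have "\<dots> = comb y v"
      unfolding comb_def by (intro sum.cong refl) (simp add: inv_into_f_f[OF inj])
    finally show "comb y v = (\<Sum>x\<in>B. (\<lambda>v. y $ (inv_into {..<n} ((!) bs) x) * x v)) v"
      by (simp add: app)
  qed
  have comb0: "y = 0\<^sub>v n" if y: "y \<in> carrier_vec n" and "comb y = 0" for y
  proof (rule eq_vecI)
    fix j assume "j < dim_vec (0\<^sub>v n :: real vec)"
    then have j: "j < n" by simp
    have bij: "bij_betw ((!) bs) {..<n} B" using bij_betw_nth[OF bs(2)] lbs bs(1) by simp
    have "(\<Sum>x\<in>B. (\<lambda>v. y $ (inv_into {..<n} ((!) bs) x) * x v)) = 0"
      using that comb_sum by metis
    then have "y $ (inv_into {..<n} ((!) bs) x) = 0" if "x \<in> B" for x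
      by (rule B(3)[unfolded fv.independent_explicit_finite_subsets, rule_format, OF subset_refl finB _ that])
    from this[of "bs ! j"] show "y $ j = 0\<^sub>v n $ j"
      using j lbs bs(1) inv_into_f_f[OF bij_betw_imp_inj_on[OF bij], of j] by auto
  qed (use y in simp)
  have "det P \<noteq> 0"
  proof
    assume "det P = 0"
    then obtain y where y: "y \<in> carrier_vec n" "y \<noteq> 0\<^sub>v n" "P *\<^sub>v y = 0\<^sub>v n"
      using det_0_iff_vec_prod_zero_field[OF P] by auto
    have "comb y = 0"
    proof
      fix v
      show "comb y v = 0 v"
      proof (cases "v \<in> ?S")
        case True
        then obtain i where "i < n" "v = vs ! i" by (auto simp: in_set_conv_nth n_def)
        then show ?thesis using Py[OF y(1)] y(3) by (metis index_zero_vec(1) zero_fun_apply)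
      next
        case False
        then show ?thesis using comb_supp[of y] by (simp add: supp_in_def)
      qed
    qed
    then show False using comb0 y by blast
  qed
  then obtain Q where Q: "Q \<in> carrier_mat n n" "Q * P = 1\<^sub>m n" "P * Q = 1\<^sub>m n"
    using det_non_zero_imp_unit[OF P, of "()"] by (auto simp: Units_def ring_mat_def)
  define M where "M = Q * A * P"
  have M: "M \<in> carrier_mat n n" using P Q A by (simp add: M_def)
  have "similar_mat_wit M A Q P"
    unfolding similar_mat_wit_def using P Q A M by (simp add: Let_def M_def)
  then have cp: "char_poly A = char_poly M"
    using char_poly_similar similar_mat_def similar_mat_sym by metis
  have AP: "A * P \<in> carrier_mat n n" using A P by simp
  have M_eq: "M = Q * (A * P)" unfolding M_def using Q(1) A P by (rule assoc_mult_mat)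
  have "P * M = (P * Q) * (A * P)"
    unfolding M_eq using P Q(1) AP by (rule assoc_mult_mat[symmetric])
  then have PM: "P * M = A * P" unfolding Q(3) left_mult_one_mat[OF AP] .
  have z: "M $$ (i, j) = 0" if "i < n" "j < k" for i j
  proof -
    have j: "j < n" using that k by simp
    have "col (A * P) j = 0\<^sub>v n"
    proof (rule eq_vecI)
      fix i assume "i < dim_vec (0\<^sub>v n :: real vec)"
      then have i: "i < n" by simp
      have "col (A * P) j $ i = (A *\<^sub>v col P j) $ i" using A P i j by simp
      also have "\<dots> = (\<Sum>u\<in>?S. a (vs ! i) u * (bs ! j) u)"
        using i j by (intro Ay) (auto simp: P_def)
      also have "\<dots> = 0" using bs_k[OF that(2)] i by (auto simp: kern_def n_def)
      finally show "col (A * P) j $ i = 0\<^sub>v n $ i" using i by simp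
    qed (use A P in simp)
    then have "col M j = Q *\<^sub>v 0\<^sub>v n"
      unfolding M_eq using col_mult2[OF Q(1) AP j] by simp
    also have "\<dots> = 0\<^sub>v n" using Q(1) by (intro eq_vecI) (auto simp: scalar_prod_def)
    finally have "col M j = 0\<^sub>v n" .
    then show ?thesis using that j M by (metis carrier_matD index_col index_zero_vec(1))
  qed
  let ?D = "mat (n - k) (n - k) (\<lambda>(i, j). M $$ (i + k, j + k))"
  have "poly (char_poly ?D) 0 \<noteq> 0"
  proof
    assume "poly (char_poly ?D) 0 = 0"
    then have "eigenvalue ?D 0" using eigenvalue_root_char_poly[of ?D "n - k" 0] by simp
    then obtain d where d: "d \<in> carrier_vec (n - k)" "d \<noteq> 0\<^sub>v (n - k)" "?D *\<^sub>v d = 0 \<cdot>\<^sub>v d"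
      unfolding eigenvalue_def eigenvector_def by auto
    \<comment> \<open>A null vector \<open>d\<close> of the block, padded with zeros in the kernel
      coordinates. Its vector \<open>h\<close> is sent by A into the kernel, so A squared kills
      \<open>h\<close>, and \<open>symmetric_kern_square\<close> puts \<open>h\<close> itself into
      the kernel.\<close>
    define y where "y = vec n (\<lambda>i. if i < k then 0 else d $ (i - k))"
    have y: "y \<in> carrier_vec n" by (simp add: y_def)
    define h where "h = comb y"
    have My: "(M *\<^sub>v y) $ i = 0" if "i < n" "k \<le> i" for i
    proof -
      have "(M *\<^sub>v y) $ i = (\<Sum>j<n. M $$ (i, j) * y $ j)"
        using that M y by (simp add: scalar_prod_def lessThan_atLeast0)
      also have "\<dots> = (\<Sum>j\<in>{k..<n}. M $$ (i, j) * y $ j)"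
        using k by (intro sum.mono_neutral_right) (auto simp: y_def)
      also have "\<dots> = (\<Sum>j\<in>{0..<n-k}. M $$ (i, j + k) * d $ j)"
        using k by (intro sum.reindex_bij_witness[of _ "\<lambda>j. j + k" "\<lambda>j. j - k"]) (auto simp: y_def)
      also have "\<dots> = (?D *\<^sub>v d) $ (i - k)"
        using that d(1) by (auto simp: scalar_prod_def intro!: sum.cong)
      also have "\<dots> = 0" unfolding d(3) using d(1) that by simp
      finally show ?thesis .
    qed
    have APy: "(A * P *\<^sub>v y) = P *\<^sub>v (M *\<^sub>v y)"
      unfolding PM[symmetric] using P M y by simp
    have Ah: "(\<Sum>u\<in>?S. a v u * h u) = comb (M *\<^sub>v y) v" if v: "v \<in> ?S" for v
    proof -
      obtain i where i: "i < n" "v = vs ! i" using v by (auto simp: in_set_conv_nth n_def)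
      have "(\<Sum>u\<in>?S. a v u * h u) = (A *\<^sub>v (P *\<^sub>v y)) $ i"
        unfolding i(2) using i P y Py by (intro Ay[symmetric]) (auto simp: h_def)
      also have "\<dots> = (P *\<^sub>v (M *\<^sub>v y)) $ i" using APy A P y by simp
      also have "\<dots> = comb (M *\<^sub>v y) v" using Py[of "M *\<^sub>v y" i] M y i by simp
      finally show ?thesis .
    qed
    have comb_kern: "comb x \<in> kern a ?S" if "\<And>i. i < n \<Longrightarrow> k \<le> i \<Longrightarrow> x $ i = 0" for x
    proof -
      have "comb x = (\<Sum>j<k. (\<lambda>v. x $ j * (bs ! j) v))"
      proof
        fix v
        have "(\<Sum>j<n. x $ j * (bs ! j) v) = (\<Sum>j<k. x $ j * (bs ! j) v)"
          using that k by (intro sum.mono_neutral_right) auto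
        moreover have "(\<Sum>j<m. (\<lambda>v. x $ j * (bs ! j) v)) v = (\<Sum>j<m. x $ j * (bs ! j) v)" for m
          by (induction m) auto
        ultimately show "comb x v = (\<Sum>j<k. (\<lambda>v. x $ j * (bs ! j) v)) v" by (simp add: comb_def)
      qed
      also have "\<dots> \<in> kern a ?S"
        using bs_k by (intro fv.subspace_sum[OF kern_subspace] fv.subspace_scale[OF kern_subspace]) auto
      finally show ?thesis .
    qed
    have "comb (M *\<^sub>v y) \<in> kern a ?S" using My by (rule comb_kern)
    then have "(\<Sum>u\<in>?S. a v u * (\<Sum>w\<in>?S. a u w * h w)) = 0" if "v \<in> ?S" for v
      using that by (simp add: Ah kern_def)
    then have "h \<in> kern a ?S"
      using sym comb_supp by (intro symmetric_kern_square) (auto simp: h_def)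
    then have "comb (M *\<^sub>v y) v = 0" for v
      using Ah comb_supp[of "M *\<^sub>v y"] by (cases "v \<in> ?S") (auto simp: kern_def supp_in_def)
    have hB0: "h \<in> fv.span B0" using \<open>h \<in> kern a ?S\<close> B0 by auto
    have finB0: "finite B0" using finite_subset[OF B(1) finB] .
    obtain c where c: "h = (\<Sum>x\<in>B0. (\<lambda>v. c x * x v))"
      using hB0 unfolding fv.span_finite[OF finB0] by auto
    \<comment> \<open>The coordinates of \<open>h\<close> minus those of its expansion in the kernel
      basis. They represent 0 and so vanish, but the last \<open>n - k\<close> of them are the
      entries of \<open>d\<close>.\<close>
    let ?x = "vec n (\<lambda>j. y $ j - (if j < k then c (bs ! j) else 0))"
    have "comb ?x = 0"
    proof
      fix v
      have bij: "bij_betw ((!) bs) {..<k} B0"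
        using bij_betw_nth[OF b0(2)] lb0 b0(1) bij_betw_cong[of "{..<k}" "(!) bs" "(!) b0" B0]
        by (simp add: bs_def nth_append)
      have "comb ?x v = (\<Sum>j<n. y $ j * (bs ! j) v) - (\<Sum>j<n. (if j < k then c (bs ! j) else 0) * (bs ! j) v)"
        unfolding comb_def sum_subtractf[symmetric] by (intro sum.cong refl) (simp add: algebra_simps)
      also have "(\<Sum>j<n. (if j < k then c (bs ! j) else 0) * (bs ! j) v) = (\<Sum>j<k. c (bs ! j) * (bs ! j) v)"
        using k by (intro sum.mono_neutral_cong_right) auto
      also have "\<dots> = (\<Sum>x\<in>B0. c x * x v)" by (rule sum.reindex_bij_betw[OF bij])
      also have "\<dots> = h v" unfolding c app ..
      finally show "comb ?x v = 0 v" by (simp add: h_def comb_def)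
    qed
    then have x0: "?x = 0\<^sub>v n" by (intro comb0) auto
    have "d = 0\<^sub>v (n - k)"
    proof (rule eq_vecI)
      fix i assume "i < dim_vec (0\<^sub>v (n - k) :: real vec)"
      then have i: "i + k < n" by simp
      then have "?x $ (i + k) = 0" using x0 by simp
      then show "d $ i = 0\<^sub>v (n - k) $ i" using i by (simp add: y_def)
    qed (use d in simp)
    then show False using d by simp
  qed
  then have D0: "Polynomial.order 0 (char_poly ?D) = 0" by (simp add: order_root)
  have Dnz: "char_poly ?D \<noteq> 0" using \<open>poly (char_poly ?D) 0 \<noteq> 0\<close> by auto
  have "char_poly A = [:0, 1:] ^ k * char_poly ?D"
    unfolding cp using M k z by (rule char_poly_zero_cols)
  then have "Polynomial.order 0 (char_poly A) = Polynomial.order 0 ([:0, 1:] ^ k :: real poly)"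
    using Dnz D0 by (simp add: order_mult)
  also have "\<dots> = k" using order_power_n_n[of 0 k] by simp
  finally show ?thesis using B0(4) by (simp add: eta_def k_def)
qed

section \<open>Kernels under vertex deletion and gluing\<close>

lemma sum_supp_in_subset:
  assumes f: "f \<in> supp_in S" and S: "finite T" "S \<subseteq> T"
  shows "(\<Sum>u\<in>T. a v u * f u) = (\<Sum>u\<in>S. a v u * f u)"
  using assms by (intro sum.mono_neutral_right) (auto simp: supp_in_def)

lemma kern_delete:
  assumes "finite S" "f \<in> kern a S" "f b = 0"
  shows "f \<in> kern a (S - {b})"
proof -
  have f: "f \<in> supp_in (S - {b})" using assms by (auto simp: kern_def supp_in_def)
  have "(\<Sum>u\<in>S - {b}. a v u * f u) = (\<Sum>u\<in>S. a v u * f u)" for v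
    using sum_supp_in_subset[OF f assms(1)] by (metis Diff_subset)
  then show ?thesis using assms f by (simp add: kern_def)
qed

lemma eta_le_delete:
  assumes "finite S" "\<And>f. f \<in> kern a S \<Longrightarrow> f b = 0"
  shows "eta a S \<le> eta a (S - {b})"
  unfolding eta_def
  using assms kern_delete[OF assms(1)] kern_supp[of a "S - {b}"]
  by (intro dim_mono_supp[of "S - {b}"]) auto

lemma eta_eval:
  assumes "finite S" "f \<in> kern a S" "f b \<noteq> 0"
  shows "eta a S = fv.dim {g \<in> kern a S. g b = 0} + 1"
  unfolding eta_def
  using assms by (intro dim_hyperplane[of S _ "\<lambda>g. g b" f] kern_subspace kern_supp) auto

text \<open>Kernel vectors vanishing at \<open>b\<close> remain kernel vectors after the deletion,
  and vanishing at \<open>b\<close> is a single linear condition.\<close>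

lemma eta_le_delete_Suc:
  assumes "finite S"
  shows "eta a S \<le> eta a (S - {b}) + 1"
proof (cases "\<exists>f\<in>kern a S. f b \<noteq> 0")
  case True
  then have "eta a S = fv.dim {g \<in> kern a S. g b = 0} + 1" using eta_eval[OF assms] by blast
  moreover have "fv.dim {g \<in> kern a S. g b = 0} \<le> fv.dim (kern a (S - {b}))"
    using assms kern_delete[OF assms] kern_supp[of a "S - {b}"]
    by (intro dim_mono_supp[of "S - {b}"]) auto
  ultimately show ?thesis by (simp add: eta_def)
next
  case False
  then show ?thesis using eta_le_delete[OF assms, of a b] by force
qed

lemma eta_disjoint_Un:
  assumes fin: "finite S" "finite T" and disj: "S \<inter> T = {}"
    and na: "\<And>u v. u \<in> S \<Longrightarrow> v \<in> T \<Longrightarrow> a u v = 0 \<and> a v u = 0"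
  shows "eta a (S \<union> T) = eta a S + eta a T"
proof -
  have sum: "(\<Sum>u\<in>S \<union> T. a v u * f u) = (\<Sum>u\<in>S. a v u * f u) + (\<Sum>u\<in>T. a v u * f u)" for v f
    using fin disj by (rule sum.union_disjoint)
  have z: "v \<in> S \<Longrightarrow> (\<Sum>u\<in>T. a v u * f u) = 0" "v \<in> T \<Longrightarrow> (\<Sum>u\<in>S. a v u * f u) = 0" for v f
    using na by (auto intro!: sum.neutral)
  have res: "(\<Sum>u\<in>X. a v u * (if u \<in> X then f u else 0)) = (\<Sum>u\<in>X. a v u * f u)" for v f X
    by (rule sum.cong) auto
  have ker: "kern a (S \<union> T) = {f + g | f g. f \<in> kern a S \<and> g \<in> kern a T}" (is "_ = ?R")
  proof
    show "kern a (S \<union> T) \<subseteq> ?R"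
    proof
      fix h assume h: "h \<in> kern a (S \<union> T)"
      let ?f = "\<lambda>v. if v \<in> S then h v else 0" and ?g = "\<lambda>v. if v \<in> T then h v else 0"
      have "h = ?f + ?g" using h disj by (auto simp: fun_eq_iff kern_def supp_in_def)
      moreover have "(\<Sum>u\<in>S. a v u * h u) = 0" if "v \<in> S" for v
        using h that sum[of v h] z(1)[OF that, of h] by (simp add: kern_def)
      then have "?f \<in> kern a S" by (simp add: kern_def supp_in_def res)
      moreover have "(\<Sum>u\<in>T. a v u * h u) = 0" if "v \<in> T" for v
        using h that sum[of v h] z(2)[OF that, of h] by (simp add: kern_def)
      then have "?g \<in> kern a T" by (simp add: kern_def supp_in_def res)
      ultimately show "h \<in> ?R" by blast
    qed
    show "?R \<subseteq> kern a (S \<union> T)"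
    proof
      fix h assume "h \<in> ?R"
      then obtain f g where fg: "h = f + g" "f \<in> kern a S" "g \<in> kern a T" by blast
      have "(\<Sum>u\<in>S \<union> T. a v u * h u) = (\<Sum>u\<in>S. a v u * f u) + (\<Sum>u\<in>T. a v u * g u)" for v
      proof -
        have "(\<Sum>u\<in>S. a v u * h u) = (\<Sum>u\<in>S. a v u * f u)"
          using fg disj by (intro sum.cong) (auto simp: kern_def supp_in_def)
        moreover have "(\<Sum>u\<in>T. a v u * h u) = (\<Sum>u\<in>T. a v u * g u)"
          using fg disj by (intro sum.cong) (auto simp: kern_def supp_in_def)
        ultimately show ?thesis unfolding sum by simp
      qed
      then show "h \<in> kern a (S \<union> T)"
        using fg z by (auto simp: kern_def supp_in_def)
    qed
  qed
  have "kern a S \<inter> kern a T \<subseteq> {0}"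
  proof
    fix f assume f: "f \<in> kern a S \<inter> kern a T"
    have "f v = 0" for v using f disj by (cases "v \<in> S") (auto simp: kern_def supp_in_def)
    then show "f \<in> {0}" by (simp add: fun_eq_iff)
  qed
  then show ?thesis unfolding eta_def ker
    using fin kern_supp[of a S] kern_supp[of a T]
    by (intro dim_direct_sum[of "S \<union> T"] kern_subspace) (auto simp: supp_in_def)
qed

lemma fv_dim_zero: "fv.dim {0} = 0"
  using fv.dim_le_card[of "{0}" "{}"] fv.span_zero by simp

lemma eta_singleton: "a v v = 0 \<Longrightarrow> eta a {v} = 1"
proof -
  assume a: "a v v = 0"
  let ?e = "\<lambda>u. if u = v then 1 else (0::real)"
  have e: "?e \<in> kern a {v}" using a by (simp add: kern_def supp_in_def)
  have "{g \<in> kern a {v}. g v = 0} = {0}"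
    using a by (auto simp: kern_def supp_in_def fun_eq_iff)
  then show "eta a {v} = 1" using eta_eval[OF _ e, of v] fv_dim_zero by simp
qed

lemma eta_empty: "eta a {} = 0"
proof -
  have "kern a {} = {0}" by (auto simp: kern_def supp_in_def fun_eq_iff)
  then show ?thesis using fv_dim_zero by (simp add: eta_def)
qed

section \<open>Weighted graphs: the neighbour of a leaf, and gluing at a cut vertex\<close>

locale weighted_graph =
  fixes a :: "'a \<Rightarrow> 'a \<Rightarrow> real"
  assumes sym: "a u v = a v u" and irrefl: "a v v = 0"
begin

abbreviation ker :: "'a set \<Rightarrow> ('a \<Rightarrow> real) set" where "ker \<equiv> kern a"
abbreviation \<eta> :: "'a set \<Rightarrow> nat" where "\<eta> \<equiv> eta a"

text \<open>The vertex \<open>v\<close> need not lie in \<open>S\<close>: below, \<open>deg K b\<close> also counts the neighbours in a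
  component \<open>K\<close> of a deleted vertex \<open>b\<close>.\<close>

definition nbs :: "'a set \<Rightarrow> 'a \<Rightarrow> 'a set" where
  "nbs S v = {u \<in> S. a v u \<noteq> 0}"

definition deg :: "'a set \<Rightarrow> 'a \<Rightarrow> nat" where
  "deg S v = card (nbs S v)"

lemma finite_nbs [simp]: "finite S \<Longrightarrow> finite (nbs S v)"
  by (simp add: nbs_def)

text \<open>The row of the leaf \<open>y\<close> forces every kernel vector to vanish at
  \<open>w\<close>. Kernel vectors of \<open>S\<close> are thus kernel vectors of
  \<open>S - {w}\<close> that also satisfy the row of \<open>w\<close>, and this extra condition is
  not automatic: the indicator of \<open>y\<close> lies in the kernel of \<open>S - {w}\<close> and
  violates it.\<close>

lemma eta_leaf_nb:
  assumes fin: "finite S" and y: "y \<in> S" "nbs S y = {w}"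
  shows "\<eta> S + 1 \<le> \<eta> (S - {w})"
proof -
  have w: "w \<in> S" "a y w \<noteq> 0" "a w y \<noteq> 0" "y \<noteq> w" using y sym[of y w] irrefl by (auto simp: nbs_def)
  let ?e = "\<lambda>u. if u = y then 1 else (0::real)"
  let ?\<phi> = "\<lambda>f. \<Sum>u\<in>S - {w}. a w u * f u"
  have e: "?e \<in> ker (S - {w})"
  proof -
    have "a v y = 0" if "v \<in> S - {w}" for v
      using that y sym[of v y] by (auto simp: nbs_def)
    then have "(\<Sum>u\<in>S - {w}. a v u * ?e u) = 0" if "v \<in> S - {w}" for v
      using that by (intro sum.neutral) simp
    then show ?thesis using w y by (simp add: kern_def supp_in_def)
  qed
  have "?\<phi> ?e = a w y" using fin w y by (simp add: if_distrib cong: if_cong)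
  then have dim: "\<eta> (S - {w}) = fv.dim {f \<in> ker (S - {w}). ?\<phi> f = 0} + 1"
    unfolding eta_def using fin e w
    by (intro dim_hyperplane[of "S - {w}" _ ?\<phi> ?e] kern_subspace kern_supp)
      (auto simp: algebra_simps sum.distrib sum_distrib_left)
  have "ker S \<subseteq> {f \<in> ker (S - {w}). ?\<phi> f = 0}"
  proof
    fix f assume f: "f \<in> ker S"
    have "(\<Sum>u\<in>S. a y u * f u) = a y w * f w"
    proof -
      have "(\<Sum>u\<in>S. a y u * f u) = (\<Sum>u\<in>{w}. a y u * f u)"
        using fin w y by (intro sum.mono_neutral_right) (auto simp: nbs_def)
      then show ?thesis by simp
    qed
    then have fw: "f w = 0" using f y w by (simp add: kern_def)
    have "?\<phi> f = (\<Sum>u\<in>S. a w u * f u)"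
      using fin fw by (intro sum.mono_neutral_left) auto
    then show "f \<in> {f \<in> ker (S - {w}). ?\<phi> f = 0}"
      using kern_delete[OF fin f fw] f w by (simp add: kern_def)
  qed
  then have "fv.dim (ker S) \<le> fv.dim {f \<in> ker (S - {w}). ?\<phi> f = 0}"
    using fin kern_supp[of a "S - {w}"] by (intro dim_mono_supp[of "S - {w}"]) auto
  then show ?thesis unfolding dim by (simp add: eta_def)
qed

text \<open>A kernel vector of \<open>Z\<close> not vanishing at the cut vertex \<open>l\<close> makes the row of \<open>l\<close> within
  \<open>Z\<close> redundant, so the kernel of the union consists of pairs of kernel vectors agreeing at \<open>l\<close>.\<close>

lemma eta_attach:
  assumes fin: "finite S" "finite Z" and int: "S \<inter> Z = {l}"
    and na: "\<And>u v. u \<in> S - {l} \<Longrightarrow> v \<in> Z - {l} \<Longrightarrow> a u v = 0"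
    and x: "x \<in> ker Z" "x l \<noteq> 0"
  shows "\<eta> (S \<union> Z) + 1 = \<eta> S + \<eta> Z"
proof -
  let ?Z = "Z - {l}" and ?S = "S - {l}"
  have l: "l \<in> S" "l \<in> Z" using int by auto
  have na': "u \<in> S - {l} \<Longrightarrow> v \<in> Z - {l} \<Longrightarrow> a v u = 0" for u v using na sym by metis
  let ?r = "\<lambda>X h v. if v \<in> X then h v else (0::real)"
  have res: "(\<Sum>u\<in>X. a v u * ?r X f u) = (\<Sum>u\<in>X. a v u * f u)" for v f X
    by (rule sum.cong) auto
  have sumS: "(\<Sum>u\<in>S \<union> Z. a v u * f u) = (\<Sum>u\<in>S. a v u * f u) + (\<Sum>u\<in>?Z. a v u * f u)" for v f
  proof -
    have "S \<union> Z = S \<union> ?Z" "S \<inter> ?Z = {}" using int by auto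
    then show ?thesis using fin by (metis finite_Diff sum.union_disjoint)
  qed
  have sumZ: "(\<Sum>u\<in>S \<union> Z. a v u * f u) = (\<Sum>u\<in>?S. a v u * f u) + (\<Sum>u\<in>Z. a v u * f u)" for v f
  proof -
    have "S \<union> Z = ?S \<union> Z" "?S \<inter> Z = {}" using int by auto
    then show ?thesis using fin by (metis finite_Diff sum.union_disjoint)
  qed
  have zS: "v \<in> ?S \<Longrightarrow> (\<Sum>u\<in>?Z. a v u * f u) = 0" for v f using na by (auto intro!: sum.neutral)
  have zZ: "v \<in> ?Z \<Longrightarrow> (\<Sum>u\<in>?S. a v u * f u) = 0" for v f using na' by (auto intro!: sum.neutral)
  have splitl: "(\<Sum>u\<in>Z. a l u * f u) = (\<Sum>u\<in>?Z. a l u * f u)" for f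
    using fin l irrefl by (intro sum.mono_neutral_right) auto
  have split: "?r S h \<in> ker S \<and> ?r Z h \<in> ker Z" if h: "h \<in> ker (S \<union> Z)" for h
  proof -
    let ?A = "\<lambda>v. \<Sum>u\<in>Z. a v u * h u"
    have A0: "?A v = 0" if "v \<in> ?Z" for v
      using h that zZ[OF that, of h] sumZ[of v h] by (simp add: kern_def)
    \<comment> \<open>Pairing the restriction of \<open>h\<close> with \<open>x\<close> gives 0
      because \<open>x\<close> is a kernel vector of \<open>Z\<close>. All terms except the one at
      \<open>l\<close> are already known to vanish, and \<open>x l \<noteq> 0\<close>.\<close>
    have "(\<Sum>v\<in>Z. x v * ?A v) = (\<Sum>v\<in>Z. \<Sum>u\<in>Z. h u * (a v u * x v))"
      by (simp add: sum_distrib_left algebra_simps)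
    also have "\<dots> = (\<Sum>u\<in>Z. \<Sum>v\<in>Z. h u * (a v u * x v))" by (rule sum.swap)
    also have "\<dots> = (\<Sum>u\<in>Z. h u * (\<Sum>v\<in>Z. a u v * x v))"
      unfolding sum_distrib_left using sym by (intro sum.cong refl) metis
    also have "\<dots> = 0" using x by (simp add: kern_def)
    finally have "(\<Sum>v\<in>Z. x v * ?A v) = 0" .
    moreover have "(\<Sum>v\<in>Z. x v * ?A v) = (\<Sum>v\<in>{l}. x v * ?A v)"
      using fin l A0 by (intro sum.mono_neutral_right) auto
    ultimately have Al: "?A l = 0" using x by simp
    have "?r Z h \<in> ker Z" using A0 Al l by (auto simp: kern_def supp_in_def res)
    moreover have "(\<Sum>u\<in>S. a v u * h u) = 0" if "v \<in> S" for v
    proof (cases "v = l")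
      case True
      have "(\<Sum>u\<in>S \<union> Z. a l u * h u) = 0" using h l by (simp add: kern_def)
      then show ?thesis unfolding sumS using True Al splitl by simp
    next
      case False
      then show ?thesis using h that zS[of v h] sumS[of v h] by (simp add: kern_def)
    qed
    then have "?r S h \<in> ker S" by (auto simp: kern_def supp_in_def res)
    ultimately show ?thesis by blast
  qed
  have join: "(\<lambda>v. if v \<in> S then f v else g v) \<in> ker (S \<union> Z)" (is "?h \<in> _")
    if f: "f \<in> ker S" and g: "g \<in> ker Z" and fg: "f l = g l" for f g
  proof -
    have hf: "?h v = f v" if "v \<in> S" for v using that by simp
    have hg: "?h v = g v" if "v \<in> Z" for v using that int fg by (cases "v = l") auto
    have S: "(\<Sum>u\<in>S. a v u * ?h u) = (\<Sum>u\<in>S. a v u * f u)" for v by (intro sum.cong) auto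
    have Z: "(\<Sum>u\<in>Z. a v u * ?h u) = (\<Sum>u\<in>Z. a v u * g u)" for v using hg by (intro sum.cong) auto
    have "(\<Sum>u\<in>S \<union> Z. a v u * ?h u) = 0" if "v \<in> S \<union> Z" for v
    proof (cases "v \<in> S")
      case True
      have "(\<Sum>u\<in>?Z. a v u * ?h u) = 0"
      proof (cases "v = l")
        case True
        then show ?thesis using splitl[of ?h] Z[of l] g l by (simp add: kern_def)
      qed (use zS True in auto)
      then show ?thesis unfolding sumS S using f True by (simp add: kern_def)
    next
      case False
      then show ?thesis unfolding sumZ Z using g zZ[of v] l that by (auto simp: kern_def)
    qed
    then show ?thesis using f g by (auto simp: kern_def supp_in_def)
  qed
  \<comment> \<open>Among vectors vanishing at \<open>l\<close> the two sides are independent, so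
    the sum is direct. The common value at \<open>l\<close> then adds one dimension to the union and
    to each side, or, if all of \<open>ker S\<close> vanishes at \<open>l\<close>, to
    \<open>Z\<close> alone.\<close>
  let ?S0 = "{f \<in> ker S. f l = 0}" and ?Z0 = "{f \<in> ker Z. f l = 0}"
    and ?H0 = "{f \<in> ker (S \<union> Z). f l = 0}"
  have sub0: "fv.subspace {f \<in> ker X. f l = 0}" for X
    using kern_subspace[of a X] fv.subspace_0[OF kern_subspace] fv.subspace_add[OF kern_subspace]
      fv.subspace_scale[OF kern_subspace] by (intro fv_subspaceI) auto
  have "?H0 = {f + g | f g. f \<in> ?S0 \<and> g \<in> ?Z0}" (is "_ = ?R")
  proof
    show "?H0 \<subseteq> ?R"
    proof
      fix h assume h: "h \<in> ?H0"
      have "h = ?r S h + ?r Z h" using h int by (auto simp: fun_eq_iff kern_def supp_in_def)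
      then show "h \<in> ?R" using split[of h] h l by fastforce
    qed
    show "?R \<subseteq> ?H0"
    proof
      fix h assume "h \<in> ?R"
      then obtain f g where fg: "h = f + g" "f \<in> ?S0" "g \<in> ?Z0" by blast
      have "h = (\<lambda>v. if v \<in> S then f v else g v)"
      proof
        fix v
        show "h v = (if v \<in> S then f v else g v)"
        proof (cases "v \<in> S")
          case True
          then have "g v = 0" using fg(3) int by (cases "v = l") (auto simp: kern_def supp_in_def)
          then show ?thesis using True fg(1) by simp
        next
          case False
          then show ?thesis using fg(1,2) by (auto simp: kern_def supp_in_def)
        qed
      qed
      then show "h \<in> ?H0" using join[of f g] fg l by auto
    qed
  qed
  moreover have "fv.dim ?R = fv.dim ?S0 + fv.dim ?Z0"
  proof (rule dim_direct_sum[of "S \<union> Z"])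
    show "?S0 \<inter> ?Z0 \<subseteq> {0}"
    proof
      fix f assume f: "f \<in> ?S0 \<inter> ?Z0"
      have "f v = 0" for v using f int by (cases "v = l"; cases "v \<in> S") (auto simp: kern_def supp_in_def)
      then show "f \<in> {0}" by (simp add: fun_eq_iff)
    qed
  qed (use fin sub0 kern_supp[of a S] kern_supp[of a Z] in \<open>auto simp: supp_in_def\<close>)
  ultimately have H0: "fv.dim ?H0 = fv.dim ?S0 + fv.dim ?Z0" by simp
  have Z1: "\<eta> Z = fv.dim ?Z0 + 1" using eta_eval[OF fin(2) x] .
  show ?thesis
  proof (cases "\<exists>f\<in>ker S. f l \<noteq> 0")
    case True
    then obtain f where f: "f \<in> ker S" "f l \<noteq> 0" by auto
    \<comment> \<open>Rescaled to agree with \<open>f\<close> at \<open>l\<close>, as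
      \<open>join\<close> requires.\<close>
    let ?x = "\<lambda>v. f l / x l * x v"
    have "?x \<in> ker Z" using fv.subspace_scale[OF kern_subspace x(1), of "f l / x l"] by simp
    then have "(\<lambda>v. if v \<in> S then f v else ?x v) \<in> ker (S \<union> Z)" (is "?h \<in> _")
      using f x by (intro join) auto
    moreover have "?h l \<noteq> 0" using f l by simp
    ultimately have "\<eta> (S \<union> Z) = fv.dim ?H0 + 1" by (rule eta_eval[OF finite_UnI[OF fin]])
    then show ?thesis using H0 Z1 eta_eval[OF fin(1) f] by simp
  next
    case False
    have "h l = 0" if h: "h \<in> ker (S \<union> Z)" for h
      using split[OF h] False l by (metis (mono_tags, lifting))
    then have "?H0 = ker (S \<union> Z)" "?S0 = ker S" using False by auto
    then show ?thesis using H0 Z1 by (simp add: eta_def)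
  qed
qed

end

section \<open>Components and the nullity bound\<close>

context weighted_graph
begin

text \<open>Unions of components, described by the absence of outgoing edges. Connectivity is
  phrased through such sets, so that no paths are handled until the translation to
  \<open>connected_graph\<close>.\<close>

definition closed_in :: "'a set \<Rightarrow> 'a set \<Rightarrow> bool" where
  "closed_in S A \<longleftrightarrow> A \<subseteq> S \<and> (\<forall>u\<in>A. \<forall>v\<in>S - A. a u v = 0)"

definition conn :: "'a set \<Rightarrow> bool" where
  "conn S \<longleftrightarrow> S \<noteq> {} \<and> (\<forall>A. closed_in S A \<longrightarrow> A = {} \<or> A = S)"

definition comps :: "'a set \<Rightarrow> 'a set set" where
  "comps S = {K. closed_in S K \<and> conn K}"

lemma closed_in_subset: "closed_in S A \<Longrightarrow> A \<subseteq> S"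
  by (simp add: closed_in_def)

lemma closed_in_step: "closed_in S A \<Longrightarrow> u \<in> A \<Longrightarrow> v \<in> S \<Longrightarrow> a u v \<noteq> 0 \<Longrightarrow> v \<in> A"
  by (auto simp: closed_in_def)

lemma closed_in_compl: "closed_in S A \<Longrightarrow> closed_in S (S - A)"
  unfolding closed_in_def using sym by (metis Diff_iff Diff_subset)

lemma closed_in_Int_subset: "closed_in S A \<Longrightarrow> T \<subseteq> S \<Longrightarrow> closed_in T (A \<inter> T)"
  by (auto simp: closed_in_def)

lemma closed_in_trans: "closed_in S A \<Longrightarrow> closed_in A B \<Longrightarrow> closed_in S B"
  unfolding closed_in_def by blast

lemma conn_nonempty: "conn S \<Longrightarrow> S \<noteq> {}"
  by (simp add: conn_def)

lemma conn_subset_closed: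
  assumes "conn T" "T \<subseteq> S" "closed_in S A" "T \<inter> A \<noteq> {}"
  shows "T \<subseteq> A"
  using assms closed_in_Int_subset[of S A T] by (auto simp: conn_def)

lemma conn_closed_eq: "conn S \<Longrightarrow> closed_in S A \<Longrightarrow> A \<noteq> {} \<Longrightarrow> A = S"
  by (auto simp: conn_def)

lemma conn_singleton: "conn {v}"
  unfolding conn_def closed_in_def by auto

lemma conn_insert:
  assumes "conn S" "u \<in> S" "a u v \<noteq> 0"
  shows "conn (insert v S)"
proof (cases "v \<in> S")
  case False
  have "A = {} \<or> A = insert v S" if A: "closed_in (insert v S) A" for A
  proof (cases "A \<inter> S = {}")
    case True
    then have "A \<subseteq> {v}" using closed_in_subset[OF A] by auto
    moreover have "v \<notin> A" using closed_in_step[OF A, of v u] assms True sym by auto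
    ultimately show ?thesis by auto
  next
    case inter: False
    then have S: "S \<subseteq> A" using conn_subset_closed[OF assms(1) _ A] by auto
    then have "v \<in> A" using closed_in_step[OF A, of u v] assms by auto
    then show ?thesis using S closed_in_subset[OF A] by auto
  qed
  then show ?thesis by (simp add: conn_def)
qed (simp add: assms insert_absorb)

text \<open>No component of \<open>S - {v}\<close> can avoid \<open>T\<close>: a closed set
  containing \<open>T\<close> contains all neighbours of \<open>v\<close>, becomes closed in
  \<open>S\<close> once \<open>v\<close> is added, and is therefore everything. A closed set missing
  \<open>T\<close> is treated through its complement.\<close>

lemma conn_delete:
  assumes S: "conn S" "v \<in> S" and T: "conn T" "T \<subseteq> S - {v}" "nbs S v \<subseteq> T"
  shows "conn (S - {v})"
proof -
  have main: "B = S - {v}" if B: "closed_in (S - {v}) B" "T \<subseteq> B" for B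
  proof -
    have "closed_in S (insert v B)"
      using B S(2) T(3) unfolding closed_in_def nbs_def by auto
    then have "insert v B = S" using conn_closed_eq[OF S(1)] by auto
    then show ?thesis using B closed_in_subset[OF B(1)] by auto
  qed
  have "A = {} \<or> A = S - {v}" if A: "closed_in (S - {v}) A" for A
  proof (cases "T \<inter> A = {}")
    case True
    then have "T \<subseteq> S - {v} - A" using T by auto
    then have "S - {v} - A = S - {v}" using main closed_in_compl[OF A] by auto
    then show ?thesis using closed_in_subset[OF A] by auto
  next
    case False
    then show ?thesis using main[OF A] conn_subset_closed[OF T(1,2) A] by auto
  qed
  moreover have "S - {v} \<noteq> {}" using T conn_nonempty[OF T(1)] by auto
  ultimately show ?thesis by (simp add: conn_def)
qed

lemma conn_delete_leaf:
  assumes "conn S" "y \<in> S" "nbs S y = {w}"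
  shows "conn (S - {y})"
proof -
  have "w \<in> S" "w \<noteq> y" using assms irrefl by (auto simp: nbs_def)
  then show ?thesis using assms by (intro conn_delete[of S y "{w}"] conn_singleton) auto
qed

lemma nbs_nonempty:
  assumes "conn S" "v \<in> S" "S \<noteq> {v}"
  shows "nbs S v \<noteq> {}"
proof
  assume "nbs S v = {}"
  then have "closed_in S {v}" using assms by (auto simp: closed_in_def nbs_def)
  then show False using assms by (auto simp: conn_def)
qed

lemma deg_pos: "finite S \<Longrightarrow> conn S \<Longrightarrow> v \<in> S \<Longrightarrow> S \<noteq> {v} \<Longrightarrow> 1 \<le> deg S v"
  using nbs_nonempty[of S v] by (simp add: deg_def card_gt_0_iff Suc_leI)

text \<open>A largest proper connected subset has an edge leaving it. Adding the far endpoint keeps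
  it connected, so by maximality this already gives all of \<open>S\<close>.\<close>

lemma exists_noncut:
  assumes fin: "finite S" and S: "conn S" "S \<noteq> {x}" "x \<in> S"
  obtains v where "v \<in> S" "conn (S - {v})"
proof -
  let ?P = "\<lambda>K. conn K \<and> K \<subset> S"
  have "?P {x}" using conn_singleton S by auto
  then obtain K where K: "?P K" "\<And>L. ?P L \<Longrightarrow> card L \<le> card K"
    using ex_has_greatest_nat[of ?P "{x}" card "card S"] psubset_card_mono[OF fin]
    by (metis less_imp_le)
  have "\<not> closed_in S K" using S K by (auto simp: conn_def)
  then obtain u v where uv: "u \<in> K" "v \<in> S - K" "a u v \<noteq> 0" using K by (auto simp: closed_in_def)
  have "conn (insert v K)" using conn_insert K uv by auto
  moreover have "card (insert v K) = Suc (card K)"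
    using uv K finite_subset[OF _ fin] by (intro card_insert_disjoint) auto
  ultimately have "insert v K = S" using K uv by (metis Suc_n_not_le_n DiffE insert_subset psubsetI psubsetE)
  then have "K = S - {v}" using uv by auto
  then show ?thesis using that[of v] uv K by auto
qed

lemma nbs_closed: "closed_in S K \<Longrightarrow> v \<in> K \<Longrightarrow> nbs S v = nbs K v"
  by (auto simp: nbs_def closed_in_def)

lemma deg_closed: "closed_in S K \<Longrightarrow> v \<in> K \<Longrightarrow> deg S v = deg K v"
  by (simp add: deg_def nbs_closed)

lemma deg_delete:
  assumes "finite S" "b \<in> S"
  shows "deg S v = deg (S - {b}) v + (if a v b \<noteq> 0 then 1 else 0)"
proof -
  have "nbs S v = (if a v b \<noteq> 0 then insert b (nbs (S - {b}) v) else nbs (S - {b}) v)"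
    using assms by (auto simp: nbs_def)
  then show ?thesis using assms by (simp add: deg_def nbs_def)
qed

lemma deg_mono: "finite S \<Longrightarrow> T \<subseteq> S \<Longrightarrow> deg T v \<le> deg S v"
  unfolding deg_def by (intro card_mono) (auto simp: nbs_def)

lemma comps_closed: "K \<in> comps S \<Longrightarrow> closed_in S K"
  by (simp add: comps_def)

lemma comps_conn: "K \<in> comps S \<Longrightarrow> conn K"
  by (simp add: comps_def)

lemma comps_subset: "K \<in> comps S \<Longrightarrow> K \<subseteq> S"
  by (simp add: comps_def closed_in_def)

lemma finite_comps: "finite S \<Longrightarrow> finite (comps S)"
  by (rule finite_subset[of _ "Pow S"]) (auto dest: comps_subset)

lemma comps_disjoint: "K \<in> comps S \<Longrightarrow> L \<in> comps S \<Longrightarrow> K \<noteq> L \<Longrightarrow> K \<inter> L = {}"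
  using conn_subset_closed by (metis comps_closed comps_conn comps_subset inf_commute subset_antisym)

lemma comps_cover:
  assumes fin: "finite S" and v: "v \<in> S"
  obtains K where "K \<in> comps S" "v \<in> K"
proof -
  let ?P = "\<lambda>K. closed_in S K \<and> v \<in> K"
  have "?P S" using v by (simp add: closed_in_def)
  \<comment> \<open>A smallest closed set around \<open>v\<close> is connected: a proper closed part
    and its complement would both be smaller and closed, and one of them contains
    \<open>v\<close>.\<close>
  then obtain K where K: "?P K" "\<And>L. ?P L \<Longrightarrow> card K \<le> card L"
    using ex_has_least_nat[of ?P S card] by auto
  have finK: "finite K" using K fin closed_in_subset finite_subset by metis
  have "A = {} \<or> A = K" if A: "closed_in K A" for A
  proof (rule ccontr)
    assume n: "\<not> (A = {} \<or> A = K)"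
    have AK: "A \<subseteq> K" using A by (rule closed_in_subset)
    have "closed_in S A" "closed_in S (K - A)"
      using K A closed_in_compl closed_in_trans by metis+
    moreover have "card A < card K" "card (K - A) < card K"
      using n AK finK by (auto intro!: psubset_card_mono)
    ultimately show False using K(1) K(2)[of A] K(2)[of "K - A"] by (cases "v \<in> A") auto
  qed
  then have "conn K" using K by (auto simp: conn_def)
  then show ?thesis using that K by (auto simp: comps_def)
qed

lemma Union_comps: "finite S \<Longrightarrow> \<Union> (comps S) = S"
  using comps_cover comps_subset by (metis Sup_le_iff UnionI subsetI subset_antisym)

lemma sum_comps:
  fixes f :: "'a \<Rightarrow> 'b :: comm_monoid_add"
  assumes "finite S"
  shows "sum f S = (\<Sum>K\<in>comps S. sum f K)"
proof -
  have "\<forall>K\<in>comps S. finite K" using assms comps_subset finite_subset by metis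
  moreover have "\<forall>K\<in>comps S. \<forall>L\<in>comps S. K \<noteq> L \<longrightarrow> K \<inter> L = {}" using comps_disjoint by blast
  ultimately have "sum f (\<Union> (comps S)) = (sum \<circ> sum) f (comps S)" by (rule sum.Union_disjoint)
  then show ?thesis using Union_comps[OF assms] by simp
qed

lemma eta_Union:
  assumes "finite F" "F \<subseteq> comps S" "finite S"
  shows "\<eta> (\<Union>F) = (\<Sum>K\<in>F. \<eta> K)"
  using assms(1,2)
proof (induction F rule: finite_induct)
  case empty then show ?case by (simp add: eta_empty)
next
  case (insert K F)
  have K: "K \<in> comps S" using insert by auto
  have disj: "K \<inter> \<Union>F = {}" using insert comps_disjoint[OF K] by blast
  have "\<Union>F \<subseteq> S" using insert comps_subset by auto
  then have na: "a u v = 0 \<and> a v u = 0" if "u \<in> K" "v \<in> \<Union>F" for u v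
    using that disj comps_closed[OF K] sym[of u v] unfolding closed_in_def by (metis DiffI Int_iff empty_iff subsetD)
  have "\<eta> (K \<union> \<Union>F) = \<eta> K + \<eta> (\<Union>F)"
    using disj na finite_subset[OF comps_subset[OF K] assms(3)] finite_subset[OF \<open>\<Union>F \<subseteq> S\<close> assms(3)]
    by (intro eta_disjoint_Un) auto
  then show ?case using insert by simp
qed

lemma eta_comps: "finite S \<Longrightarrow> \<eta> S = (\<Sum>K\<in>comps S. \<eta> K)"
  using eta_Union[of "comps S" S] by (simp add: Union_comps finite_comps)

section \<open>Degree excess and its change under vertex deletion\<close>

definition Phi :: "'a set \<Rightarrow> nat" where
  "Phi S = (\<Sum>v\<in>S. deg S v - 2)"

definition branch_nbs :: "'a set \<Rightarrow> 'a \<Rightarrow> nat" where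
  "branch_nbs K b = card {u \<in> nbs K b. 2 \<le> deg K u}"

text \<open>The slack that a component \<open>K\<close> left after deleting \<open>b\<close> contributes to the bound on \<open>\<eta>\<close>;
  \<open>branch_nbs\<close> is the decrease of \<open>Phi\<close> at the neighbours of \<open>b\<close>.\<close>

definition gap :: "'a set \<Rightarrow> 'a \<Rightarrow> int" where
  "gap K b = int (deg K b) + int (branch_nbs K b) + int (Phi K) - int (\<eta> K)"

lemma card_Collect_sum: "finite S \<Longrightarrow> card {u \<in> S. P u} = (\<Sum>u\<in>S. if P u then 1 else 0)"
  by (simp add: sum.If_cases Int_def)

lemma deg_sum: "finite S \<Longrightarrow> deg S b = (\<Sum>u\<in>S. if a b u \<noteq> 0 then 1 else 0)"
  unfolding deg_def nbs_def by (rule card_Collect_sum)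

lemma branch_nbs_sum:
  "finite S \<Longrightarrow> branch_nbs S b = (\<Sum>u\<in>S. if a b u \<noteq> 0 \<and> 2 \<le> deg S u then 1 else 0)"
  unfolding branch_nbs_def nbs_def using card_Collect_sum[of S "\<lambda>u. a b u \<noteq> 0 \<and> 2 \<le> deg S u"] by simp

text \<open>Losing one neighbour lowers the truncated difference \<open>deg S v - 2\<close> exactly
  when at least two neighbours remain, which is the condition counted by
  \<open>branch_nbs\<close>.\<close>

lemma Phi_delete:
  assumes "finite S" "b \<in> S"
  shows "Phi S = (deg S b - 2) + Phi (S - {b}) + branch_nbs (S - {b}) b"
proof -
  let ?T = "S - {b}"
  have "Phi S = (deg S b - 2) + (\<Sum>v\<in>?T. deg S v - 2)"
    unfolding Phi_def using assms by (rule sum.remove)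
  also have "(\<Sum>v\<in>?T. deg S v - 2)
      = (\<Sum>v\<in>?T. (deg ?T v - 2) + (if a b v \<noteq> 0 \<and> 2 \<le> deg ?T v then 1 else 0))"
  proof (rule sum.cong[OF refl])
    fix v
    show "deg S v - 2 = (deg ?T v - 2) + (if a b v \<noteq> 0 \<and> 2 \<le> deg ?T v then 1 else 0)"
      using deg_delete[OF assms, of v] sym[of b v] by auto
  qed
  also have "\<dots> = Phi ?T + branch_nbs ?T b"
    using assms by (simp add: sum.distrib Phi_def branch_nbs_sum)
  finally show ?thesis by simp
qed

lemma gap_comps:
  assumes fin: "finite S"
  shows "gap S b = (\<Sum>K\<in>comps S. gap K b)"
proof -
  have finK: "finite K" if "K \<in> comps S" for K using that fin comps_subset finite_subset by metis
  have d: "v \<in> K \<Longrightarrow> deg S v = deg K v" if "K \<in> comps S" for v K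
    using that comps_closed deg_closed by metis
  have "deg S b = (\<Sum>K\<in>comps S. deg K b)"
    unfolding deg_sum[OF fin] sum_comps[OF fin] by (intro sum.cong refl) (simp add: deg_sum finK)
  moreover have "branch_nbs S b = (\<Sum>K\<in>comps S. branch_nbs K b)"
    unfolding branch_nbs_sum[OF fin] sum_comps[OF fin]
    by (intro sum.cong refl) (simp add: branch_nbs_sum finK d cong: sum.cong)
  moreover have "Phi S = (\<Sum>K\<in>comps S. Phi K)"
    unfolding Phi_def sum_comps[OF fin] by (intro sum.cong refl) (simp add: d)
  ultimately show ?thesis
    using eta_comps[OF fin] by (simp add: gap_def sum.distrib sum_subtractf)
qed

text \<open>The definition of \<open>gap\<close> is arranged to make this an identity; the degree
  assumption keeps the subtraction of 2 exact. Consequently \<open>\<eta> S \<le> Phi S + 1\<close>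
  needs total gap 2 at an arbitrary \<open>b\<close>, where the nullity may drop by one, but only 0
  at a neighbour of a leaf, where it rises.\<close>

lemma eta_gap:
  assumes "finite S" "b \<in> S" "2 \<le> deg S b"
  shows "int (\<eta> (S - {b})) + gap (S - {b}) b = int (Phi S) + 2"
  using Phi_delete[OF assms(1,2)] deg_delete[OF assms(1,2), of b] irrefl[of b] assms(3)
  by (simp add: gap_def)

text \<open>All that is used about the vertex set of a cycle.\<close>

definition bicon :: "'a set \<Rightarrow> bool" where
  "bicon Z \<longleftrightarrow> Z \<noteq> {} \<and> (\<forall>b\<in>Z. 2 \<le> deg Z b \<and> conn (Z - {b}))"

text \<open>The exceptional graphs of the bound: cycles with \<open>Phi Z = 0\<close> and nullity
  2.\<close>

definition nullcyc :: "'a set \<Rightarrow> bool" where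
  "nullcyc Z \<longleftrightarrow> finite Z \<and> bicon Z \<and> (\<forall>b\<in>Z. deg Z b = 2) \<and> \<eta> Z = 2"

lemma nbs_irrefl: "v \<notin> nbs S v"
  by (simp add: nbs_def irrefl)

lemma bicon_conn:
  assumes "bicon Z" shows "conn Z"
proof -
  obtain b where b: "b \<in> Z" "2 \<le> deg Z b" "conn (Z - {b})" using assms by (auto simp: bicon_def)
  then have "nbs Z b \<noteq> {}" by (auto simp: deg_def)
  then obtain u where u: "u \<in> Z" "a b u \<noteq> 0" by (auto simp: nbs_def)
  then have "u \<in> Z - {b}" "a u b \<noteq> 0" using irrefl sym by auto
  then have "conn (insert b (Z - {b}))" using b conn_insert by blast
  then show ?thesis using b by (simp add: insert_absorb)
qed

lemma Phi_zero: "(\<And>v. v \<in> S \<Longrightarrow> deg S v \<le> 2) \<Longrightarrow> Phi S = 0"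
  by (simp add: Phi_def)

text \<open>Every neighbour of \<open>b\<close> in \<open>K\<close> counts as a branch neighbour.
  This doubles the contribution of the degree and absorbs the surplus nullity, so the gap stays
  nonnegative whenever \<open>b\<close> has a neighbour in \<open>K\<close>.\<close>

lemma gap_nullcyc:
  assumes "nullcyc K" shows "gap K b = 2 * int (deg K b) - 2"
proof -
  have "{u \<in> nbs K b. 2 \<le> deg K u} = nbs K b" using assms by (auto simp: nbs_def nullcyc_def)
  then show ?thesis using assms Phi_zero[of K] by (simp add: gap_def branch_nbs_def deg_def nullcyc_def)
qed

lemma gap_ge:
  assumes "\<eta> K \<le> Phi K + 1"
  shows "int (deg K b) - 1 + int (branch_nbs K b) \<le> gap K b"
  using assms by (simp add: gap_def)

lemma gap_nonneg:
  assumes "\<eta> K \<le> Phi K + 1 \<or> nullcyc K" "1 \<le> deg K b"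
  shows "0 \<le> gap K b"
  using assms gap_ge[of K b] gap_nullcyc[of K b] by auto

lemma comp_deg_pos:
  assumes "finite S" "conn S" "b \<in> S" "K \<in> comps (S - {b})"
  shows "1 \<le> deg K b"
proof -
  have K: "K \<subseteq> S - {b}" "K \<noteq> {}" "finite K"
    using assms comps_subset comps_conn conn_nonempty finite_subset[of K S] by blast+
  have "\<not> closed_in S K" using K assms(2,3) by (auto simp: conn_def)
  then obtain u v where uv: "u \<in> K" "v \<in> S - K" "a u v \<noteq> 0" using K by (auto simp: closed_in_def)
  then have "v = b" using comps_closed[OF assms(4)] by (auto simp: closed_in_def)
  then have "nbs K b \<noteq> {}" using uv sym by (auto simp: nbs_def)
  then show ?thesis using K by (simp add: deg_def Suc_le_eq card_gt_0_iff)
qed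

section \<open>The upper bound on the nullity\<close>

lemma nbs_leaf:
  assumes "deg S y = 1" obtains w where "nbs S y = {w}" "w \<in> S" "a y w \<noteq> 0" "a w y \<noteq> 0" "w \<noteq> y"
proof -
  obtain w where w: "nbs S y = {w}" using assms by (auto simp: deg_def card_1_singleton_iff)
  then have "w \<in> S" "a y w \<noteq> 0" by (auto simp: nbs_def)
  then show ?thesis using that[OF w] sym irrefl by metis
qed

text \<open>Deleting \<open>w\<close> isolates the leaf and raises the nullity, so
  \<open>eta_gap\<close> is applied with one unit gained instead of lost. If \<open>w\<close> has
  degree one the graph is a single edge with trivial kernel, covered by the first
  alternative.\<close>

lemma leaf_bound:
  assumes fin: "finite S" and S: "conn S" "y \<in> S" "nbs S y = {w}"
  shows "\<eta> S \<le> Phi S \<or> 2 \<le> deg S w \<and> int (\<eta> S) + (\<Sum>K\<in>comps (S - {w}). gap K w) \<le> int (Phi S) + 1"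
proof (cases "2 \<le> deg S w")
  case True
  have "w \<in> S" using S by (auto simp: nbs_def)
  then show ?thesis
    using eta_leaf_nb[OF fin S(2,3)] eta_gap[OF fin _ True] gap_comps[of "S - {w}" w] fin True by simp
next
  case False
  have w: "w \<in> S" "y \<noteq> w" "a w y \<noteq> 0" using S sym irrefl nbs_irrefl by (auto simp: nbs_def)
  then have "y \<in> nbs S w" using S by (simp add: nbs_def)
  then have "nbs S w = {y}" using False fin card_le_Suc0_iff_eq[of "nbs S w"] by (auto simp: deg_def)
  then have "closed_in S {y, w}" using S w unfolding closed_in_def nbs_def by auto
  then have "S = {y, w}" using conn_closed_eq[OF S(1)] by blast
  then have "S - {w} = {y}" using w by auto
  then show ?thesis using eta_leaf_nb[OF fin S(2,3)] eta_singleton[of a y] irrefl by simp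
qed

text \<open>In a graph of minimum degree two, a non-cut vertex of degree two without branch
  neighbours passes these properties on to its neighbours.\<close>

lemma noncut_branch_or_cycle:
  assumes fin: "finite S" and S: "conn S" and 3: "\<forall>v\<in>S. 2 \<le> deg S v"
    and False: "\<not> (\<exists>v\<in>S. conn (S - {v}) \<and> (3 \<le> deg S v \<or> 1 \<le> branch_nbs (S - {v}) v))"
  shows "\<forall>v\<in>S. conn (S - {v}) \<and> deg S v = 2"
proof -
  let ?N = "{v \<in> S. conn (S - {v})}"
  have N: "deg S v = 2 \<and> branch_nbs (S - {v}) v = 0" if "v \<in> ?N" for v
    using False that 3 by force
  obtain x where x: "x \<in> S" using conn_nonempty[OF S] by auto
  have "S \<noteq> {x}"
  proof
    assume "S = {x}"
    then have "nbs S x = {}" by (auto simp: nbs_def irrefl)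
    then show False using 3 x by (auto simp: deg_def)
  qed
  then obtain v0 where "v0 \<in> ?N" using exists_noncut[OF fin S _ x] by blast
  moreover have "closed_in S ?N"
    unfolding closed_in_def
  proof (intro conjI ballI)
    fix v y assume v: "v \<in> ?N" and y: "y \<in> S - ?N"
    show "a v y = 0"
    proof (rule ccontr)
      assume vy: "a v y \<noteq> 0"
      then have yv: "y \<noteq> v" "a y v \<noteq> 0" using irrefl sym by auto
      have "y \<in> nbs (S - {v}) v" using y vy yv by (simp add: nbs_def)
      moreover have "{u \<in> nbs (S - {v}) v. 2 \<le> deg (S - {v}) u} = {}"
        using N[OF v] fin by (simp add: branch_nbs_def)
      ultimately have "\<not> 2 \<le> deg (S - {v}) y" by auto
      moreover have "deg S y = deg (S - {v}) y + 1" using deg_delete[OF fin, of v y] v yv by simp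
      \<comment> \<open>As \<open>y\<close> is not a branch neighbour, it is a leaf of
        \<open>S - {v}\<close>. It can be removed there without disconnecting, and \<open>v\<close>
        is then put back through its second neighbour \<open>u\<close>; so \<open>y\<close> is no
        cut vertex either.\<close>
      ultimately have "deg (S - {v}) y = 1" using 3 y by force
      then obtain w where "nbs (S - {v}) y = {w}" using nbs_leaf by blast
      then have conn: "conn (S - {v} - {y})" using conn_delete_leaf[of "S - {v}" y w] v y yv by auto
      have "nbs S v \<noteq> {y}" using N[OF v] by (auto simp: deg_def)
      moreover have "y \<in> nbs S v" using y vy by (simp add: nbs_def)
      ultimately obtain u where "u \<in> nbs S v" "u \<noteq> y" by blast
      then have "u \<in> S - {v} - {y}" "a u v \<noteq> 0" using sym irrefl by (auto simp: nbs_def)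
      then have "conn (insert v (S - {v} - {y}))" using conn conn_insert by blast
      moreover have "insert v (S - {v} - {y}) = S - {y}" using v yv by auto
      ultimately show False using y by auto
    qed
  qed auto
  ultimately have "?N = S" using conn_closed_eq[OF S] by blast
  then show ?thesis using N by blast
qed

text \<open>A leaf allows deletion of its neighbour, where nonnegative gaps suffice. Without leaves,
  a non-cut vertex of degree at least three or with a branch neighbour supplies a gap of two; if
  there is none, the graph is a cycle.\<close>

theorem eta_bound:
  assumes "finite S" "conn S"
  shows "\<eta> S \<le> Phi S + 1 \<or> nullcyc S"
  using assms
proof (induction "card S" arbitrary: S rule: less_induct)
  case less
  note fin = less.prems(1) and S = less.prems(2)
  have IH: "\<eta> K \<le> Phi K + 1 \<or> nullcyc K" if "conn K" "K \<subset> S" for K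
    using less.hyps[of K] that psubset_card_mono[OF fin] finite_subset[OF _ fin] by auto
  have del: "\<eta> S \<le> Phi S + 1" if v: "v \<in> S" "conn (S - {v})" "2 \<le> deg S v"
    and "3 \<le> deg S v \<or> 1 \<le> branch_nbs (S - {v}) v" for v
  proof -
    have d: "deg (S - {v}) v = deg S v" using deg_delete[OF fin v(1), of v] irrefl by simp
    have psub: "S - {v} \<subset> S" using v(1) by auto
    \<comment> \<open>For a null cycle the gap is \<open>2 * deg S v - 2\<close>, at least 2.
      Otherwise it is at least \<open>deg S v - 1\<close> plus the number of branch neighbours, and
      the choice of \<open>v\<close> supplies the second unit.\<close>
    have "2 \<le> gap (S - {v}) v"
      using IH[OF v(2) psub] gap_ge[of "S - {v}" v] gap_nullcyc[of "S - {v}" v] v that(4) unfolding d by auto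
    then show ?thesis using eta_gap[OF fin v(1,3)] eta_le_delete_Suc[OF fin, of a v] by simp
  qed
  consider x where "S = {x}" | y where "y \<in> S" "deg S y = 1" | "\<forall>v\<in>S. 2 \<le> deg S v"
    using deg_pos[OF fin S] by (metis Suc_1 le_antisym not_less_eq_eq One_nat_def)
  then show ?case
  proof cases
    case 1
    then show ?thesis using eta_singleton[of a x, OF irrefl] by simp
  next
    case 2
    obtain w where w: "nbs S y = {w}" "w \<in> S" using nbs_leaf[OF 2(2)] .
    have c: "\<eta> K \<le> Phi K + 1 \<or> nullcyc K" if "K \<in> comps (S - {w})" for K
      using IH[of K] comps_conn[OF that] comps_subset[OF that] w by auto
    have "0 \<le> (\<Sum>K\<in>comps (S - {w}). gap K w)"
      using c comp_deg_pos[OF fin S w(2)] by (intro sum_nonneg gap_nonneg) auto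
    then show ?thesis using leaf_bound[OF fin S 2(1) w(1)] by auto
  next
    case 3
    show ?thesis
    proof (cases "\<exists>v\<in>S. conn (S - {v}) \<and> (3 \<le> deg S v \<or> 1 \<le> branch_nbs (S - {v}) v)")
      case True
      then show ?thesis using del 3 by auto
    next
      case False
      have all: "conn (S - {v}) \<and> deg S v = 2" if "v \<in> S" for v
        using noncut_branch_or_cycle[OF fin S 3 False] that by blast
      obtain x where x: "x \<in> S" using conn_nonempty[OF S] by auto
      have bic: "bicon S" using all conn_nonempty[OF S] by (auto simp: bicon_def)
      have Phi: "Phi S = 0" using all by (simp add: Phi_zero)
      have d: "deg (S - {x}) x = 2" using deg_delete[OF fin x, of x] irrefl all[OF x] by simp
      have psub: "S - {x} \<subset> S" using x by auto
      \<comment> \<open>Only one unit is available here, which yields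
        \<open>\<eta> S \<le> 2\<close>; the value 2 is precisely the exceptional case.\<close>
      have "1 \<le> gap (S - {x}) x"
        using IH[OF _ psub] all[OF x] x gap_ge[of "S - {x}" x] gap_nullcyc[of "S - {x}" x] d by auto
      then have "\<eta> S \<le> 2"
        using eta_gap[OF fin x] eta_le_delete_Suc[OF fin, of a x] Phi all[OF x] by simp
      then show ?thesis using bic all fin Phi by (auto simp: nullcyc_def)
    qed
  qed
qed

end

section \<open>Extremal graphs\<close>

context weighted_graph
begin

definition extremal :: "'a set \<Rightarrow> bool" where
  "extremal S \<longleftrightarrow> finite S \<and> conn S \<and> \<eta> S = Phi S + 1"

text \<open>The degrees encode that a single edge leaves \<open>Z\<close> and that it starts at
  \<open>l\<close>, since inside \<open>Z\<close> all degrees are two.\<close>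

definition pendant :: "'a set \<Rightarrow> 'a set \<Rightarrow> 'a \<Rightarrow> bool" where
  "pendant S Z l \<longleftrightarrow> Z \<subseteq> S \<and> nullcyc Z \<and> l \<in> Z \<and> deg S l = 3 \<and> (\<forall>u\<in>Z - {l}. deg S u = 2)"

lemma nullcyc_finite: "nullcyc Z \<Longrightarrow> finite Z" by (simp add: nullcyc_def)
lemma nullcyc_bicon: "nullcyc Z \<Longrightarrow> bicon Z" by (simp add: nullcyc_def)
lemma nullcyc_deg: "nullcyc Z \<Longrightarrow> v \<in> Z \<Longrightarrow> deg Z v = 2" by (simp add: nullcyc_def)

lemma bicon_deg: "bicon Z \<Longrightarrow> finite S \<Longrightarrow> Z \<subseteq> S \<Longrightarrow> v \<in> Z \<Longrightarrow> 2 \<le> deg S v"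
  using deg_mono[of S Z v] by (auto simp: bicon_def)

lemma deg_comp:
  assumes "finite S" "w \<in> S" "K \<in> comps (S - {w})" "v \<in> K"
  shows "deg S v = deg K v + (if a v w \<noteq> 0 then 1 else 0)"
  using deg_delete[OF assms(1,2), of v] deg_closed[OF comps_closed[OF assms(3)] assms(4)] by simp

lemma deg_le_1_cases:
  assumes "finite S" "conn S" "y \<in> S" "deg S y \<le> 1"
  shows "S = {y} \<or> deg S y = 1"
  using deg_pos[OF assms(1-3)] assms(4) by (cases "S = {y}") auto

text \<open>Equality leaves no slack in \<open>leaf_bound\<close>, so the nonnegative gaps of the
  components all vanish. A zero gap means one edge from \<open>w\<close> to \<open>K\<close>; if
  \<open>K\<close> is not a null cycle, it also makes \<open>K\<close> extremal and leaves no branch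
  neighbour, so the end \<open>u\<close> of that edge has degree at most one in
  \<open>K\<close>.\<close>

lemma extremal_leaf:
  assumes S: "extremal S" and y: "y \<in> S" "nbs S y = {w}"
  shows "2 \<le> deg S w"
    and "K \<in> comps (S - {w}) \<Longrightarrow> \<exists>u. nbs K w = {u} \<and> (nullcyc K \<or> extremal K \<and> deg K u \<le> 1)"
proof -
  have fin: "finite S" and cS: "conn S" and e: "\<eta> S = Phi S + 1" using S by (auto simp: extremal_def)
  have w: "w \<in> S" using y by (auto simp: nbs_def)
  have lb: "2 \<le> deg S w" "(\<Sum>K\<in>comps (S - {w}). gap K w) \<le> 0"
    using leaf_bound[OF fin cS y] e by auto
  show "2 \<le> deg S w" by (rule lb)
  have finK: "finite K" if "K \<in> comps (S - {w})" for K
    using comps_subset[OF that] fin by (meson finite_Diff finite_subset)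
  have bd: "\<eta> K \<le> Phi K + 1 \<or> nullcyc K" if "K \<in> comps (S - {w})" for K
    using eta_bound[OF finK[OF that] comps_conn[OF that]] .
  have nn: "0 \<le> gap K w" if "K \<in> comps (S - {w})" for K
    using gap_nonneg bd[OF that] comp_deg_pos[OF fin cS w that] by blast
  assume K: "K \<in> comps (S - {w})"
  have fc: "finite (comps (S - {w}))" using fin by (simp add: finite_comps)
  have "(\<Sum>K\<in>comps (S - {w}). gap K w) = 0" using lb sum_nonneg[of "comps (S - {w})" "\<lambda>K. gap K w"] nn by force
  then have g: "gap K w = 0" using sum_nonneg_eq_0_iff[OF fc nn] K by simp
  have d: "1 \<le> deg K w" using comp_deg_pos[OF fin cS w K] .
  have "deg K w = 1 \<and> (nullcyc K \<or> \<eta> K = Phi K + 1 \<and> branch_nbs K w = 0)"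
  proof (cases "nullcyc K")
    case True
    then show ?thesis using gap_nullcyc[OF True, of w] g by simp
  next
    case False
    then have "\<eta> K \<le> Phi K + 1" using bd[OF K] by simp
    then show ?thesis using gap_ge[of K w] g d by (auto simp: gap_def)
  qed
  moreover obtain u where u: "nbs K w = {u}" using calculation by (auto simp: deg_def card_1_singleton_iff)
  moreover have "deg K u \<le> 1" if "branch_nbs K w = 0"
  proof -
    have "{x \<in> nbs K w. 2 \<le> deg K x} = {}" using that finK[OF K] by (simp add: branch_nbs_def)
    then show ?thesis using u by auto
  qed
  ultimately show "\<exists>u. nbs K w = {u} \<and> (nullcyc K \<or> extremal K \<and> deg K u \<le> 1)"
    using finK[OF K] comps_conn[OF K] by (auto simp: extremal_def)
qed

lemma pendant_comp:
  assumes fin: "finite S" and w: "w \<in> S" and K: "K \<in> comps (S - {w})"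
    and Z: "pendant K Z l" "nbs K w \<inter> Z = {}"
  shows "pendant S Z l"
proof -
  have "deg S v = deg K v" if "v \<in> Z" for v
  proof -
    have "v \<in> K" using that Z by (auto simp: pendant_def)
    moreover have "a v w = 0" using that Z calculation sym[of v w] by (auto simp: nbs_def)
    ultimately show ?thesis using deg_comp[OF fin w K] by simp
  qed
  then show ?thesis using Z comps_subset[OF K] by (auto simp: pendant_def)
qed

lemma pendant_nullcyc_comp:
  assumes fin: "finite S" and w: "w \<in> S" and K: "K \<in> comps (S - {w})"
    and Z: "nullcyc K" "nbs K w = {u}"
  shows "pendant S K u"
proof -
  have u: "u \<in> K" "a w u \<noteq> 0" using Z by (auto simp: nbs_def)
  have "deg S u = 3" using deg_comp[OF fin w K u(1)] nullcyc_deg[OF Z(1) u(1)] u(2) sym[of u w] by simp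
  moreover have "deg S v = 2" if "v \<in> K - {u}" for v
  proof -
    have "a v w = 0" using that Z(2) sym[of v w] by (auto simp: nbs_def)
    then show ?thesis using deg_comp[OF fin w K] nullcyc_deg[OF Z(1)] that by simp
  qed
  ultimately show ?thesis using u Z comps_subset[OF K] by (auto simp: pendant_def)
qed

text \<open>Each vertex of \<open>Z\<close> already has its full allowance of two neighbours inside
  \<open>Z\<close>.\<close>

lemma bicon_closed_in:
  assumes "finite K" "bicon Z" "Z \<subseteq> K" "\<And>v. v \<in> Z \<Longrightarrow> deg K v \<le> 2"
  shows "closed_in K Z"
proof -
  have "nbs K v \<subseteq> Z" if v: "v \<in> Z" for v
  proof -
    have "nbs Z v \<subseteq> nbs K v" using assms(3) by (auto simp: nbs_def)
    moreover have "card (nbs K v) \<le> card (nbs Z v)"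
      using assms(2) assms(4)[OF v] v by (force simp: deg_def bicon_def)
    ultimately have "nbs Z v = nbs K v" using assms(1) by (intro card_seteq) auto
    then show ?thesis by (auto simp: nbs_def)
  qed
  then show ?thesis using assms(3) by (auto simp: closed_in_def nbs_def)
qed

lemma bicon_card2:
  assumes "bicon Z" "v \<in> Z" shows "\<not> nbs Z v \<subseteq> {u}"
proof
  assume "nbs Z v \<subseteq> {u}"
  then have "card (nbs Z v) \<le> card {u}" by (intro card_mono) auto
  then show False using assms by (auto simp: bicon_def deg_def)
qed

lemma extremal_bicon_pendant:
  assumes "extremal S" "y \<in> S" "deg S y \<le> 1" "bicon Z" "Z \<subseteq> S"
  shows "\<exists>l. pendant S Z l"
  using assms
proof (induction "card S" arbitrary: S y rule: less_induct)
  case less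
  note Z = less.prems(4,5)
  have fin: "finite S" and cS: "conn S" using less.prems by (auto simp: extremal_def)
  have yZ: "y \<notin> Z" using bicon_deg[OF Z(1) fin Z(2), of y] less.prems(3) by auto
  then have "S \<noteq> {y}" using Z by (auto simp: bicon_def)
  then have "deg S y = 1" using deg_le_1_cases[OF fin cS less.prems(2,3)] by simp
  then obtain w where w: "nbs S y = {w}" "w \<in> S" using nbs_leaf by metis
  note ext = extremal_leaf(2)[OF less.prems(1,2) w(1)]
  \<comment> \<open>If \<open>w\<close> were on \<open>Z\<close>, the connected rest of
    \<open>Z\<close> would lie in a single component, to which \<open>w\<close> has only one edge;
    but \<open>w\<close> has two neighbours on \<open>Z\<close>.\<close>
  have "w \<notin> Z"
  proof
    assume wZ: "w \<in> Z"
    then have c: "conn (Z - {w})" using Z by (auto simp: bicon_def)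
    then obtain x where x: "x \<in> Z - {w}" using conn_nonempty by blast
    then obtain K where K: "K \<in> comps (S - {w})" "x \<in> K" using comps_cover[of "S - {w}" x] fin Z by blast
    have "Z - {w} \<subseteq> K" using conn_subset_closed[OF c _ comps_closed[OF K(1)]] x K Z by blast
    moreover obtain u where "nbs K w = {u}" using ext[OF K(1)] by auto
    ultimately have "nbs Z w \<subseteq> {u}" using irrefl by (auto simp: nbs_def)
    then show False using bicon_card2[OF Z(1) wZ] by blast
  qed
  then have ZS: "Z \<subseteq> S - {w}" using Z by auto
  have cZ: "conn Z" using Z bicon_conn by simp
  then obtain x where x: "x \<in> Z" using conn_nonempty by blast
  then obtain K where K: "K \<in> comps (S - {w})" "x \<in> K" using comps_cover[of "S - {w}" x] fin ZS by blast
  have ZK: "Z \<subseteq> K" using conn_subset_closed[OF cZ ZS comps_closed[OF K(1)]] x K by blast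
  obtain u where u: "nbs K w = {u}" "nullcyc K \<or> extremal K \<and> deg K u \<le> 1" using ext[OF K(1)] by auto
  have uK: "u \<in> K" using u(1) by (auto simp: nbs_def)
  show ?case
  proof (cases "nullcyc K")
    case True
    have "deg K v \<le> 2" if "v \<in> Z" for v using nullcyc_deg[OF True, of v] ZK that by auto
    then have "closed_in K Z" by (rule bicon_closed_in[OF nullcyc_finite[OF True] Z(1) ZK])
    then have "Z = K" using conn_closed_eq[OF comps_conn[OF K(1)]] x by blast
    then show ?thesis using pendant_nullcyc_comp[OF fin w(2) K(1) True u(1)] by blast
  next
    case False
    then have e: "extremal K" "deg K u \<le> 1" using u by auto
    have "K \<subset> S" using comps_subset[OF K(1)] w by auto
    then have "card K < card S" using fin psubset_card_mono by blast
    then obtain l where l: "pendant K Z l" using less.hyps[OF _ e(1) uK e(2) Z(1) ZK] by auto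
    have "u \<notin> Z" using bicon_deg[OF Z(1) _ ZK, of u] e by (auto simp: extremal_def)
    then show ?thesis using pendant_comp[OF fin w(2) K(1) l] u by auto
  qed
qed

text \<open>The second claim serves \<open>extremal_exists_pendant\<close>, where a pendant cycle
  has to avoid a prescribed neighbour \<open>z\<close> of a deleted vertex. With one leaf,
  \<open>Phi S = 2 c - 1\<close>, so \<open>2 \<le> Phi S\<close> excludes a single cycle with a
  tail, whose only cycle might contain \<open>z\<close>.\<close>

lemma extremal_one_leaf:
  assumes "extremal S" "y \<in> S" "deg S y = 1" "\<forall>v\<in>S - {y}. 2 \<le> deg S v"
  shows "(\<exists>Z l. pendant S Z l) \<and> (2 \<le> Phi S \<longrightarrow> (\<forall>z. \<exists>Z l. pendant S Z l \<and> z \<notin> Z))"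
  using assms
proof (induction "card S" arbitrary: S y rule: less_induct)
  case less
  have fin: "finite S" and cS: "conn S" and eS: "\<eta> S = Phi S + 1" using less.prems by (auto simp: extremal_def)
  note y = less.prems(2,3) and min2 = less.prems(4)
  obtain w where w: "nbs S y = {w}" "w \<in> S" "a w y \<noteq> 0" "w \<noteq> y" using nbs_leaf[OF y(2)] by metis
  note ext = extremal_leaf[OF less.prems(1) y(1) w(1)]
  have cy: "{y} \<in> comps (S - {w})"
    using w y conn_singleton unfolding comps_def closed_in_def nbs_def by auto
  \<comment> \<open>As \<open>y\<close> is the only leaf of \<open>S\<close>, the endpoint
    \<open>u\<close> has degree at least two in \<open>S\<close>, hence exactly one in
    \<open>K\<close> when \<open>K\<close> is no null cycle. So \<open>K\<close> again has exactly
    one leaf, and the induction applies.\<close>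
  have cmp: "\<exists>u. nbs K w = {u} \<and> u \<in> K \<and> (nullcyc K \<or>
      extremal K \<and> deg K u = 1 \<and> (\<forall>v\<in>K - {u}. 2 \<le> deg K v) \<and> card K < card S)"
    if K: "K \<in> comps (S - {w})" "y \<notin> K" for K
  proof -
    obtain u where u: "nbs K w = {u}" "nullcyc K \<or> extremal K \<and> deg K u \<le> 1" using ext(2)[OF K(1)] by auto
    have KS: "K \<subset> S" using comps_subset[OF K(1)] w by auto
    have uK: "u \<in> K" "a u w \<noteq> 0" using u(1) sym by (auto simp: nbs_def)
    have "deg S u = deg K u + 1" using deg_comp[OF fin w(2) K(1) uK(1)] uK by simp
    moreover have "2 \<le> deg S u" using min2 uK(1) KS K(2) by auto
    moreover have "2 \<le> deg K v" if "v \<in> K - {u}" for v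
    proof -
      have "a v w = 0" using that u(1) sym[of v w] by (auto simp: nbs_def)
      then have "deg S v = deg K v" using deg_comp[OF fin w(2) K(1)] that by simp
      moreover have "2 \<le> deg S v" using min2 that KS K(2) by auto
      ultimately show ?thesis by simp
    qed
    ultimately show ?thesis using u uK psubset_card_mono[OF fin KS] by auto
  qed
  have lift: "pendant S Z l" if K: "K \<in> comps (S - {w})" "nbs K w = {u}" "extremal K" "deg K u = 1"
    and Z: "pendant K Z l" for K u Z l
  proof -
    have "u \<notin> Z" using bicon_deg[of Z K u] Z K(3,4) by (auto simp: pendant_def nullcyc_def extremal_def)
    then show ?thesis using pendant_comp[OF fin w(2) K(1) Z] K(2) by auto
  qed
  have pend: "\<exists>Z l. pendant S Z l \<and> Z \<subseteq> K" if K: "K \<in> comps (S - {w})" "y \<notin> K" for K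
  proof -
    obtain u where u: "nbs K w = {u}" "u \<in> K" and c: "nullcyc K \<or>
      extremal K \<and> deg K u = 1 \<and> (\<forall>v\<in>K - {u}. 2 \<le> deg K v) \<and> card K < card S" using cmp[OF K] by auto
    from c show ?thesis
    proof
      assume "nullcyc K"
      then show ?thesis using pendant_nullcyc_comp[OF fin w(2) K(1) _ u(1)] by blast
    next
      assume e: "extremal K \<and> deg K u = 1 \<and> (\<forall>v\<in>K - {u}. 2 \<le> deg K v) \<and> card K < card S"
      then obtain Z l where Z: "pendant K Z l" using less.hyps[of K u] u by blast
      then have "pendant S Z l" using lift[OF K(1) u(1)] e by blast
      moreover have "Z \<subseteq> K" using Z by (simp add: pendant_def)
      ultimately show ?thesis by blast
    qed
  qed
  have yw: "y \<in> nbs S w" using y w by (simp add: nbs_def)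
  have "nbs S w \<noteq> {y}" using ext(1) by (auto simp: deg_def)
  then obtain u' where u': "u' \<in> nbs S w" "u' \<noteq> y" using yw by blast
  then have "u' \<in> S - {w}" using irrefl by (auto simp: nbs_def)
  then obtain K where K: "K \<in> comps (S - {w})" "u' \<in> K" using comps_cover[of "S - {w}" u'] fin by blast
  have yK: "y \<notin> K" using comps_disjoint[OF cy K(1)] K u' by auto
  have first: "\<exists>Z l. pendant S Z l" using pend[OF K(1) yK] by blast
  moreover have "\<exists>Z l. pendant S Z l \<and> z \<notin> Z" if Phi: "2 \<le> Phi S" for z
  proof (cases "\<exists>L\<in>comps (S - {w}). y \<notin> L \<and> z \<notin> L")
    case True
    then show ?thesis using pend by blast
  next
    case False
    have zK: "z \<in> K" using False K(1) yK by blast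
    \<comment> \<open>With no component free of both \<open>y\<close> and \<open>z\<close>, all
      components other than \<open>{y}\<close> share \<open>z\<close> and so coincide. Then
      \<open>w\<close> is a vertex of degree two on the tail, and the leaf is moved along
      it.\<close>
    have only: "L = {y} \<or> L = K" if L: "L \<in> comps (S - {w})" for L
    proof (cases "y \<in> L")
      case True then show ?thesis using comps_disjoint[OF cy L] by auto
    next
      case False' : False
      then have "z \<in> L" using False L by blast
      then show ?thesis using comps_disjoint[OF K(1) L] zK by auto
    qed
    have Sw: "S - {w} = insert y K"
    proof
      show "S - {w} \<subseteq> insert y K"
        using Union_comps[of "S - {w}"] fin only by auto
      show "insert y K \<subseteq> S - {w}" using comps_subset[OF K(1)] comps_subset[OF cy] by auto
    qed
    obtain u where u: "nbs K w = {u}" "u \<in> K" and c: "nullcyc K \<or>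
      extremal K \<and> deg K u = 1 \<and> (\<forall>v\<in>K - {u}. 2 \<le> deg K v) \<and> card K < card S" using cmp[OF K(1) yK] by auto
    have nb: "nbs (S - {w}) w = {y, u}" unfolding Sw using u(1) w by (auto simp: nbs_def)
    then have "nbs S w = {y, u}" using irrefl by (auto simp: nbs_def)
    moreover have "y \<noteq> u" using u yK by auto
    ultimately have d2: "deg S w = 2" by (simp add: deg_def)
    have dK: "deg (S - {w}) v = deg K v" if "v \<in> K" for v
      using deg_closed[OF comps_closed[OF K(1)] that] .
    have dy: "deg (S - {w}) y = 0"
      using deg_closed[OF comps_closed[OF cy], of y] by (simp add: deg_def nbs_def irrefl)
    have finK: "finite K" using Sw fin by (metis finite_Diff finite_insert)
    have PhiK: "Phi (S - {w}) = Phi K"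
      unfolding Phi_def Sw[symmetric] using finK yK dK dy
      by (subst Sw) (simp add: sum.insert)
    have bn: "branch_nbs (S - {w}) w = (if 2 \<le> deg K u then 1 else 0)"
    proof -
      have "{x \<in> nbs (S - {w}) w. 2 \<le> deg (S - {w}) x} = (if 2 \<le> deg K u then {u} else {})"
        unfolding nb using dy dK[OF u(2)] by auto
      then show ?thesis by (simp add: branch_nbs_def)
    qed
    have Phi_eq: "Phi S = Phi K + (if 2 \<le> deg K u then 1 else 0)"
      using Phi_delete[OF fin w(2)] d2 PhiK bn by simp
    \<comment> \<open>A null cycle \<open>K\<close> would give \<open>Phi S = 1\<close>. In the
      remaining case \<open>u\<close> is a leaf of \<open>K\<close>, and shortening the tail does
      not change \<open>Phi\<close>.\<close>
    from c have e: "extremal K \<and> deg K u = 1 \<and> (\<forall>v\<in>K - {u}. 2 \<le> deg K v) \<and> card K < card S"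
    proof
      assume "nullcyc K"
      then have "Phi K = 0" by (simp add: Phi_zero nullcyc_deg)
      then show ?thesis using Phi_eq Phi by (auto split: if_splits)
    qed
    then have "2 \<le> Phi K" using Phi_eq Phi by simp
    then obtain Z l where Z: "pendant K Z l" "z \<notin> Z" using less.hyps[of K u] e u by blast
    then show ?thesis using lift[OF K(1) u(1)] e by blast
  qed
  ultimately show ?case by blast
qed

section \<open>Pruning pendant null cycles\<close>

lemma pendant_nbs:
  assumes fin: "finite S" and Z: "pendant S Z l" and u: "u \<in> Z - {l}"
  shows "nbs S u \<subseteq> Z"
proof -
  have "Z \<subseteq> S" and n: "nullcyc Z" and d2: "deg S u = 2" using Z u by (auto simp: pendant_def)
  then have "nbs Z u \<subseteq> nbs S u" by (auto simp: nbs_def)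
  moreover have "card (nbs S u) \<le> card (nbs Z u)"
    using d2 u nullcyc_deg[OF n, of u] by (simp add: deg_def)
  ultimately have "nbs Z u = nbs S u" using fin by (intro card_seteq) auto
  then show ?thesis by (auto simp: nbs_def)
qed

text \<open>Removing \<open>l\<close> keeps \<open>Z\<close> connected and makes
  \<open>Z0 - {l}\<close> closed, so \<open>Z\<close> cannot leave \<open>Z0\<close>. A cycle
  contains no smaller set of this kind.\<close>

lemma pendant_bicon_eq:
  assumes fin: "finite S" and Z0: "pendant S Z0 l" and Z: "bicon Z" "Z \<subseteq> S" "Z \<inter> (Z0 - {l}) \<noteq> {}"
  shows "Z = Z0"
proof -
  have n0: "nullcyc Z0" and Z0S: "Z0 \<subseteq> S" and l: "l \<in> Z0"
    using Z0 by (auto simp: pendant_def)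
  have nb: "nbs S u \<subseteq> Z0" if "u \<in> Z0 - {l}" for u using pendant_nbs[OF fin Z0 that] .
  have cl: "closed_in (S - {l}) (Z0 - {l})"
    using nb Z0S by (auto simp: closed_in_def nbs_def)
  have eq: "Z = Z0" if "Z \<subseteq> Z0"
  proof -
    have "deg Z0 v \<le> 2" if "v \<in> Z" for v using nullcyc_deg[OF n0, of v] \<open>Z \<subseteq> Z0\<close> that by auto
    then have "closed_in Z0 Z" by (rule bicon_closed_in[OF nullcyc_finite[OF n0] Z(1) that])
    then show ?thesis using conn_closed_eq[OF bicon_conn[OF nullcyc_bicon[OF n0]]] Z by auto
  qed
  have "conn (Z - {l})" using Z(1) bicon_conn[OF Z(1)] by (cases "l \<in> Z") (auto simp: bicon_def)
  then have "Z - {l} \<subseteq> Z0 - {l}"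
    using conn_subset_closed[of "Z - {l}" "S - {l}" "Z0 - {l}"] cl Z by blast
  then show ?thesis using eq l by auto
qed

text \<open>If all kernel vectors vanished at \<open>u\<close>, the path \<open>K - {u}\<close>
  would inherit nullity two, against \<open>eta_bound\<close>. This supplies the vector that
  \<open>eta_attach\<close> requires, at any vertex of the cycle.\<close>

lemma nullcyc_kernel:
  assumes K: "nullcyc K" and u: "u \<in> K"
  shows "\<exists>x\<in>ker K. x u \<noteq> 0"
proof (rule ccontr)
  assume n: "\<not> (\<exists>x\<in>ker K. x u \<noteq> 0)"
  have fin: "finite K" using K nullcyc_finite by simp
  have eta: "2 \<le> \<eta> (K - {u})"
    using eta_le_delete[OF fin, of a u] n K by (auto simp: nullcyc_def)
  have c: "conn (K - {u})" using nullcyc_bicon[OF K] u by (auto simp: bicon_def)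
  have le: "deg (K - {u}) v \<le> 2" if "v \<in> K - {u}" for v
    using deg_mono[OF fin, of "K - {u}" v] nullcyc_deg[OF K, of v] that by auto
  have "nbs K u \<noteq> {}" using nullcyc_deg[OF K u] by (auto simp: deg_def)
  then obtain v where v: "v \<in> K" "a u v \<noteq> 0" by (auto simp: nbs_def)
  then have "v \<in> K - {u}" "a v u \<noteq> 0" using irrefl sym by auto
  then have "deg (K - {u}) v = 1" "v \<in> K - {u}"
    using deg_delete[OF fin u, of v] nullcyc_deg[OF K v(1)] by auto
  then have "\<not> nullcyc (K - {u})" using nullcyc_deg[of "K - {u}" v] by auto
  then show False using eta_bound[OF _ c] fin Phi_zero[OF le] eta by simp
qed

text \<open>\<open>Phi\<close> loses one because the degree at \<open>l\<close> falls from 3 to 1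
  and the removed vertices contribute nothing; the nullity loses \<open>\<eta> Z - 1 = 1\<close> by
  \<open>eta_attach\<close>.\<close>

lemma pendant_prune:
  assumes fin: "finite S" and Z: "pendant S Z l"
  defines "T \<equiv> S - (Z - {l})"
  shows "l \<in> T" and "conn S \<Longrightarrow> conn T" and "deg T l = 1"
    and "\<And>t. t \<in> T - {l} \<Longrightarrow> deg T t = deg S t"
    and "Phi S = Phi T + 1" and "\<eta> S = \<eta> T + 1"
proof -
  have ZS: "Z \<subseteq> S" and n: "nullcyc Z" and l: "l \<in> Z" and d3: "deg S l = 3"
    and d2: "\<forall>u\<in>Z - {l}. deg S u = 2" using Z by (auto simp: pendant_def)
  have nb: "a u v = 0 \<and> a v u = 0" if "u \<in> Z - {l}" "v \<in> S - Z" for u v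
    using pendant_nbs[OF fin Z that(1)] that sym[of u v] by (auto simp: nbs_def)
  show lT: "l \<in> T" using l ZS by (auto simp: T_def)
  have S: "S = T \<union> Z" and int: "T \<inter> Z = {l}" using ZS l by (auto simp: T_def)
  have finT: "finite T" and finZ: "finite Z" using fin S by auto
  show "conn T" if cS: "conn S"
  proof -
    have "A = {} \<or> A = T" if A: "closed_in T A" for A
    proof (cases "l \<in> A")
      case True
      have "a u v = 0" if uv: "u \<in> A \<union> Z" "v \<in> S - (A \<union> Z)" for u v
      proof (cases "u \<in> Z - {l}")
        case True then show ?thesis using nb uv by auto
      next
        case False
        then have "u \<in> A" using uv \<open>l \<in> A\<close> by auto
        moreover have "v \<in> T - A" using uv by (auto simp: T_def)
        ultimately show ?thesis using A by (auto simp: closed_in_def)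
      qed
      then have "closed_in S (A \<union> Z)"
        using ZS closed_in_subset[OF A] by (auto simp: closed_in_def T_def)
      then have "A \<union> Z = S" using conn_closed_eq[OF cS] True by blast
      then show ?thesis using closed_in_subset[OF A] True by (auto simp: T_def)
    next
      case False
      have "a u v = 0" if uv: "u \<in> A" "v \<in> S - A" for u v
      proof (cases "v \<in> Z - {l}")
        case True
        have "u \<in> T" "u \<noteq> l" using uv False closed_in_subset[OF A] by auto
        then show ?thesis using nb[OF True, of u] by (auto simp: T_def)
      next
        case False
        then have "v \<in> T - A" using uv by (auto simp: T_def)
        then show ?thesis using A uv by (auto simp: closed_in_def)
      qed
      then have "closed_in S A" using closed_in_subset[OF A] by (auto simp: closed_in_def T_def)
      moreover have "A \<noteq> S" using False l ZS by auto
      ultimately show ?thesis using cS by (auto simp: conn_def)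
    qed
    then show ?thesis using lT by (auto simp: conn_def)
  qed
  have "nbs S l = nbs T l \<union> nbs Z l" unfolding S by (auto simp: nbs_def)
  moreover have "nbs T l \<inter> nbs Z l = nbs (T \<inter> Z) l" by (auto simp: nbs_def)
  then have "nbs T l \<inter> nbs Z l = {}" unfolding int by (auto simp: nbs_def irrefl)
  ultimately have "deg S l = deg T l + deg Z l" using finT finZ by (simp add: deg_def card_Un_disjoint)
  then show dl: "deg T l = 1" using d3 nullcyc_deg[OF n l] by simp
  show dt: "deg T t = deg S t" if "t \<in> T - {l}" for t
  proof -
    have "nbs T t = nbs S t" using that nb by (auto simp: nbs_def T_def)
    then show ?thesis by (simp add: deg_def)
  qed
  have "Phi S = (\<Sum>v\<in>T. deg S v - 2) + (\<Sum>v\<in>Z - {l}. deg S v - 2)"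
    unfolding Phi_def using fin ZS by (subst sum.subset_diff[of "Z - {l}"]) (auto simp: T_def)
  also have "(\<Sum>v\<in>Z - {l}. deg S v - 2) = 0" using d2 by simp
  also have "(\<Sum>v\<in>T. deg S v - 2) = (deg S l - 2) + (\<Sum>v\<in>T - {l}. deg S v - 2)"
    using finT lT by (rule sum.remove)
  also have "(\<Sum>v\<in>T - {l}. deg S v - 2) = (\<Sum>v\<in>T - {l}. deg T v - 2)"
    using dt by (intro sum.cong) auto
  also have "\<dots> = Phi T"
    unfolding Phi_def using finT lT dl by (subst sum.remove[of T l]) auto
  finally show "Phi S = Phi T + 1" using d3 by simp
  obtain x where "x \<in> ker Z" "x l \<noteq> 0" using nullcyc_kernel[OF n l] by auto
  moreover have "a u v = 0" if "u \<in> T - {l}" "v \<in> Z - {l}" for u v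
    using nb[of v u] that by (auto simp: T_def)
  ultimately have "\<eta> S + 1 = \<eta> T + \<eta> Z" unfolding S
    using finT finZ int by (intro eta_attach[of T Z l x]) auto
  then show "\<eta> S = \<eta> T + 1" using n by (simp add: nullcyc_def)
qed

text \<open>Two different pendant cycles could meet only in a common attaching vertex, which would
  then have degree at least four.\<close>

lemma pendant_disjoint:
  assumes fin: "finite S" and Z: "pendant S Z l" "pendant S Y m" "Z \<noteq> Y"
  shows "Z \<inter> Y = {}"
proof (rule ccontr)
  have ZY: "nullcyc Z" "Z \<subseteq> S" "nullcyc Y" "Y \<subseteq> S" using Z by (auto simp: pendant_def)
  assume ne: "Z \<inter> Y \<noteq> {}"
  have "Y \<inter> (Z - {l}) = {}" using pendant_bicon_eq[OF fin Z(1) nullcyc_bicon[OF ZY(3)] ZY(4)] Z(3) by blast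
  moreover have "Z \<inter> (Y - {m}) = {}" using pendant_bicon_eq[OF fin Z(2) nullcyc_bicon[OF ZY(1)] ZY(2)] Z(3) by blast
  ultimately have lm: "l = m" "l \<in> Z" "l \<in> Y" "Z \<inter> Y = {l}" using ne by auto
  have "nbs Z l \<inter> nbs Y l = nbs (Z \<inter> Y) l" by (auto simp: nbs_def)
  then have "nbs Z l \<inter> nbs Y l = {}" unfolding lm(4) by (auto simp: nbs_def irrefl)
  then have "card (nbs Z l \<union> nbs Y l) = 4"
    using nullcyc_deg[OF ZY(1) lm(2)] nullcyc_deg[OF ZY(3) lm(3)] ZY nullcyc_finite
    by (simp add: card_Un_disjoint deg_def)
  moreover have "card (nbs Z l \<union> nbs Y l) \<le> card (nbs S l)"
    using fin ZY by (intro card_mono) (auto simp: nbs_def)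
  ultimately show False using Z(1) by (simp add: pendant_def deg_def)
qed

lemma pendant_prune_all:
  assumes "finite I" "finite S" "\<And>i. i \<in> I \<Longrightarrow> pendant S (C i) (l i)"
    "\<And>i j. i \<in> I \<Longrightarrow> j \<in> I \<Longrightarrow> i \<noteq> j \<Longrightarrow> C i \<inter> C j = {}"
  defines "T \<equiv> S - (\<Union>i\<in>I. C i - {l i})"
  shows "\<eta> S = \<eta> T + card I \<and> Phi S = Phi T + card I \<and> (conn S \<longrightarrow> conn T) \<and>
    (\<forall>i\<in>I. l i \<in> T \<and> deg T (l i) = 1) \<and> (\<forall>t\<in>T - l ` I. deg T t = deg S t)"
  using assms(1,3,4) unfolding T_def
proof (induction I rule: finite_induct)
  case empty then show ?case by simp
next
  case (insert i I)
  define U where "U = S - (\<Union>i\<in>I. C i - {l i})"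
  have ih: "\<eta> S = \<eta> U + card I \<and> Phi S = Phi U + card I \<and> (conn S \<longrightarrow> conn U) \<and>
    (\<forall>i\<in>I. l i \<in> U \<and> deg U (l i) = 1) \<and> (\<forall>t\<in>U - l ` I. deg U t = deg S t)"
    unfolding U_def by (rule insert.IH) (use insert.prems in auto)
  then have IH: "\<eta> S = \<eta> U + card I" "Phi S = Phi U + card I" "conn S \<longrightarrow> conn U"
    "\<And>i. i \<in> I \<Longrightarrow> l i \<in> U \<and> deg U (l i) = 1" "\<And>t. t \<in> U - l ` I \<Longrightarrow> deg U t = deg S t"
    by blast+
  have lC: "l j \<in> C j" if "j \<in> insert i I" for j using insert.prems(1)[OF that] by (simp add: pendant_def)
  have disj: "C i \<inter> C j = {}" if "j \<in> I" for j using insert.prems(2)[of i j] insert.hyps that by auto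
  have CiU: "C i \<subseteq> U - l ` I"
  proof
    fix v assume v: "v \<in> C i"
    have "v \<in> S" using v insert.prems(1)[of i] by (auto simp: pendant_def)
    moreover have "v \<notin> C j" if "j \<in> I" for j using disj[OF that] v by auto
    ultimately show "v \<in> U - l ` I" using lC by (auto simp: U_def)
  qed
  \<comment> \<open>The earlier prunings altered degrees only at the attaching vertices of other
    cycles, so \<open>C i\<close> is still pendant.\<close>
  have "deg U v = deg S v" if "v \<in> C i" for v using IH(5) CiU that by blast
  then have P: "pendant U (C i) (l i)" using insert.prems(1)[of i] CiU by (auto simp: pendant_def)
  define W where "W = U - (C i - {l i})"
  have finU: "finite U" using assms(2) by (simp add: U_def)
  note pr = pendant_prune[OF finU P, folded W_def]
  have "l j \<in> W \<and> deg W (l j) = 1" if j: "j \<in> insert i I" for j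
  proof (cases "j = i")
    case True then show ?thesis using pr(1,3) by simp
  next
    case False
    then have jI: "j \<in> I" using j by auto
    have "l j \<notin> C i" using disj[OF jI] lC[OF j] by auto
    then have "l j \<in> W - {l i}" using IH(4)[OF jI] lC[of i] by (auto simp: W_def)
    then show ?thesis using pr(4)[of "l j"] IH(4)[OF jI] by auto
  qed
  moreover have "deg W t = deg S t" if "t \<in> W - l ` insert i I" for t
    using that pr(4)[of t] IH(5)[of t] by (auto simp: W_def)
  moreover have "S - (\<Union>i\<in>insert i I. C i - {l i}) = W" by (auto simp: U_def W_def)
  ultimately show ?case using pr(2,5,6) IH(1-3) insert.hyps by simp
qed

text \<open>Without a leaf, \<open>extremal_leaf\<close> has no starting point. A non-cut vertex of
  degree two is deleted such that exactly one of its neighbours becomes a leaf; a pendant cycle of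
  the rest that avoids the other neighbour is then pendant in \<open>S\<close> as well.\<close>

lemma extremal_exists_pendant:
  assumes S: "extremal S" and min2: "\<forall>v\<in>S. 2 \<le> deg S v" and Phi: "3 \<le> Phi S"
  shows "\<exists>Z l. pendant S Z l"
proof -
  have fin: "finite S" and cS: "conn S" and e: "\<eta> S = Phi S + 1" using S by (auto simp: extremal_def)
  let ?q = "\<lambda>v. branch_nbs (S - {v}) v"
  have dd: "deg (S - {v}) v = deg S v" if "v \<in> S" for v
    using deg_delete[OF fin that, of v] irrefl by simp
  have step: "deg S v + ?q v = 3 \<and> extremal (S - {v})"
    if v: "v \<in> S" "conn (S - {v})" "3 \<le> deg S v \<or> 1 \<le> ?q v" for v
  proof -
    have d: "2 \<le> deg S v" using min2 v by auto
    have g: "gap (S - {v}) v \<le> 2" using eta_gap[OF fin v(1) d] eta_le_delete_Suc[OF fin, of a v] e by simp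
    \<comment> \<open>This is where \<open>3 \<le> Phi S\<close> is used: a null cycle plus a vertex
      of degree two has \<open>Phi\<close> at most 2. The complete bipartite graph on 2 + 3 vertices
      with positive signs is an extremal graph of this excluded shape.\<close>
    have nn: "\<not> nullcyc (S - {v})"
    proof
      assume n: "nullcyc (S - {v})"
      then have "deg S v = 2" using gap_nullcyc[OF n, of v] g d dd[OF v(1)] by simp
      moreover have "Phi (S - {v}) = 0" using Phi_zero[of "S - {v}"] nullcyc_deg[OF n] by simp
      moreover have "?q v \<le> deg (S - {v}) v"
        unfolding branch_nbs_def deg_def[of "S - {v}" v] using fin by (intro card_mono) auto
      ultimately show False using Phi_delete[OF fin v(1)] Phi dd[OF v(1)] by simp
    qed
    then have b: "\<eta> (S - {v}) \<le> Phi (S - {v}) + 1" using eta_bound[OF _ v(2)] fin by simp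
    then have "int (deg S v) - 1 + int (?q v) \<le> 2" using gap_ge[OF b, of v] g dd[OF v(1)] by simp
    then have 3: "deg S v + ?q v = 3" using d v(3) by auto
    have "\<eta> (S - {v}) = Phi (S - {v}) + 1" using b g 3 dd[OF v(1)] by (simp add: gap_def)
    then show ?thesis using 3 v fin by (simp add: extremal_def)
  qed
  have "\<exists>v\<in>S. conn (S - {v}) \<and> (3 \<le> deg S v \<or> 1 \<le> ?q v)"
  proof (rule ccontr)
    assume "\<not> ?thesis"
    then have "\<forall>v\<in>S. deg S v = 2" using noncut_branch_or_cycle[OF fin cS min2] by blast
    then show False using Phi by (simp add: Phi_zero)
  qed
  then obtain v0 where v0: "v0 \<in> S" "conn (S - {v0})" "3 \<le> deg S v0 \<or> 1 \<le> ?q v0" by auto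
  \<comment> \<open>Tightness leaves degree 2 with one branch neighbour or degree 3 with none. In
    the latter case a neighbour \<open>h\<close> has degree two, is not a cut vertex, and sees
    \<open>v0\<close> as a branch neighbour, so \<open>h\<close> is taken instead.\<close>
  have "\<exists>v\<in>S. conn (S - {v}) \<and> deg S v = 2 \<and> ?q v = 1"
  proof (cases "deg S v0 = 2")
    case True
    then show ?thesis using step[OF v0] v0 by auto
  next
    case False
    then have d3: "deg S v0 = 3" "?q v0 = 0" using step[OF v0] min2 v0 by force+
    then have "nbs S v0 \<noteq> {}" by (auto simp: deg_def)
    then obtain h where h: "h \<in> nbs S v0" by auto
    then have hS: "h \<in> S" "h \<noteq> v0" "a v0 h \<noteq> 0" "a h v0 \<noteq> 0" using irrefl sym by (auto simp: nbs_def)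
    have "{u \<in> nbs (S - {v0}) v0. 2 \<le> deg (S - {v0}) u} = {}" using d3 fin by (simp add: branch_nbs_def)
    moreover have "h \<in> nbs (S - {v0}) v0" using hS by (simp add: nbs_def)
    ultimately have "deg (S - {v0}) h < 2" by auto
    moreover have "deg S h = deg (S - {v0}) h + 1" using deg_delete[OF fin v0(1), of h] hS by simp
    ultimately have dh: "deg (S - {v0}) h = 1" "deg S h = 2" using min2 hS by force+
    obtain w where "nbs (S - {v0}) h = {w}" using nbs_leaf[OF dh(1)] by metis
    then have c: "conn (S - {v0} - {h})" using conn_delete_leaf[OF v0(2)] hS by auto
    have "nbs S v0 \<noteq> {h}" using d3 by (auto simp: deg_def)
    then obtain h' where "h' \<in> nbs S v0" "h' \<noteq> h" using h by blast
    then have "h' \<in> S - {v0} - {h}" "a h' v0 \<noteq> 0" using irrefl sym by (auto simp: nbs_def)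
    then have "conn (insert v0 (S - {v0} - {h}))" using c conn_insert by blast
    moreover have "insert v0 (S - {v0} - {h}) = S - {h}" using v0 hS by auto
    ultimately have ch: "conn (S - {h})" by simp
    have "v0 \<in> nbs (S - {h}) h" using hS v0 by (simp add: nbs_def)
    moreover have "2 \<le> deg (S - {h}) v0" using deg_delete[OF fin hS(1), of v0] d3 hS by simp
    ultimately have "1 \<le> ?q h" using fin by (auto simp: branch_nbs_def Suc_le_eq card_gt_0_iff)
    then show ?thesis using step[OF hS(1) ch] dh hS ch by auto
  qed
  then obtain v where v: "v \<in> S" "conn (S - {v})" "deg S v = 2" "?q v = 1" by auto
  let ?H = "S - {v}"
  have eH: "extremal ?H" using step[OF v(1,2)] v by auto
  have PhiH: "2 \<le> Phi ?H" using Phi_delete[OF fin v(1)] v Phi by simp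
  obtain z where z: "{u \<in> nbs ?H v. 2 \<le> deg ?H u} = {z}"
    using v(4) by (auto simp: branch_nbs_def card_1_singleton_iff)
  have nbH: "nbs ?H v = nbs S v" using irrefl by (auto simp: nbs_def)
  have zn: "z \<in> nbs S v" using z nbH by auto
  have "nbs S v \<noteq> {z}" using v by (auto simp: deg_def)
  then obtain y where y: "y \<in> nbs S v" "y \<noteq> z" using zn by blast
  have zy: "nbs S v = {z, y}"
  proof (rule card_seteq[symmetric])
    show "card (nbs S v) \<le> card {z, y}" using v(3) y(2) by (simp add: deg_def)
  qed (use fin zn y in auto)
  have yS: "y \<in> S" "y \<noteq> v" "a y v \<noteq> 0" using y irrefl sym by (auto simp: nbs_def)
  have "\<not> 2 \<le> deg ?H y" using z nbH y by auto
  moreover have "deg S y = deg ?H y + 1" using deg_delete[OF fin v(1), of y] yS by simp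
  ultimately have dy: "deg ?H y = 1" using min2 yS by force
  have "2 \<le> deg ?H t" if t: "t \<in> ?H - {y}" for t
  proof (cases "t = z")
    case True then show ?thesis using z by auto
  next
    case False
    then have "a t v = 0" using t zy sym[of t v] by (auto simp: nbs_def)
    then have "deg ?H t = deg S t" using deg_delete[OF fin v(1), of t] by simp
    then show ?thesis using min2 t by simp
  qed
  \<comment> \<open>The leaf \<open>y\<close> lies on no cycle and \<open>z\<close> is avoided by
    choice, so restoring \<open>v\<close> changes no degree on \<open>Z\<close>.\<close>
  then obtain Z l where Z: "pendant ?H Z l" "z \<notin> Z"
    using extremal_one_leaf[OF eH _ dy] PhiH yS by blast
  have "y \<notin> Z" using bicon_deg[of Z ?H y] Z dy fin by (auto simp: pendant_def nullcyc_def)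
  have "deg S t = deg ?H t" if "t \<in> Z" for t
  proof -
    have "a t v = 0" using that zy Z \<open>y \<notin> Z\<close> sym[of t v] by (auto simp: nbs_def pendant_def)
    then show ?thesis using deg_delete[OF fin v(1), of t] by simp
  qed
  then have "pendant S Z l" using Z by (auto simp: pendant_def)
  then show ?thesis by blast
qed

text \<open>Pruning one pendant null cycle leaves an extremal graph with a leaf, where
  \<open>extremal_bicon_pendant\<close> applies.\<close>

theorem extremal_leaf_free_pendant:
  assumes S: "extremal S" and min2: "\<forall>v\<in>S. 2 \<le> deg S v" and Phi: "3 \<le> Phi S"
    and Z: "bicon Z" "Z \<subseteq> S"
  shows "\<exists>l. pendant S Z l"
proof -
  have fin: "finite S" and cS: "conn S" and e: "\<eta> S = Phi S + 1" using S by (auto simp: extremal_def)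
  obtain Z0 l0 where Z0: "pendant S Z0 l0" using extremal_exists_pendant[OF S min2 Phi] by blast
  let ?T = "S - (Z0 - {l0})"
  note pr = pendant_prune[OF fin Z0]
  have eT: "extremal ?T" using pr(2,5,6) fin cS e by (simp add: extremal_def)
  show ?thesis
  proof (cases "Z \<inter> (Z0 - {l0}) = {}")
    case True
    then have ZT: "Z \<subseteq> ?T" using Z by auto
    obtain l where l: "pendant ?T Z l" using extremal_bicon_pendant[OF eT pr(1) _ Z(1) ZT] pr(3) by auto
    have "l0 \<notin> Z" using bicon_deg[OF Z(1) _ ZT, of l0] pr(3) fin by auto
    then have "deg ?T t = deg S t" if "t \<in> Z" for t using pr(4)[of t] ZT that by auto
    then show ?thesis using l by (auto simp: pendant_def)
  next
    case False
    then show ?thesis using pendant_bicon_eq[OF fin Z0 Z] Z0 by blast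
  qed
qed

end

section \<open>Cycles and trees\<close>

text \<open>The predecessor on a cycle is written \<open>(i + n - 1) mod n\<close>, which also wraps
  around correctly at 0.\<close>

lemma cycle_index_succ_pred:
  fixes i n :: nat
  assumes "i < n" shows "Suc ((i + n - 1) mod n) mod n = i"
proof -
  have "Suc ((i + n - 1) mod n) mod n = Suc (i + n - 1) mod n" by (rule mod_Suc_eq)
  also have "Suc (i + n - 1) = i + n" using assms by simp
  finally show ?thesis using assms by simp
qed

lemma cycle_index_pred_succ:
  fixes j n :: nat
  assumes "j < n" shows "(Suc j mod n + n - 1) mod n = j"
  using assms by (cases "Suc j = n") auto

lemma cycle_index_distinct:
  fixes i n :: nat
  assumes "i < n" "3 \<le> n" shows "Suc i mod n \<noteq> (i + n - 1) mod n"
proof (cases "i = 0")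
  case False
  then have "i + n - 1 = (i - 1) + n" by simp
  then have "(i + n - 1) mod n = (i - 1) mod n" by (simp only: mod_add_self2)
  also have "\<dots> = i - 1" using assms by (intro mod_less) simp
  finally show ?thesis using False assms by (cases "Suc i = n") auto
qed (use assms in auto)

lemma cycle_edges_iff:
  assumes vs: "distinct vs" "i < length vs"
  shows "{vs ! i, v} \<in> cycle_edges vs \<longleftrightarrow>
    v = vs ! (Suc i mod length vs) \<or> v = vs ! ((i + length vs - 1) mod length vs)"
    (is "_ \<longleftrightarrow> v = ?n \<or> v = ?p")
proof
  let ?l = "length vs"
  assume "{vs ! i, v} \<in> cycle_edges vs"
  then obtain j where j: "j < ?l" "{vs ! i, v} = {vs ! j, vs ! (Suc j mod ?l)}"
    by (auto simp: cycle_edges_def)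
  have l: "Suc j mod ?l < ?l" using vs(2) by (intro mod_less_divisor) auto
  from j(2) consider "vs ! i = vs ! j" "v = vs ! (Suc j mod ?l)" | "vs ! i = vs ! (Suc j mod ?l)" "v = vs ! j"
    by (auto simp: doubleton_eq_iff)
  then show "v = ?n \<or> v = ?p"
  proof cases
    case 1
    then show ?thesis using nth_eq_iff_index_eq[OF vs(1) vs(2) j(1)] by simp
  next
    case 2
    then have "i = Suc j mod ?l" using nth_eq_iff_index_eq[OF vs(1) vs(2) l] by simp
    then show ?thesis using 2 cycle_index_pred_succ[OF j(1)] by simp
  qed
next
  let ?l = "length vs"
  have l: "(i + ?l - 1) mod ?l < ?l" using vs(2) by (intro mod_less_divisor) auto
  assume "v = ?n \<or> v = ?p"
  then show "{vs ! i, v} \<in> cycle_edges vs"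
  proof
    assume "v = ?n"
    then show ?thesis using vs(2) by (auto simp: cycle_edges_def)
  next
    assume v: "v = ?p"
    then have "{vs ! i, v} = {vs ! ((i + ?l - 1) mod ?l), vs ! (Suc ((i + ?l - 1) mod ?l) mod ?l)}"
      using cycle_index_succ_pred[OF vs(2)] by auto
    then show ?thesis using l unfolding cycle_edges_def by blast
  qed
qed

context weighted_graph
begin

text \<open>Chords are allowed, so \<open>set vs\<close> need not induce a cycle; what follows from
  it is \<open>bicon (set vs)\<close>.\<close>

definition cycle_list :: "'a list \<Rightarrow> bool" where
  "cycle_list vs \<longleftrightarrow> distinct vs \<and> 3 \<le> length vs \<and>
    (\<forall>u v. {u, v} \<in> cycle_edges vs \<longrightarrow> a u v \<noteq> 0)"

lemma cycle_list_nbs: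
  assumes "cycle_list vs" "i < length vs"
  defines "N \<equiv> {vs ! (Suc i mod length vs), vs ! ((i + length vs - 1) mod length vs)}"
  shows "N \<subseteq> nbs (set vs) (vs ! i)" "card N = 2"
proof -
  have vs: "distinct vs" "3 \<le> length vs" using assms(1) by (auto simp: cycle_list_def)
  have l: "Suc i mod length vs < length vs" "(i + length vs - 1) mod length vs < length vs"
    using assms(2) by (auto intro!: mod_less_divisor)
  show "N \<subseteq> nbs (set vs) (vs ! i)"
    using assms(1) cycle_edges_iff[OF vs(1) assms(2)] l
    by (auto simp: N_def nbs_def cycle_list_def)
  show "card N = 2"
    using cycle_index_distinct[OF assms(2) vs(2)] l by (simp add: N_def nth_eq_iff_index_eq[OF vs(1)])
qed

lemma cycle_list_bicon:
  assumes vs: "cycle_list vs"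
  shows "bicon (set vs)"
proof -
  let ?n = "length vs"
  have n: "3 \<le> ?n" and dist: "distinct vs" using vs by (auto simp: cycle_list_def)
  \<comment> \<open>Periodic indexing turns the cycle without its vertex number \<open>i\<close>
    into the path \<open>f (i + 1), ..., f (i + ?n - 1)\<close> with no wrap-around to
    treat.\<close>
  define f where "f k = vs ! (k mod ?n)" for k
  have fmod: "k mod ?n < ?n" for k using n by (intro mod_less_divisor) auto
  have step: "a (f k) (f (Suc k)) \<noteq> 0" for k
  proof -
    have "f (Suc k) = vs ! (Suc (k mod ?n) mod ?n)" by (simp add: f_def mod_Suc_eq)
    then show ?thesis using cycle_list_nbs(1)[OF vs fmod[of k]] by (auto simp: f_def nbs_def)
  qed
  have "2 \<le> deg (set vs) b \<and> conn (set vs - {b})" if b: "b \<in> set vs" for b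
  proof
    obtain i where i: "i < ?n" "b = vs ! i" using b by (auto simp: in_set_conv_nth)
    show "2 \<le> deg (set vs) b"
      using card_mono[OF _ cycle_list_nbs(1)[OF vs i(1)]] cycle_list_nbs(2)[OF vs i(1)] i(2)
      by (simp add: deg_def)
    have conn: "conn (f ` {Suc i..<Suc i + Suc m})" for m
    proof (induction m)
      case 0
      have "{Suc i..<Suc i + Suc 0} = {Suc i}" by auto
      then show ?case using conn_singleton by simp
    next
      case (Suc m)
      have "{Suc i..<Suc i + Suc (Suc m)} = insert (Suc (Suc i + m)) {Suc i..<Suc i + Suc m}" by auto
      moreover have "f (Suc i + m) \<in> f ` {Suc i..<Suc i + Suc m}" by auto
      ultimately show ?case using conn_insert[OF Suc.IH _ step[of "Suc i + m"]] by simp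
    qed
    have "set vs - {b} = f ` {Suc i..<Suc i + Suc (?n - 2)}"
    proof
      show "set vs - {b} \<subseteq> f ` {Suc i..<Suc i + Suc (?n - 2)}"
      proof
        fix v assume v: "v \<in> set vs - {b}"
        then obtain m where m: "m < ?n" "v = vs ! m" by (auto simp: in_set_conv_nth)
        have "m \<noteq> i" using v m i by auto
        then consider "i < m" | "m < i" by linarith
        then show "v \<in> f ` {Suc i..<Suc i + Suc (?n - 2)}"
        proof cases
          case 1
          then have "v = f m" "m \<in> {Suc i..<Suc i + Suc (?n - 2)}" using m n by (auto simp: f_def)
          then show ?thesis by blast
        next
          case 2
          then have "v = f (m + ?n)" "m + ?n \<in> {Suc i..<Suc i + Suc (?n - 2)}"
            using m n i by (auto simp: f_def)
          then show ?thesis by blast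
        qed
      qed
      show "f ` {Suc i..<Suc i + Suc (?n - 2)} \<subseteq> set vs - {b}"
      proof
        fix v assume "v \<in> f ` {Suc i..<Suc i + Suc (?n - 2)}"
        then obtain k where k: "Suc i \<le> k" "k < i + ?n" "v = f k" using n by auto
        have "k mod ?n \<noteq> i"
        proof (cases "k < ?n")
          case False
          then have "k mod ?n = k - ?n" using k i by (simp add: le_mod_geq)
          then show ?thesis using k False by simp
        qed (use k in simp)
        then show "v \<in> set vs - {b}"
          using k(3) fmod[of k] i nth_eq_iff_index_eq[OF dist fmod[of k] i(1)] by (simp add: f_def)
      qed
    qed
    then show "conn (set vs - {b})" using conn by simp
  qed
  then show ?thesis using n by (auto simp: bicon_def)
qed

text \<open>In a longest path, all neighbours of the first vertex lie on the path. One of them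
  differs from the second vertex, and the edge to it closes an initial segment of length at least
  three.\<close>

lemma min_degree_cycle_list:
  assumes fin: "finite S" and S: "S \<noteq> {}" and min2: "\<forall>v\<in>S. 2 \<le> deg S v"
  shows "\<exists>vs. cycle_list vs \<and> set vs \<subseteq> S"
proof -
  define P where "P p \<longleftrightarrow> distinct p \<and> p \<noteq> [] \<and> set p \<subseteq> S \<and>
    (\<forall>i. Suc i < length p \<longrightarrow> a (p ! i) (p ! Suc i) \<noteq> 0)" for p
  obtain s where "s \<in> S" using S by auto
  then have "P [s]" by (simp add: P_def)
  moreover have "\<forall>p. P p \<longrightarrow> length p \<le> card S"
    unfolding P_def using card_mono[OF fin] distinct_card by metis
  then have "\<forall>p. P p \<longrightarrow> length p < Suc (card S)" by (simp add: less_Suc_eq_le)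
  ultimately obtain p where Pp: "P p" "\<forall>q. P q \<longrightarrow> length q \<le> length p"
    using ex_has_greatest_nat[of P "[s]" length "Suc (card S)"] by auto
  note p = Pp(1)[unfolded P_def]
  let ?x = "p ! 0"
  have xS: "?x \<in> S" using p by auto
  have nb: "nbs S ?x \<subseteq> set p"
  proof
    fix v assume v: "v \<in> nbs S ?x"
    show "v \<in> set p"
    proof (rule ccontr)
      assume "v \<notin> set p"
      moreover have "a ((v # p) ! i) ((v # p) ! Suc i) \<noteq> 0" if "Suc i < length (v # p)" for i
        using that v p sym[of v ?x] by (cases i) (auto simp: nbs_def)
      ultimately have "P (v # p)" using p v by (auto simp: P_def nbs_def)
      then show False using Pp(2) by fastforce
    qed
  qed
  have "\<not> nbs S ?x \<subseteq> {p ! 1}"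
  proof
    assume "nbs S ?x \<subseteq> {p ! 1}"
    then have "card (nbs S ?x) \<le> card {p ! 1}" by (intro card_mono) auto
    then show False using min2 xS by (auto simp: deg_def)
  qed
  then obtain y where y: "y \<in> nbs S ?x" "y \<noteq> p ! 1" by auto
  have "y \<in> set p" using y nb by blast
  then obtain j where j: "j < length p" "y = p ! j" by (auto simp: in_set_conv_nth)
  have "y \<noteq> ?x" using y(1) irrefl by (auto simp: nbs_def)
  then have "j \<noteq> 0" "j \<noteq> 1" using y(2) j(2) by metis+
  then have j2: "2 \<le> j" by simp
  let ?c = "take (Suc j) p"
  have len: "length ?c = Suc j" using j by simp
  have "a u v \<noteq> 0" if "{u, v} \<in> cycle_edges ?c" for u v
  proof -
    obtain i where i: "i < Suc j" "{u, v} = {?c ! i, ?c ! (Suc i mod Suc j)}"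
      using \<open>{u, v} \<in> cycle_edges ?c\<close> unfolding cycle_edges_def len by blast
    have "a (?c ! i) (?c ! (Suc i mod Suc j)) \<noteq> 0"
    proof (cases "i = j")
      case True
      then show ?thesis using y j sym by (auto simp: nbs_def)
    next
      case False
      then show ?thesis using i p j by simp
    qed
    then show ?thesis using i(2) sym by (auto simp: doubleton_eq_iff)
  qed
  then have "cycle_list ?c" using p len j2 by (simp add: cycle_list_def)
  moreover have "set ?c \<subseteq> S" using p set_take_subset by fastforce
  ultimately show ?thesis by blast
qed

lemma nullcyc_cycle_list:
  assumes Z: "nullcyc Z"
  obtains vs where "cycle_list vs" "set vs = Z"
proof -
  have b: "bicon Z" "finite Z" using Z nullcyc_bicon nullcyc_finite by auto
  obtain vs where vs: "cycle_list vs" "set vs \<subseteq> Z"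
    using min_degree_cycle_list[of Z] b by (auto simp: bicon_def)
  have bv: "bicon (set vs)" using cycle_list_bicon[OF vs(1)] .
  have "deg Z v \<le> 2" if "v \<in> set vs" for v using nullcyc_deg[OF Z, of v] vs that by auto
  then have "closed_in Z (set vs)" by (rule bicon_closed_in[OF b(2) bv vs(2)])
  moreover have "set vs \<noteq> {}" using bv by (simp add: bicon_def)
  ultimately have "set vs = Z" using conn_closed_eq[OF bicon_conn[OF b(1)]] by simp
  then show ?thesis using that vs by blast
qed

lemma cycle_list_edges:
  assumes vs: "cycle_list vs" and d: "\<forall>v\<in>set vs. deg (set vs) v = 2"
    and uv: "u \<in> set vs" "v \<in> set vs" "a u v \<noteq> 0"
  shows "{u, v} \<in> cycle_edges vs"
proof -
  have dist: "distinct vs" using vs by (simp add: cycle_list_def)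
  obtain i where i: "i < length vs" "u = vs ! i" using uv by (auto simp: in_set_conv_nth)
  note nb = cycle_list_nbs[OF vs i(1)]
  have "{vs ! (Suc i mod length vs), vs ! ((i + length vs - 1) mod length vs)} = nbs (set vs) u"
    unfolding i(2) by (rule card_seteq) (use nb d uv i in \<open>auto simp: deg_def\<close>)
  then have "v \<in> {vs ! (Suc i mod length vs), vs ! ((i + length vs - 1) mod length vs)}"
    using uv by (simp add: nbs_def)
  then show ?thesis unfolding i(2) using cycle_edges_iff[OF dist i(1)] by auto
qed

lemma cycle_list_deg:
  assumes vs: "cycle_list vs"
    and e: "\<And>u v. u \<in> set vs \<Longrightarrow> v \<in> set vs \<Longrightarrow> a u v \<noteq> 0 \<Longrightarrow> {u, v} \<in> cycle_edges vs"
    and u: "u \<in> set vs"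
  shows "deg (set vs) u = 2"
proof -
  have dist: "distinct vs" using vs by (simp add: cycle_list_def)
  obtain i where i: "i < length vs" "u = vs ! i" using u by (auto simp: in_set_conv_nth)
  note nb = cycle_list_nbs[OF vs i(1)]
  have "nbs (set vs) u \<subseteq> {vs ! (Suc i mod length vs), vs ! ((i + length vs - 1) mod length vs)}"
    using e[OF u] cycle_edges_iff[OF dist i(1)] i(2) by (auto simp: nbs_def)
  then have "nbs (set vs) u = {vs ! (Suc i mod length vs), vs ! ((i + length vs - 1) mod length vs)}"
    using nb(1) i(2) by auto
  then show ?thesis using nb(2) by (simp add: deg_def)
qed

text \<open>A graph without cycles has a vertex of degree at most one; removing such a leaf lowers
  the degree sum by two.\<close>

lemma tree_degree_sum:
  assumes "finite T" "conn T" "\<And>vs. cycle_list vs \<Longrightarrow> \<not> set vs \<subseteq> T"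
  shows "(\<Sum>v\<in>T. deg T v) + 2 = 2 * card T"
  using assms
proof (induction "card T" arbitrary: T rule: less_induct)
  case less
  note fin = less.prems(1) and T = less.prems(2)
  obtain y where y: "y \<in> T" "\<not> 2 \<le> deg T y"
    using min_degree_cycle_list[OF fin conn_nonempty[OF T]] less.prems(3) by blast
  show ?case
  proof (cases "T = {y}")
    case True
    then have "deg T y = 0" by (simp add: deg_def nbs_def irrefl)
    then show ?thesis using True by simp
  next
    case False
    then have d1: "deg T y = 1" using deg_pos[OF fin T y(1)] y(2) by simp
    obtain w where w: "nbs T y = {w}" "w \<in> T" "a w y \<noteq> 0" "w \<noteq> y" using nbs_leaf[OF d1] by metis
    let ?U = "T - {y}"
    have wU: "w \<in> ?U" using w by auto
    have "card ?U < card T" using card_Diff1_less[OF fin y(1)] .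
    moreover have "\<not> set vs \<subseteq> ?U" if "cycle_list vs" for vs using less.prems(3)[OF that] by blast
    ultimately have IH: "(\<Sum>v\<in>?U. deg ?U v) + 2 = 2 * card ?U"
      using less.hyps[of ?U] conn_delete_leaf[OF T y(1) w(1)] fin by simp
    have "deg T v = deg ?U v + (if v = w then 1 else 0)" if "v \<in> ?U" for v
    proof -
      have "a v y \<noteq> 0 \<longleftrightarrow> v = w" using w(1,3) that sym[of v y] by (auto simp: nbs_def)
      then show ?thesis using deg_delete[OF fin y(1), of v] by simp
    qed
    then have "(\<Sum>v\<in>?U. deg T v) = (\<Sum>v\<in>?U. deg ?U v + (if v = w then 1 else 0))"
      by (intro sum.cong) auto
    also have "\<dots> = (\<Sum>v\<in>?U. deg ?U v) + 1" using fin wU by (simp add: sum.distrib)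
    finally have "(\<Sum>v\<in>T. deg T v) = (\<Sum>v\<in>?U. deg ?U v) + 2"
      using sum.remove[OF fin y(1), of "deg T"] d1 by simp
    moreover have "card T = Suc (card ?U)" using card_Suc_Diff1[OF fin y(1)] by (rule HOL.sym)
    ultimately show ?thesis using IH by simp
  qed
qed

text \<open>The graph is induced by the nonzero pattern of the weights on its vertices. Signs are
  left out, since connectivity, degrees and cycles see only this pattern.\<close>

definition represents :: "'a signed_graph \<Rightarrow> bool" where
  "represents H \<longleftrightarrow> signed_graph H \<and> (\<forall>u\<in>verts H. \<forall>v\<in>verts H. {u, v} \<in> edges H \<longleftrightarrow> a u v \<noteq> 0)"

lemma represents_edge:
  assumes "represents H" "{u, v} \<in> edges H"
  shows "u \<in> verts H" "v \<in> verts H" "a u v \<noteq> 0"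
  using assms by (force simp: represents_def signed_graph_def)+

lemma connected_graph_iff:
  assumes H: "represents H"
  shows "connected_graph H \<longleftrightarrow> conn (verts H)"
proof
  let ?R = "{(x, y). {x, y} \<in> edges H}"
  assume c: "connected_graph H"
  have "A = verts H" if A: "closed_in (verts H) A" "A \<noteq> {}" for A
  proof -
    obtain u where u: "u \<in> A" using A by auto
    have "v \<in> A" if v: "v \<in> verts H" for v
    proof -
      have "(u, v) \<in> ?R\<^sup>*"
        using c u v closed_in_subset[OF A(1)] by (auto simp: connected_graph_def reach_rel_def)
      then show ?thesis
      proof (induction rule: rtrancl_induct)
        case base then show ?case using u .
      next
        case (step x y)
        then show ?case using closed_in_step[OF A(1), of x y] represents_edge[OF H] by auto
      qed
    qed
    then show ?thesis using closed_in_subset[OF A(1)] by auto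
  qed
  then show "conn (verts H)" using c by (auto simp: conn_def connected_graph_def)
next
  let ?R = "{(x, y). {x, y} \<in> edges H}"
  assume c: "conn (verts H)"
  have "(u, v) \<in> reach_rel H" if u: "u \<in> verts H" and v: "v \<in> verts H" for u v
  proof -
    let ?A = "{v \<in> verts H. (u, v) \<in> ?R\<^sup>*}"
    have "closed_in (verts H) ?A"
      unfolding closed_in_def
    proof (intro conjI ballI)
      fix x y assume x: "x \<in> ?A" and y: "y \<in> verts H - ?A"
      show "a x y = 0"
      proof (rule ccontr)
        assume "a x y \<noteq> 0"
        then have "(x, y) \<in> ?R" using H x y by (auto simp: represents_def)
        then show False using x y by (auto intro: rtrancl_into_rtrancl)
      qed
    qed auto
    moreover have "u \<in> ?A" using u by simp
    ultimately have "?A = verts H" using conn_closed_eq[OF c] by blast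
    then show ?thesis using u v by (auto simp: reach_rel_def)
  qed
  then show "connected_graph H" using conn_nonempty[OF c] by (simp add: connected_graph_def)
qed

lemma vdegree_eq_deg:
  assumes H: "represents H" and v: "v \<in> verts H"
  shows "vdegree H v = deg (verts H) v"
proof -
  have "bij_betw (\<lambda>u. {v, u}) (nbs (verts H) v) {e \<in> edges H. v \<in> e}"
    unfolding bij_betw_def
  proof
    show "inj_on (\<lambda>u. {v, u}) (nbs (verts H) v)" by (auto simp: inj_on_def doubleton_eq_iff)
    show "(\<lambda>u. {v, u}) ` nbs (verts H) v = {e \<in> edges H. v \<in> e}"
    proof
      show "(\<lambda>u. {v, u}) ` nbs (verts H) v \<subseteq> {e \<in> edges H. v \<in> e}"
        using H v by (auto simp: nbs_def represents_def)
      show "{e \<in> edges H. v \<in> e} \<subseteq> (\<lambda>u. {v, u}) ` nbs (verts H) v"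
      proof
        fix e assume e: "e \<in> {e \<in> edges H. v \<in> e}"
        then have "card e = 2" using H by (auto simp: represents_def signed_graph_def)
        then obtain u where u: "e = {v, u}" using e by (auto simp: card_2_iff)
        then have "u \<in> nbs (verts H) v" using represents_edge[OF H, of v u] e by (simp add: nbs_def)
        then show "e \<in> (\<lambda>u. {v, u}) ` nbs (verts H) v" using u by blast
      qed
    qed
  qed
  then show ?thesis using bij_betw_same_card by (force simp: vdegree_def deg_def)
qed

lemma cycle_list_iff:
  assumes H: "represents H" and vs: "set vs \<subseteq> verts H" "distinct vs" "3 \<le> length vs"
  shows "cycle_edges vs \<subseteq> edges H \<longleftrightarrow> cycle_list vs"
proof
  assume "cycle_edges vs \<subseteq> edges H"
  then show "cycle_list vs" using vs represents_edge[OF H] by (auto simp: cycle_list_def)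
next
  assume c: "cycle_list vs"
  show "cycle_edges vs \<subseteq> edges H"
  proof
    fix e assume e: "e \<in> cycle_edges vs"
    then obtain i where i: "i < length vs" "e = {vs ! i, vs ! (Suc i mod length vs)}"
      by (auto simp: cycle_edges_def)
    have "Suc i mod length vs < length vs" using i by (intro mod_less_divisor) auto
    then have "vs ! i \<in> verts H" "vs ! (Suc i mod length vs) \<in> verts H" using i vs by auto
    moreover have "a (vs ! i) (vs ! (Suc i mod length vs)) \<noteq> 0" using c e i by (simp add: cycle_list_def)
    ultimately show "e \<in> edges H" using H i by (simp add: represents_def)
  qed
qed

lemma acyclic_graph_iff:
  assumes H: "represents H"
  shows "acyclic_graph H \<longleftrightarrow> (\<forall>vs. cycle_list vs \<longrightarrow> \<not> set vs \<subseteq> verts H)"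
  using cycle_list_iff[OF H] unfolding acyclic_graph_def by (metis cycle_list_def)

end

section \<open>Edge counts and nullities of signed graphs\<close>

lemma handshake:
  assumes "signed_graph G"
  shows "(\<Sum>v\<in>verts G. vdegree G v) = 2 * card (edges G)"
proof -
  have fV: "finite (verts G)" and E: "\<And>e. e \<in> edges G \<Longrightarrow> e \<subseteq> verts G \<and> card e = 2"
    using assms by (auto simp: signed_graph_def)
  have fE: "finite (edges G)" by (rule finite_subset[of _ "Pow (verts G)"]) (use E fV in auto)
  have "(\<Sum>v\<in>verts G. vdegree G v) = (\<Sum>v\<in>verts G. \<Sum>e\<in>edges G. if v \<in> e then 1 else 0)"
    unfolding vdegree_def using fE by (simp add: sum.If_cases Int_def)
  also have "\<dots> = (\<Sum>e\<in>edges G. \<Sum>v\<in>verts G. if v \<in> e then 1 else 0)" by (rule sum.swap)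
  also have "\<dots> = (\<Sum>e\<in>edges G. card e)"
  proof (rule sum.cong[OF refl])
    fix e assume e: "e \<in> edges G"
    have "(\<Sum>v\<in>verts G. if v \<in> e then 1 else 0) = card (verts G \<inter> e)" using fV by (simp add: sum.If_cases)
    also have "verts G \<inter> e = e" using E[OF e] by auto
    finally show "(\<Sum>v\<in>verts G. if v \<in> e then 1 else 0) = card e" .
  qed
  also have "\<dots> = 2 * card (edges G)" using E by simp
  finally show ?thesis .
qed

lemma cyclomatic_connected:
  assumes "connected_graph G"
  shows "cyclomatic G = int (card (edges G)) - int (card (verts G)) + 1"
proof -
  have "reach_rel G = verts G \<times> verts G" using assms by (auto simp: connected_graph_def reach_rel_def)
  then have "components G = {verts G}"
    using assms by (auto simp: components_def quotient_def connected_graph_def)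
  then show ?thesis by (simp add: cyclomatic_def)
qed

lemma adj_entry_sym: "adj_entry G u v = adj_entry G v u"
  by (simp add: adj_entry_def insert_commute)

lemma adj_entry_nonzero: "adj_entry G u v \<noteq> 0 \<longleftrightarrow> {u, v} \<in> edges G"
  by (cases "esign G {u, v}") (auto simp: adj_entry_def)

lemma weighted_graph_adj_entry:
  assumes "signed_graph G" shows "weighted_graph (adj_entry G)"
proof
  fix u v
  show "adj_entry G u v = adj_entry G v u" by (rule adj_entry_sym)
  have "{v, v} \<notin> edges G" using assms by (auto simp: signed_graph_def)
  then show "adj_entry G v v = 0" by (simp add: adj_entry_def)
qed

lemma nullity_eq_eta:
  assumes "finite (verts G)"
  shows "nullity G = eta (adj_entry G) (verts G)"
proof -
  obtain vs where vs: "set vs = verts G" "distinct vs" using finite_distinct_list[OF assms] by auto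
  then show ?thesis
    using nullity_eq[of vs G] order_char_poly_eq_eta[of vs "adj_entry G"] adj_entry_sym[of G]
    by (simp add: adj_mat_def)
qed

lemma nullity_eq_eta_subgraph:
  assumes "finite (verts H)"
    and "\<And>u v. u \<in> verts H \<Longrightarrow> v \<in> verts H \<Longrightarrow> {u, v} \<in> edges H \<longleftrightarrow> {u, v} \<in> edges G"
    and "\<And>e. e \<in> edges H \<Longrightarrow> esign H e = esign G e"
  shows "nullity H = eta (adj_entry G) (verts H)"
  unfolding nullity_eq_eta[OF assms(1)] using assms(2,3) by (intro eta_cong) (simp add: adj_entry_def)

section \<open>The decomposition\<close>

context weighted_graph
begin

text \<open>The cycles are indexed by their attaching vertices; two pendant cycles at the same
  vertex coincide, so \<open>C l\<close> is determined. What remains is acyclic because every cycle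
  is pendant, hence is some \<open>C l\<close>, of which only the vertex \<open>l\<close>
  survives.\<close>

lemma extremal_leaf_free_decomposition:
  assumes S: "extremal S" and min2: "\<forall>v\<in>S. 2 \<le> deg S v" and Phi: "3 \<le> Phi S"
  shows "\<exists>I C. finite I \<and> (\<forall>l\<in>I. pendant S (C l) l) \<and>
    (\<forall>l\<in>I. \<forall>m\<in>I. l \<noteq> m \<longrightarrow> C l \<inter> C m = {}) \<and>
    (\<forall>vs. cycle_list vs \<longrightarrow> \<not> set vs \<subseteq> S - (\<Union>l\<in>I. C l - {l}))"
proof -
  have fin: "finite S" using S by (simp add: extremal_def)
  define I where "I = {l. \<exists>Z. pendant S Z l}"
  define C where "C l = (SOME Z. pendant S Z l)" for l
  have C: "pendant S (C l) l" if "l \<in> I" for l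
    using that unfolding I_def C_def by (auto intro: someI_ex)
  have "I \<subseteq> S" by (auto simp: I_def pendant_def)
  then have finI: "finite I" using fin finite_subset by blast
  have disj: "C l \<inter> C m = {}" if "l \<in> I" "m \<in> I" "l \<noteq> m" for l m
  proof -
    have "C l \<noteq> C m" using C[OF that(1)] C[OF that(2)] that(3) by (auto simp: pendant_def)
    then show ?thesis using pendant_disjoint[OF fin C C] that by blast
  qed
  have "\<not> set vs \<subseteq> S - (\<Union>l\<in>I. C l - {l})" if vs: "cycle_list vs" for vs
  proof
    assume sub: "set vs \<subseteq> S - (\<Union>l\<in>I. C l - {l})"
    then obtain l where l: "pendant S (set vs) l"
      using extremal_leaf_free_pendant[OF S min2 Phi cycle_list_bicon[OF vs]] by blast
    then have lI: "l \<in> I" by (auto simp: I_def)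
    have "l \<in> set vs" "l \<in> C l" using l C[OF lI] by (auto simp: pendant_def)
    then have "C l = set vs" using pendant_disjoint[OF fin C[OF lI] l] by auto
    then have "set vs \<subseteq> {l}" using sub lI by auto
    then have "card (set vs) \<le> card {l}" by (intro card_mono) auto
    then show False using vs distinct_card[of vs] by (simp add: cycle_list_def)
  qed
  then show ?thesis using finI C disj by (intro exI[of _ I] exI[of _ C]) simp
qed

lemma pruned_tree_leaves:
  assumes S: "finite S" "conn S" and min2: "\<forall>v\<in>S. 2 \<le> deg S v"
    and I: "finite I" "\<And>l. l \<in> I \<Longrightarrow> pendant S (C l) l"
      "\<And>l m. l \<in> I \<Longrightarrow> m \<in> I \<Longrightarrow> l \<noteq> m \<Longrightarrow> C l \<inter> C m = {}"
  defines "T \<equiv> S - (\<Union>l\<in>I. C l - {l})"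
  assumes acyc: "\<And>vs. cycle_list vs \<Longrightarrow> \<not> set vs \<subseteq> T"
  shows "conn T" "\<eta> S = \<eta> T + card I" "{t \<in> T. deg T t = 1} = I" "2 * card I = Phi S + 2"
proof -
  have pr: "\<eta> S = \<eta> T + card I" "Phi S = Phi T + card I" "conn T"
    "\<And>i. i \<in> I \<Longrightarrow> i \<in> T \<and> deg T i = 1" "\<And>t. t \<in> T - I \<Longrightarrow> deg T t = deg S t"
    using pendant_prune_all[of I S C "\<lambda>l. l", OF I(1) S(1) I(2,3), folded T_def] S(2) by auto
  show "conn T" "\<eta> S = \<eta> T + card I" by (rule pr)+
  have finT: "finite T" using S(1) by (simp add: T_def)
  have big: "2 \<le> deg T t" if "t \<in> T - I" for t using pr(5)[OF that] min2 that by (auto simp: T_def)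
  show "{t \<in> T. deg T t = 1} = I" using pr(4) big by force
  \<comment> \<open>Truncation affects only the leaves, each by one. Hence the degree sum plus
    \<open>card I\<close> is \<open>Phi T + 2 * card T\<close>, and the tree formula gives
    \<open>card I = Phi T + 2\<close>.\<close>
  have "(\<Sum>t\<in>T. deg T t + (if t \<in> I then 1 else 0)) = (\<Sum>t\<in>T. (deg T t - 2) + 2)"
  proof (rule sum.cong[OF refl])
    fix t assume "t \<in> T"
    then show "deg T t + (if t \<in> I then 1 else 0) = (deg T t - 2) + 2"
      using pr(4)[of t] big[of t] by auto
  qed
  moreover have "T \<inter> I = I" using pr(4) by auto
  ultimately have "(\<Sum>t\<in>T. deg T t) + card I = Phi T + 2 * card T"
    unfolding sum.distrib Phi_def using finT by (simp add: sum.If_cases)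
  then show "2 * card I = Phi S + 2"
    using tree_degree_sum[OF finT pr(3) acyc] pr(2) by simp
qed

end

section \<open>Passing between the signed graph and the tree with its cycles\<close>

lemma leaf_free_min_degree:
  assumes G: "signed_graph G" "connected_graph G" "leaf_free G" "cyclomatic G \<ge> 1"
  shows "\<forall>v\<in>verts G. 2 \<le> vdegree G v"
proof
  interpret W: weighted_graph "adj_entry G" using G(1) by (rule weighted_graph_adj_entry)
  have rep: "W.represents G" using G(1) by (simp add: W.represents_def adj_entry_nonzero)
  have fin: "finite (verts G)" using G(1) by (simp add: signed_graph_def)
  have c: "W.conn (verts G)" using W.connected_graph_iff[OF rep] G(2) by simp
  fix v assume v: "v \<in> verts G"
  have "leaves G = {}" using G(3) fin by (simp add: leaf_free_def num_leaves_def leaves_def)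
  then have "vdegree G v \<noteq> 1" using v by (auto simp: leaves_def)
  moreover have "vdegree G v \<noteq> 0"
  proof
    assume d: "vdegree G v = 0"
    then have V: "verts G = {v}"
      using W.deg_pos[OF fin c v] W.vdegree_eq_deg[OF rep v] by auto
    then have "card (edges G) = 0" using handshake[OF G(1)] d by simp
    then show False using cyclomatic_connected[OF G(2)] V G(4) by simp
  qed
  ultimately show "2 \<le> vdegree G v" by simp
qed

lemma cyclomatic_degree_sum:
  assumes "signed_graph G" "connected_graph G"
  shows "2 * cyclomatic G = int (\<Sum>v\<in>verts G. vdegree G v) - 2 * int (card (verts G)) + 2"
  unfolding cyclomatic_connected[OF assms(2)] handshake[OF assms(1)] by simp

lemma nullity_imp_attached:
  fixes G :: "'a signed_graph"
  assumes G: "signed_graph G" "connected_graph G" "leaf_free G" and c3: "cyclomatic G \<ge> 3"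
    and null: "int (nullity G) = 2 * cyclomatic G - 1"
  shows "\<exists>(T :: 'a signed_graph) C. signed_tree T \<and> int (num_leaves T) = cyclomatic G \<and>
    int (nullity T) = int (num_leaves T) - 1 \<and>
    (\<forall>l\<in>leaves T. signed_cycle (C l) \<and> nullity (C l) = 2) \<and> attached_at_leaves T C G"
proof -
  interpret W: weighted_graph "adj_entry G" using G(1) by (rule weighted_graph_adj_entry)
  let ?V = "verts G" and ?E = "edges G"
  have rep: "W.represents G" using G(1) by (simp add: W.represents_def adj_entry_nonzero)
  have fin: "finite ?V" and E: "\<And>e. e \<in> ?E \<Longrightarrow> e \<subseteq> ?V \<and> card e = 2"
    using G(1) by (auto simp: signed_graph_def)
  have conn: "W.conn ?V" using W.connected_graph_iff[OF rep] G(2) by simp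
  have min2: "\<forall>v\<in>?V. 2 \<le> W.deg ?V v"
    using leaf_free_min_degree[OF G] c3 W.vdegree_eq_deg[OF rep] by auto
  have "(\<Sum>v\<in>?V. vdegree G v) = (\<Sum>v\<in>?V. (W.deg ?V v - 2) + 2)"
    using W.vdegree_eq_deg[OF rep] min2 by (intro sum.cong) auto
  then have "(\<Sum>v\<in>?V. vdegree G v) = W.Phi ?V + 2 * card ?V"
    unfolding W.Phi_def sum.distrib by simp
  then have Phi: "2 * cyclomatic G = int (W.Phi ?V) + 2" using cyclomatic_degree_sum[OF G(1,2)] by simp
  have nul: "nullity G = eta (adj_entry G) ?V" by (rule nullity_eq_eta[OF fin])
  have ext: "W.extremal ?V" using null Phi nul fin conn by (simp add: W.extremal_def)
  have Phi3: "3 \<le> W.Phi ?V" using Phi c3 by simp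
  obtain I C where IC: "finite I \<and> (\<forall>l\<in>I. W.pendant ?V (C l) l) \<and>
    (\<forall>l\<in>I. \<forall>m\<in>I. l \<noteq> m \<longrightarrow> C l \<inter> C m = {}) \<and>
    (\<forall>vs. W.cycle_list vs \<longrightarrow> \<not> set vs \<subseteq> ?V - (\<Union>l\<in>I. C l - {l}))"
    using W.extremal_leaf_free_decomposition[OF ext min2 Phi3] by (elim exE)
  then have I: "finite I" "\<And>l. l \<in> I \<Longrightarrow> W.pendant ?V (C l) l"
    "\<And>l m. l \<in> I \<Longrightarrow> m \<in> I \<Longrightarrow> l \<noteq> m \<Longrightarrow> C l \<inter> C m = {}"
    and acyc: "\<And>vs. W.cycle_list vs \<Longrightarrow> \<not> set vs \<subseteq> ?V - (\<Union>l\<in>I. C l - {l})"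
    by simp_all
  define VT where "VT = ?V - (\<Union>l\<in>I. C l - {l})"
  note pr = W.pruned_tree_leaves[OF fin conn min2 I acyc, folded VT_def]
  \<comment> \<open>Tree and cycles are taken as induced subgraphs of \<open>G\<close>, so their
    matrices are restrictions of the weight function of \<open>G\<close>.\<close>
  define sub where "sub X = \<lparr>verts = X, edges = {e \<in> ?E. e \<subseteq> X}, esign = esign G\<rparr>" for X :: "'a set"
  have sub_sel: "verts (sub X) = X" "edges (sub X) = {e \<in> ?E. e \<subseteq> X}" "esign (sub X) = esign G" for X
    by (simp_all add: sub_def)
  have rep_sub: "W.represents (sub X)" if "X \<subseteq> ?V" for X
    using that E finite_subset[OF that fin]
    by (auto simp: W.represents_def signed_graph_def sub_sel adj_entry_nonzero)
  have nul_sub: "nullity (sub X) = eta (adj_entry G) X" if "X \<subseteq> ?V" for X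
    using nullity_eq_eta_subgraph[of "sub X" G] finite_subset[OF that fin] by (simp add: sub_sel)
  have CV: "C l \<subseteq> ?V" "l \<in> C l" "W.nullcyc (C l)" if "l \<in> I" for l
    using I(2)[OF that] by (auto simp: W.pendant_def)
  have VT: "VT \<subseteq> ?V" by (auto simp: VT_def)
  let ?T = "sub VT" and ?C = "\<lambda>l. sub (C l)"
  have leaves: "leaves ?T = I"
    using pr(3) W.vdegree_eq_deg[OF rep_sub[OF VT]] by (auto simp: leaves_def sub_sel)
  have tree: "signed_tree ?T"
    using rep_sub[OF VT] pr(1) acyc W.connected_graph_iff[OF rep_sub[OF VT]]
      W.acyclic_graph_iff[OF rep_sub[OF VT]]
    by (simp add: signed_tree_def W.represents_def sub_sel VT_def)
  have num: "int (num_leaves ?T) = cyclomatic G" using pr(4) Phi by (simp add: num_leaves_def leaves)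
  \<comment> \<open>Pruning c cycles from nullity 2 c - 1 leaves c - 1.\<close>
  have nulT: "int (nullity ?T) = int (num_leaves ?T) - 1"
    using pr(2) nul null num nul_sub[OF VT] by (simp add: num_leaves_def leaves)
  have cyc: "signed_cycle (?C l) \<and> nullity (?C l) = 2" if l: "l \<in> I" for l
  proof
    obtain vs where vs: "W.cycle_list vs" "set vs = C l" using W.nullcyc_cycle_list[OF CV(3)[OF l]] .
    have dist: "distinct vs" "3 \<le> length vs" using vs by (auto simp: W.cycle_list_def)
    have "edges (?C l) = cycle_edges vs"
    proof
      show "cycle_edges vs \<subseteq> edges (?C l)"
        using W.cycle_list_iff[OF rep_sub[OF CV(1)[OF l]] _ dist] vs by (simp add: sub_sel)
      show "edges (?C l) \<subseteq> cycle_edges vs"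
      proof
        fix e assume e: "e \<in> edges (?C l)"
        then have "card e = 2" using E by (simp add: sub_sel)
        then obtain u v where uv: "e = {u, v}" by (auto simp: card_2_iff)
        then show "e \<in> cycle_edges vs"
          using W.cycle_list_edges[OF vs(1), of u v] vs(2) W.nullcyc_deg[OF CV(3)[OF l]] e
          by (auto simp: sub_sel adj_entry_nonzero)
      qed
    qed
    then show "signed_cycle (?C l)" unfolding signed_cycle_def using dist vs(2) by (auto simp: sub_sel)
    show "nullity (?C l) = 2" using nul_sub[OF CV(1)[OF l]] CV(3)[OF l] by (simp add: W.nullcyc_def)
  qed
  have CT: "C l \<inter> VT = {l}" if l: "l \<in> I" for l
    using CV[OF l] I(3)[OF l] CV(2) l by (auto simp: VT_def)
  \<comment> \<open>An edge not inside the tree has an end on some \<open>C l\<close> away from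
    \<open>l\<close>, and all neighbours of such a vertex lie on \<open>C l\<close>.\<close>
  have "e \<subseteq> VT \<or> (\<exists>l\<in>I. e \<subseteq> C l)" if e: "e \<in> ?E" for e
  proof (cases "e \<subseteq> VT")
    case False
    obtain u v where uv: "e = {u, v}" using E[OF e] by (auto simp: card_2_iff)
    have "\<exists>l\<in>I. u \<in> C l - {l} \<or> v \<in> C l - {l}" using False E[OF e] uv by (auto simp: VT_def)
    then obtain l where l: "l \<in> I" "u \<in> C l - {l} \<or> v \<in> C l - {l}" by blast
    have "u \<in> W.nbs ?V v" "v \<in> W.nbs ?V u"
      using e E[OF e] unfolding uv by (auto simp: W.nbs_def adj_entry_nonzero insert_commute)
    then have "u \<in> C l \<and> v \<in> C l"
      using l(2) W.pendant_nbs[OF fin I(2)[OF l(1)], of u] W.pendant_nbs[OF fin I(2)[OF l(1)], of v] by blast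
    then show ?thesis using l uv by auto
  qed simp
  then have edges: "?E = edges ?T \<union> (\<Union>l\<in>I. edges (?C l))" by (auto simp: sub_sel)
  have verts: "?V = VT \<union> (\<Union>l\<in>I. C l)" using CV(1) VT by (auto simp: VT_def)
  have "attached_at_leaves ?T ?C G"
    unfolding attached_at_leaves_def leaves
    using CT I(3) verts edges by (simp add: sub_sel)
  then show ?thesis
    using tree num nulT cyc leaves by (intro exI[of _ ?T] exI[of _ ?C] conjI) simp_all
qed

text \<open>The attached cycles are pendant in the sense of \<open>pendant\<close>, and pruning all
  of them leaves exactly \<open>T\<close>; each accounts for one unit of nullity.\<close>

lemma attached_imp_nullity:
  assumes G: "signed_graph G"
    and T: "signed_tree T" and C: "\<forall>l\<in>leaves T. signed_cycle (C l) \<and> nullity (C l) = 2"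
    and att: "attached_at_leaves T C G"
  shows "nullity G = nullity T + num_leaves T"
proof -
  interpret W: weighted_graph "adj_entry G" using G by (rule weighted_graph_adj_entry)
  let ?V = "verts G" and ?E = "edges G" and ?L = "leaves T"
  have fin: "finite ?V" and E: "\<And>e. e \<in> ?E \<Longrightarrow> e \<subseteq> ?V \<and> card e = 2"
    using G by (auto simp: signed_graph_def)
  have sT: "signed_graph T" using T by (simp add: signed_tree_def)
  have finT: "finite (verts T)" and ET: "\<And>e. e \<in> edges T \<Longrightarrow> e \<subseteq> verts T \<and> card e = 2"
    using sT by (auto simp: signed_graph_def)
  have CT: "\<And>l. l \<in> ?L \<Longrightarrow> verts (C l) \<inter> verts T = {l}"
    and CC: "\<And>l m. l \<in> ?L \<Longrightarrow> m \<in> ?L \<Longrightarrow> l \<noteq> m \<Longrightarrow> verts (C l) \<inter> verts (C m) = {}"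
    and V: "?V = verts T \<union> (\<Union>l\<in>?L. verts (C l))"
    and Ed: "?E = edges T \<union> (\<Union>l\<in>?L. edges (C l))"
    and sgT: "\<And>e. e \<in> edges T \<Longrightarrow> esign G e = esign T e"
    and sgC: "\<And>l e. l \<in> ?L \<Longrightarrow> e \<in> edges (C l) \<Longrightarrow> esign G e = esign (C l) e"
    using att by (simp_all add: attached_at_leaves_def)
  have cyc: "\<exists>vs. distinct vs \<and> 3 \<le> length vs \<and> verts (C l) = set vs \<and> edges (C l) = cycle_edges vs"
    if "l \<in> ?L" for l using C that by (simp add: signed_cycle_def)
  have EC: "e \<subseteq> verts (C l)" if l: "l \<in> ?L" and e: "e \<in> edges (C l)" for l e
  proof -
    obtain vs where vs: "3 \<le> length vs" "verts (C l) = set vs" "edges (C l) = cycle_edges vs" using cyc[OF l] by blast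
    have "Suc i mod length vs < length vs" for i using vs(1) by (intro mod_less_divisor) auto
    then show ?thesis using e vs by (auto simp: cycle_edges_def)
  qed
  \<comment> \<open>An edge of some \<open>C l\<close> with both ends in \<open>T\<close> would have
    both ends equal to \<open>l\<close>. Thus \<open>T\<close> is an induced subgraph.\<close>
  have inT: "e \<in> edges T" if "e \<in> ?E" "e \<subseteq> verts T" for e
  proof (rule ccontr)
    assume "e \<notin> edges T"
    then have "e \<in> (\<Union>l\<in>?L. edges (C l))" using that(1) unfolding Ed by simp
    then obtain l where l: "l \<in> ?L" "e \<in> edges (C l)" by blast
    have "e \<subseteq> verts (C l) \<inter> verts T" using EC[OF l] that(2) by simp
    then have "e \<subseteq> {l}" unfolding CT[OF l(1)] .
    then have "card e \<le> card {l}" by (intro card_mono) auto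
    then show False using E[OF that(1)] by simp
  qed
  have inC: "e \<in> edges (C l)" if l: "l \<in> ?L" and e: "e \<in> ?E" "e \<inter> (verts (C l) - {l}) \<noteq> {}" for l e
  proof (rule ccontr)
    assume n: "e \<notin> edges (C l)"
    have "e \<notin> edges T" using ET[of e] CT[OF l] e(2) by blast
    then have "e \<in> (\<Union>l\<in>?L. edges (C l))" using e(1) unfolding Ed by simp
    then obtain m where m: "m \<in> ?L" "e \<in> edges (C m)" by blast
    then have "m \<noteq> l" using n by auto
    then show False using EC[OF m] CC[OF l m(1)] e(2) by auto
  qed
  have inC': "e \<in> edges (C l)" if l: "l \<in> ?L" and e: "e \<in> ?E" "e \<subseteq> verts (C l)" for l e
  proof (rule inC[OF l e(1)])
    show "e \<inter> (verts (C l) - {l}) \<noteq> {}"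
    proof
      assume "e \<inter> (verts (C l) - {l}) = {}"
      then have "e \<subseteq> {l}" using e(2) by blast
      then have "card e \<le> card {l}" by (intro card_mono) auto
      then show False using E[OF e(1)] by simp
    qed
  qed
  have repT: "W.represents T"
    unfolding W.represents_def adj_entry_nonzero using sT inT Ed by blast
  have pend: "W.pendant ?V (verts (C l)) l" if l: "l \<in> ?L" for l
  proof -
    let ?Z = "verts (C l)"
    obtain vs where vs: "distinct vs" "3 \<le> length vs" "?Z = set vs" "edges (C l) = cycle_edges vs"
      using cyc[OF l] by blast
    have ZV: "?Z \<subseteq> ?V" using V l by blast
    have lZ: "l \<in> ?Z" "l \<in> verts T" using CT[OF l] by blast+
    have eq: "{u, v} \<in> edges (C l) \<longleftrightarrow> {u, v} \<in> ?E" if "u \<in> ?Z" "v \<in> ?Z" for u v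
      using inC'[OF l, of "{u, v}"] that Ed l by blast
    have cl: "W.cycle_list vs"
      using vs Ed l by (auto simp: W.cycle_list_def adj_entry_nonzero)
    have "{u, v} \<in> cycle_edges vs" if "u \<in> set vs" "v \<in> set vs" "adj_entry G u v \<noteq> 0" for u v
      using that eq[of u v] vs by (simp add: adj_entry_nonzero)
    then have d2: "W.deg ?Z u = 2" if "u \<in> ?Z" for u using W.cycle_list_deg[OF cl] that vs(3) by simp
    have "eta (adj_entry G) ?Z = nullity (C l)"
      using eq sgC[OF l] vs(3) by (intro nullity_eq_eta_subgraph[symmetric]) auto
    then have nc: "W.nullcyc ?Z"
      using C l d2 W.cycle_list_bicon[OF cl] vs(3) by (simp add: W.nullcyc_def)
    have "W.nbs ?V u = W.nbs ?Z u" if u: "u \<in> ?Z - {l}" for u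
    proof -
      have "v \<in> ?Z" if "{u, v} \<in> ?E" for v using inC[OF l that] u EC[OF l] by blast
      then show ?thesis using ZV by (auto simp: W.nbs_def adj_entry_nonzero)
    qed
    then have du: "\<forall>u\<in>?Z - {l}. W.deg ?V u = 2" using d2 by (simp add: W.deg_def)
    \<comment> \<open>At \<open>l\<close> the degree is one from the leaf of \<open>T\<close> plus
      two from the cycle. Edges of another cycle cannot reach \<open>l\<close>, because the cycles
      are disjoint.\<close>
    have "W.nbs ?V l = W.nbs (verts T) l \<union> W.nbs ?Z l"
    proof -
      have "v \<in> verts T \<or> v \<in> ?Z" if v: "v \<in> ?V" "{l, v} \<in> ?E" for v
      proof (rule ccontr)
        assume n: "\<not> (v \<in> verts T \<or> v \<in> ?Z)"
        then obtain m where m: "m \<in> ?L" "v \<in> verts (C m)" using v V by blast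
        have "v \<noteq> m" using n m by (auto simp: leaves_def)
        then have "{l, v} \<in> edges (C m)" using inC[OF m(1) v(2)] m by blast
        then have "l \<in> verts (C m)" using EC[OF m(1)] by blast
        then show False using CC[OF l m(1)] n m lZ by blast
      qed
      then show ?thesis using ZV V by (auto simp: W.nbs_def adj_entry_nonzero)
    qed
    moreover have "W.nbs (verts T) l \<inter> W.nbs ?Z l = W.nbs (?Z \<inter> verts T) l" by (auto simp: W.nbs_def)
    then have "W.nbs (verts T) l \<inter> W.nbs ?Z l = {}"
      unfolding CT[OF l] by (auto simp: W.nbs_def W.irrefl)
    moreover have "W.deg (verts T) l = 1"
      using W.vdegree_eq_deg[OF repT lZ(2)] l by (simp add: leaves_def)
    ultimately have "W.deg ?V l = 3"
      using d2[OF lZ(1)] finT vs(3) by (simp add: W.deg_def card_Un_disjoint)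
    then show ?thesis using ZV nc lZ du by (simp add: W.pendant_def)
  qed
  have VT: "verts T = ?V - (\<Union>l\<in>?L. verts (C l) - {l})"
  proof
    show "verts T \<subseteq> ?V - (\<Union>l\<in>?L. verts (C l) - {l})" using V CT by blast
    show "?V - (\<Union>l\<in>?L. verts (C l) - {l}) \<subseteq> verts T" using V CT by blast
  qed
  have finL: "finite ?L" using finT by (simp add: leaves_def)
  have "eta (adj_entry G) ?V = eta (adj_entry G) (verts T) + card ?L"
    using W.pendant_prune_all[of ?L ?V "\<lambda>l. verts (C l)" "\<lambda>l. l", OF finL fin pend CC, folded VT] by blast
  moreover have "nullity T = eta (adj_entry G) (verts T)"
    using inT Ed sgT by (intro nullity_eq_eta_subgraph[OF finT]) auto
  ultimately show ?thesis using nullity_eq_eta[OF fin] by (simp add: num_leaves_def)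
qed

theorem theorem5p3:
  fixes \<Gamma> :: "'a signed_graph"
  assumes "signed_graph \<Gamma>"
    and "connected_graph \<Gamma>"
    and "leaf_free \<Gamma>"
    and "cyclomatic \<Gamma> \<ge> 3"
  shows "int (nullity \<Gamma>) = 2 * cyclomatic \<Gamma> - 1 \<longleftrightarrow>
    (\<exists>(T :: 'a signed_graph) C.
        signed_tree T \<and>
        int (num_leaves T) = cyclomatic \<Gamma> \<and>
        int (nullity T) = int (num_leaves T) - 1 \<and>
        (\<forall>l\<in>leaves T. signed_cycle (C l) \<and> nullity (C l) = 2) \<and>
        attached_at_leaves T C \<Gamma>)"
proof
  assume "int (nullity \<Gamma>) = 2 * cyclomatic \<Gamma> - 1"
  then show "\<exists>(T :: 'a signed_graph) C. signed_tree T \<and> int (num_leaves T) = cyclomatic \<Gamma> \<and>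
      int (nullity T) = int (num_leaves T) - 1 \<and>
      (\<forall>l\<in>leaves T. signed_cycle (C l) \<and> nullity (C l) = 2) \<and> attached_at_leaves T C \<Gamma>"
    using nullity_imp_attached[OF assms] by simp
next
  assume "\<exists>(T :: 'a signed_graph) C. signed_tree T \<and> int (num_leaves T) = cyclomatic \<Gamma> \<and>
      int (nullity T) = int (num_leaves T) - 1 \<and>
      (\<forall>l\<in>leaves T. signed_cycle (C l) \<and> nullity (C l) = 2) \<and> attached_at_leaves T C \<Gamma>"
  then obtain T :: "'a signed_graph" and C where T: "signed_tree T" "int (num_leaves T) = cyclomatic \<Gamma>"
      "int (nullity T) = int (num_leaves T) - 1"
      "\<forall>l\<in>leaves T. signed_cycle (C l) \<and> nullity (C l) = 2" "attached_at_leaves T C \<Gamma>"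
    by blast
  then show "int (nullity \<Gamma>) = 2 * cyclomatic \<Gamma> - 1"
    using attached_imp_nullity[OF assms(1) T(1,4,5)] by simp
qed

end
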